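(* Let $m$ and $\alpha$ be positive integers and $F_m^{(4)}(z)=1+\sum_{\lambda\ge1}f_\lambda^{(4)}(m)z^\lambda$. If $p$ is a prime with $p\equiv1\pmod4$, then there is $\overline P_\alpha(z)\in\mathbb{Z}[z]$ with $F_m^{(4)}(z)\equiv\overline P_\alpha(z)/Q_{(p-1)/4}(z)^\alpha$ coefficientwise modulo $p^\alpha$, where $Q_{(p-1)/4}(z)$ is a polynomial of degree $(p-1)/4$. If $p$ is a prime with $p\equiv3\pmod4$, then there is $\widehat P_\alpha(z)\in\mathbb{Z}[z]$ with $F_m^{(4)}(z)\equiv\widehat P_\alpha(z)/Q_{(p-3)/4}(z)^\alpha$ coefficientwise modulo $p^\alpha$, where $Q_{(p-3)/4}(z)$ is a polynomial of degree $(p-3)/4$.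
   Context: For a positive integer $m$, $\Gamma_m(4)=\langle x,y\mid x^{2m}=y^{4m}=1,\ x^2=y^4\rangle$ and $f_\lambda^{(4)}(m)$ is the number of free subgroups of index $4m\lambda$ in $\Gamma_m(4)$. For integers $n\ge0$, $Q_n(z)=\sum_{k=0}^n q_{n,k}z^k$, where for $0\le k\le n$ $$q_{n,n-k}=\frac{(-1)^n(4m)^{n-k}}{(\frac12-k)_{2k+1}}\Bigg(\Big(\tfrac34\Big)_{n+1}\sum_{j=0}^k\binom{k+j}{k}\binom{n-j}{k-j}\Big(\tfrac12+j\Big)_{k-j}\Big(\tfrac14\Big)_j-\Big(\tfrac14\Big)_{n+1}\sum_{j=0}^k\binom{k+j}{k}\binom{n-j}{k-j}\Big(\tfrac32+j\Big)_{k-j}\Big(\tfrac34\Big)_j\Bigg),$$ with $(\alpha)_r=\alpha(\alpha+1)\cdots(\alpha+r-1)$, $(\alpha)_0=1$. (These $q_{n,k}$ are integers and $q_{n,0}=1$; $Q_n$ is the specialization $A=4m-2$, $B=4m$, $C=1$, $D=1-4m+3m^2$, $E=2m$ of the denominator of the Padé-type rational solution of $(1-Az)F-Bz^2F'-CzF^2-1-Dz=0$.) "$F\equiv P/Q^\alpha$ modulo $p^\alpha$" means that the coefficients of $F$ and of the power series $P\cdot Q^{-\alpha}$ agree modulo $p^\alpha$. *)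

theory Defs
  imports
    "HOL-Algebra.Coset"
    "HOL-Computational_Algebra.Polynomial_FPS"
    "HOL-Computational_Algebra.Primes"
    "HOL-Number_Theory.Cong"
begin

(* The letter (x, True) stands for the generator x and (x, False) for its inverse. *)
type_synonym 'x gword = "('x \<times> bool) list"

definition gwords :: "'x set \<Rightarrow> 'x gword set" where
  "gwords X = lists (X \<times> UNIV)"

(* A relation r = s is given as the pair (r, s). *)
inductive pres_equiv :: "'x set \<Rightarrow> ('x gword \<times> 'x gword) set \<Rightarrow> 'x gword \<Rightarrow> 'x gword \<Rightarrow> bool"
  for X :: "'x set" and R :: "('x gword \<times> 'x gword) set" where
  refl: "w \<in> gwords X \<Longrightarrow> pres_equiv X R w w"
| sym: "pres_equiv X R v w \<Longrightarrow> pres_equiv X R w v"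
| trans: "pres_equiv X R u v \<Longrightarrow> pres_equiv X R v w \<Longrightarrow> pres_equiv X R u w"
| cancel: "u \<in> gwords X \<Longrightarrow> v \<in> gwords X \<Longrightarrow> x \<in> X \<Longrightarrow>
    pres_equiv X R (u @ [(x, b), (x, \<not> b)] @ v) (u @ v)"
| relation: "u \<in> gwords X \<Longrightarrow> v \<in> gwords X \<Longrightarrow> (r, s) \<in> R \<Longrightarrow>
    r \<in> gwords X \<Longrightarrow> s \<in> gwords X \<Longrightarrow>
    pres_equiv X R (u @ r @ v) (u @ s @ v)"

definition pres_rel :: "'x set \<Rightarrow> ('x gword \<times> 'x gword) set \<Rightarrow> ('x gword \<times> 'x gword) set" where
  "pres_rel X R = {(v, w). pres_equiv X R v w}"

definition presented_group ::
    "'x set \<Rightarrow> ('x gword \<times> 'x gword) set \<Rightarrow> 'x gword set monoid" where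
  "presented_group X R =
    \<lparr> carrier = gwords X // pres_rel X R,
      monoid.mult = (\<lambda>A B. \<Union>v\<in>A. \<Union>w\<in>B. pres_rel X R `` {v @ w}),
      one = pres_rel X R `` {[]} \<rparr>"

definition free_group_on :: "'x set \<Rightarrow> 'x gword set monoid" where
  "free_group_on S = presented_group S {}"

(* Taking the index set S in the type of the elements of G is no restriction,
   since a basis of G is a subset of its carrier. *)
definition is_free_group :: "('a, 'b) monoid_scheme \<Rightarrow> bool" where
  "is_free_group G \<longleftrightarrow> (\<exists>S :: 'a set. free_group_on S \<cong> G)"

datatype Gamma_gen = GenX | GenY

definition gen_pow :: "'x \<Rightarrow> nat \<Rightarrow> 'x gword" where
  "gen_pow g k = replicate k (g, True)"

definition Gamma4 :: "nat \<Rightarrow> Gamma_gen gword set monoid" where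
  "Gamma4 m = presented_group {GenX, GenY}
    {(gen_pow GenX (2 * m), []), (gen_pow GenY (4 * m), []), (gen_pow GenX 2, gen_pow GenY 4)}"

(* Used only for m > 0 and l > 0. The index 4 * m * l is then positive, so
   the convention that infinite sets have cardinality 0 does not let
   subgroups of infinite index in. *)
definition free_subgroups4 :: "nat \<Rightarrow> nat \<Rightarrow> Gamma_gen gword set set set" where
  "free_subgroups4 m l =
    {H. subgroup H (Gamma4 m) \<and> is_free_group ((Gamma4 m)\<lparr>carrier := H\<rparr>) \<and>
        card (rcosets\<^bsub>Gamma4 m\<^esub> H) = 4 * m * l}"

definition f4 :: "nat \<Rightarrow> nat \<Rightarrow> nat" where
  "f4 m l = card (free_subgroups4 m l)"

definition F4 :: "nat \<Rightarrow> int fps" where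
  "F4 m = Abs_fps (\<lambda>l. if l = 0 then 1 else int (f4 m l))"

(* q_rev m n k is the coefficient of z^(n - k) in Q_n; it is integral, but is
   defined by a formula in rational numbers. *)
definition q_rev :: "nat \<Rightarrow> nat \<Rightarrow> nat \<Rightarrow> rat" where
  "q_rev m n k =
    (-1) ^ n * (4 * of_nat m) ^ (n - k) / pochhammer (1/2 - of_nat k) (2 * k + 1) *
    (pochhammer (3/4) (n + 1) *
       (\<Sum>j=0..k. of_nat ((k + j) choose k) * of_nat ((n - j) choose (k - j)) *
          pochhammer (1/2 + of_nat j) (k - j) * pochhammer (1/4) j)
     - pochhammer (1/4) (n + 1) *
       (\<Sum>j=0..k. of_nat ((k + j) choose k) * of_nat ((n - j) choose (k - j)) *
          pochhammer (3/2 + of_nat j) (k - j) * pochhammer (3/4) j))"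

definition Q4 :: "nat \<Rightarrow> nat \<Rightarrow> rat poly" where
  "Q4 m n = (\<Sum>i=0..n. monom (q_rev m n (n - i)) i)"

(* Coefficientwise congruence modulo M, where a and b are congruent if
   a - b is M times an integer. *)
definition fps_cong_mod :: "rat fps \<Rightarrow> rat fps \<Rightarrow> nat \<Rightarrow> bool" where
  "fps_cong_mod F G M \<longleftrightarrow>
    (\<forall>n. \<exists>c :: int. fps_nth F n - fps_nth G n = of_nat M * of_int c)"

definition rat_fps_of_int_fps :: "int fps \<Rightarrow> rat fps" where
  "rat_fps_of_int_fps F = Abs_fps (\<lambda>n. of_int (fps_nth F n))"

definition rat_fps_of_int_poly :: "int poly \<Rightarrow> rat fps" where
  "rat_fps_of_int_poly P = fps_of_poly (map_poly of_int P)"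

end

theory Submission
  imports Defs "HOL-Combinatorics.Cycles"
begin

text \<open>
  Put \<open>H = \<Sum>\<^sub>k h\<^sub>k z\<^sup>k\<close> with \<open>h\<^sub>k = (4m)\<^sup>k (1/4)\<^sub>k (3/4)\<^sub>k / k!\<close>. The free subgroups of finite
  index are the point stabilizers of the finite actions in which both generators act
  semiregularly (with full orders \<open>2m\<close> and \<open>4m\<close>): such a stabilizer has a basis indexed by the
  edges outside a spanning tree of the graph of orbits, and conversely a free group is torsion
  free. There are \<open>(4mk)! h\<^sub>k\<close> such actions on \<open>4mk\<close> points, and splitting off the orbit of a
  base point gives \<open>F H = H + 4 m z H'\<close>.

  Modulo every power of an odd prime \<open>p\<close> the series \<open>H\<close> is a polynomial. Contiguous relations
  between the series \<open>W\<^sub>n\<close> with parameters \<open>n + 1/4\<close>, \<open>n + 3/4\<close> give, with \<open>x = 4mz\<close>,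
  \<open>H = Q\<^sub>n W\<^sub>n - (n + 1/4) (n + 3/4) x\<^sup>2 Q\<^sub>n\<^sub>-\<^sub>1 W\<^sub>n\<^sub>+\<^sub>1\<close>, because \<open>Q\<^sub>n\<close> satisfies the corresponding
  three-term recurrence; its initial values amount to a terminating case of Watson's theorem on
  \<open>\<^sub>3F\<^sub>2\<close>, proved here through moments of Legendre polynomials. If \<open>p = 4n + 1\<close> or
  \<open>p = 4n + 3\<close>, then \<open>H \<equiv> Q\<^sub>n\<close> modulo \<open>p\<close>. Hence \<open>Q\<^sub>n\<^sup>\<alpha>\<close> is a multiple of \<open>H\<close> modulo \<open>p\<^sup>\<alpha>\<close>, and
  \<open>Q\<^sub>n\<^sup>\<alpha> F\<close> is a polynomial modulo \<open>p\<^sup>\<alpha>\<close>.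
\<close>

section \<open>The three-term recurrence of the denominators\<close>

text \<open>The obstacle is the explicit formula for \<open>Q\<^sub>n\<close>: a difference of two
  rational sums, from which neither integrality nor a congruence can be read off. Iterating the
  contiguous relation from \<open>H = W\<^sub>0\<close> produces continuants with integer
  coefficients and constant term 1, so everything rests on showing that the formula satisfies their
  recurrence. The prime enters through odd numbers: \<open>4\<^sup>k k! h\<^sub>k\<close> is
  \<open>m\<^sup>k\<close> times the product of the first 2k odd numbers. For odd p this product is
  p-integrally divisible by (2k)!, so after division by k! a factor k! survives, and it tends to 0
  p-adically. For \<open>W\<^sub>n\<close> the product starts at 4n + 1. If p is 4n + 1 or 4n + 3,
  it is one of the first two factors, and it also divides the constant (4n + 1)(4n + 3) of the
  second term in the formula for H. Hence \<open>W\<^sub>n\<close> is 1 and the second term is 0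
  modulo p; this fixes the index n and separates the two classes of primes. The exponent \<alpha> of
  the denominator is needed because \<open>Q\<^sub>n\<close> agrees with H only modulo p.\<close>

text \<open>Coefficients of the Legendre polynomial \<open>P\<^sub>n(1 - 2x)\<close>.\<close>

definition legendre_coeff :: "nat \<Rightarrow> nat \<Rightarrow> 'a :: field_char_0" where
  "legendre_coeff n j = (-1) ^ j * of_nat ((n + j) choose j) * of_nat (n choose j)"

lemma legendre_coeff_eq_0 [simp]: "j > n \<Longrightarrow> legendre_coeff n j = 0"
  by (simp add: legendre_coeff_def)

lemma legendre_coeff_0 [simp]: "legendre_coeff n 0 = 1"
  by (simp add: legendre_coeff_def)

lemma legendre_coeff_Suc:
  "of_nat (Suc j) ^ 2 * legendre_coeff n (Suc j) =
     - (of_nat n + of_nat j + 1) * (of_nat n - of_nat j) * (legendre_coeff n j :: 'a :: field_char_0)"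
proof -
  have 1: "of_nat (Suc j) * of_nat ((n + Suc j) choose Suc j) =
      (of_nat n + of_nat j + 1) * (of_nat ((n + j) choose j) :: 'a)"
    using Suc_times_binomial[of j "n + j"]
    by (metis (no_types, lifting) add_Suc_right of_nat_Suc of_nat_add of_nat_mult add.commute add.left_commute)
  have 2: "of_nat (Suc j) * of_nat (n choose Suc j) = (of_nat n - of_nat j) * (of_nat (n choose j) :: 'a)"
  proof (cases "j \<le> n")
    case True
    have "Suc j * (n choose Suc j) = (n - j) * (n choose j)"
      by (metis binomial_absorb_comp binomial_absorption)
    then show ?thesis
      using True by (metis of_nat_diff of_nat_mult)
  qed (simp add: binomial_eq_0)
  have "of_nat (Suc j) ^ 2 * legendre_coeff n (Suc j) =
      - ((-1) ^ j * (of_nat (Suc j) * of_nat ((n + Suc j) choose Suc j)) * (of_nat (Suc j) * of_nat (n choose Suc j)) :: 'a)"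
    by (simp add: legendre_coeff_def power2_eq_square algebra_simps)
  then show ?thesis
    unfolding 1 2 by (simp add: legendre_coeff_def algebra_simps)
qed

lemma legendre_coeff_Suc_upper:
  "of_nat (Suc j) ^ 2 * legendre_coeff (Suc n) (Suc j) =
     - (of_nat n + of_nat j + 2) * (of_nat n + of_nat j + 1) * (legendre_coeff n j :: 'a :: field_char_0)"
proof -
  have 1: "of_nat (Suc j) * of_nat ((Suc n + Suc j) choose Suc j) =
      (of_nat n + of_nat j + 2) * (of_nat ((Suc n + j) choose j) :: 'a)"
  proof -
    have "Suc j * ((Suc n + Suc j) choose Suc j) = (n + j + 2) * ((Suc n + j) choose j)"
      using Suc_times_binomial[of j "Suc n + j"] by simp
    then show ?thesis
      by (metis (no_types, lifting) of_nat_add of_nat_mult of_nat_numeral)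
  qed
  have 2: "of_nat (Suc j) * of_nat (Suc n choose Suc j) = of_nat (Suc n) * (of_nat (n choose j) :: 'a)"
    using Suc_times_binomial[of j n] by (metis of_nat_mult)
  have 3: "of_nat (Suc n) * of_nat ((Suc n + j) choose j) = (of_nat n + of_nat j + 1) * (of_nat ((n + j) choose j) :: 'a)"
  proof -
    have "Suc n * ((Suc n + j) choose j) = (n + j + 1) * ((n + j) choose j)"
      using binomial_absorb_comp[of "Suc n + j" j] by simp
    then show ?thesis
      by (metis (no_types, lifting) of_nat_1 of_nat_add of_nat_mult)
  qed
  have "of_nat (Suc j) ^ 2 * legendre_coeff (Suc n) (Suc j) =
      - ((-1) ^ j * (of_nat (Suc j) * of_nat ((Suc n + Suc j) choose Suc j)) * (of_nat (Suc j) * of_nat (Suc n choose Suc j)) :: 'a)"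
    by (simp add: legendre_coeff_def power2_eq_square algebra_simps)
  also have "\<dots> = - ((-1) ^ j * (of_nat n + of_nat j + 2) * (of_nat (Suc n) * of_nat ((Suc n + j) choose j)) * of_nat (n choose j))"
    unfolding 1 2 by (simp add: algebra_simps)
  finally show ?thesis
    unfolding 3 by (simp add: legendre_coeff_def algebra_simps)
qed

lemma legendre_coeff_swap:
  "(of_nat n + of_nat j + 1) * legendre_coeff n j = (of_nat n - of_nat j + 1) * (legendre_coeff (Suc n) j :: 'a :: field_char_0)"
proof -
  have A: "of_nat (Suc n) * of_nat ((Suc n + j) choose j) = (of_nat n + of_nat j + 1) * (of_nat ((n + j) choose j) :: 'a)"
  proof -
    have "Suc n * ((Suc n + j) choose j) = (n + j + 1) * ((n + j) choose j)"
      using binomial_absorb_comp[of "Suc n + j" j] by simp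
    then show ?thesis
      by (metis (no_types, lifting) of_nat_1 of_nat_add of_nat_mult)
  qed
  have B: "of_nat (Suc n) * of_nat (n choose j) = (of_nat n - of_nat j + 1) * (of_nat (Suc n choose j) :: 'a)"
  proof (cases "j \<le> Suc n")
    case True
    have "Suc n * (n choose j) = (Suc n - j) * (Suc n choose j)"
      using binomial_absorb_comp[of "Suc n" j] by simp
    then have "of_nat (Suc n) * of_nat (n choose j) = (of_nat (Suc n - j) :: 'a) * of_nat (Suc n choose j)"
      by (metis of_nat_mult)
    then show ?thesis using True by (simp add: of_nat_diff algebra_simps)
  qed (simp add: binomial_eq_0)
  have "(of_nat n + of_nat j + 1) * legendre_coeff n j =
    (-1) ^ j * ((of_nat n + of_nat j + 1) * of_nat ((n + j) choose j)) * (of_nat (n choose j) :: 'a)"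
    by (simp add: legendre_coeff_def algebra_simps)
  also have "\<dots> = (-1) ^ j * of_nat ((Suc n + j) choose j) * (of_nat (Suc n) * of_nat (n choose j))"
    unfolding A[symmetric] by (simp add: algebra_simps)
  finally show ?thesis
    unfolding B by (simp add: legendre_coeff_def algebra_simps)
qed

lemma legendre_coeff_lower:
  "of_nat (Suc j) ^ 2 * legendre_coeff n (Suc j) =
     - (of_nat n - of_nat j) * (of_nat n - of_nat j + 1) * (legendre_coeff (Suc n) j :: 'a :: field_char_0)"
proof -
  show ?thesis unfolding legendre_coeff_Suc using legendre_coeff_swap
    by (metis (no_types, lifting) mult.assoc mult.left_commute mult_minus_left)
qed

text \<open>The coefficientwise certificate for the two-step recurrence of the moments: weighted by
  a moment, the left side becomes a difference in \<open>j\<close>. All coefficients are rational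
  multiples of \<open>legendre_coeff (Suc n) j\<close>, so this is an identity of rational
  functions.\<close>

lemma legendre_coeff_rec:
  fixes a :: "'a :: field_char_0"
  shows "2 * (2 * of_nat n + 3) * ((of_nat (Suc j) + a) * legendre_coeff (Suc n) (Suc j) -
            (2 * a + of_nat j) * legendre_coeff (Suc n) j) =
         (of_nat n + 2) * (of_nat n + 1 + 2 * a) * legendre_coeff (Suc (Suc n)) (Suc j) -
         (of_nat n + 1) * (of_nat n + 2 - 2 * a) * legendre_coeff n (Suc j)"
proof -
  define J :: 'a where "J = of_nat (Suc j)"
  have J: "J \<noteq> 0" "of_nat j = J - 1" unfolding J_def
     using of_nat_neq_0 by auto
  define N :: 'a where "N = of_nat n"
  define Y :: 'a where "Y = legendre_coeff (Suc n) j"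
  have 1: "legendre_coeff (Suc n) (Suc j) = - (N + J + 1) * (N - J + 2) * Y / J^2"
    using legendre_coeff_Suc[of j "Suc n", where 'a = 'a] J by (simp add: J_def[symmetric] N_def Y_def field_simps)
  have 2: "legendre_coeff (Suc (Suc n)) (Suc j) = - (N + J + 2) * (N + J + 1) * Y / J^2"
    using legendre_coeff_Suc_upper[of j "Suc n", where 'a = 'a] J by (simp add: J_def[symmetric] N_def Y_def field_simps)
  have 3: "legendre_coeff n (Suc j) = - (N - J + 1) * (N - J + 2) * Y / J^2"
    using legendre_coeff_lower[of j n, where 'a = 'a] J by (simp add: J_def[symmetric] N_def Y_def field_simps)
  show ?thesis
    unfolding 1 2 3 J_def[symmetric] N_def[symmetric] Y_def[symmetric] J(2)
    using J(1) by (simp add: divide_simps) (simp add: algebra_simps power2_eq_square)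
qed

section \<open>Moments of Legendre polynomials for a symmetric beta distribution\<close>

text \<open>For real \<open>a > 0\<close> this is the \<open>j\<close>-th moment of the Beta(a, a)
  distribution on [0, 1], which is symmetric about 1/2.\<close>

definition beta_moment :: "'a :: field_char_0 \<Rightarrow> nat \<Rightarrow> 'a" where
  "beta_moment a j = pochhammer a j / pochhammer (2 * a) j"

text \<open>The terminating series 3F2(-n, n + 1, a; 1, 2a; 1) of Watson's theorem, read as the
  expectation of a shifted Legendre polynomial.\<close>

definition legendre_moment :: "'a :: field_char_0 \<Rightarrow> nat \<Rightarrow> 'a" where
  "legendre_moment a n = (\<Sum>j\<le>n. legendre_coeff n j * beta_moment a j)"

text \<open>The corresponding expectation of x p'(x), where p is the shifted Legendre
  polynomial.\<close>

definition legendre_deriv_moment :: "'a :: field_char_0 \<Rightarrow> nat \<Rightarrow> 'a" where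
  "legendre_deriv_moment a n = (\<Sum>j\<le>n. of_nat j * legendre_coeff n j * beta_moment a j)"

lemma sum_legendre_extend:
  fixes f :: "nat \<Rightarrow> 'a :: field_char_0"
  assumes "n \<le> M"
  shows "(\<Sum>j\<le>n. g j * legendre_coeff n j * f j) = (\<Sum>j\<le>M. g j * legendre_coeff n j * f j)"
  using assms by (intro sum.mono_neutral_left) auto

lemma legendre_moment_extend:
  "n \<le> M \<Longrightarrow> legendre_moment a n = (\<Sum>j\<le>M. legendre_coeff n j * beta_moment a j)"
  using sum_legendre_extend[of n M "\<lambda>_. 1" "beta_moment a"] by (simp add: legendre_moment_def)

lemma beta_moment_Suc:
  assumes "\<And>j. 2 * a + of_nat j \<noteq> 0"
  shows "(2 * a + of_nat j) * beta_moment a (Suc j) = (a + of_nat j) * beta_moment a j"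
  using assms[of j] by (simp add: beta_moment_def pochhammer_rec')

lemma legendre_moment_1:
  assumes "2 * a \<noteq> 0"
  shows "legendre_moment a (Suc 0) = 0"
  using assms by (simp add: legendre_moment_def legendre_coeff_def beta_moment_def)

text \<open>Creative telescoping with \<open>legendre_coeff_rec\<close>. Since the moment of index 1
  is 0, all odd moments vanish, as the symmetry about 1/2 demands.\<close>

lemma legendre_moment_rec:
  fixes a :: "'a :: field_char_0"
  assumes nz: "\<And>j. 2 * a + of_nat j \<noteq> 0"
  shows "(of_nat n + 2) * (of_nat n + 1 + 2 * a) * legendre_moment a (Suc (Suc n)) =
         (of_nat n + 1) * (of_nat n + 2 - 2 * a) * legendre_moment a n"
proof -
  \<comment> \<open>The antidifference in \<open>j\<close>. It is 0 at the lower end by definition,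
    and at the upper end because \<open>legendre_coeff (Suc n) (n + 2) = 0\<close>.\<close>
  define f :: "nat \<Rightarrow> 'a" where
    "f j = (case j of 0 \<Rightarrow> 0 | Suc i \<Rightarrow> 2 * (2 * of_nat n + 3) * legendre_coeff (Suc n) i * (2 * a + of_nat i) * beta_moment a (Suc i))" for j
  have step: "(of_nat n + 2) * (of_nat n + 1 + 2 * a) * (legendre_coeff (Suc (Suc n)) j * beta_moment a j)
        - (of_nat n + 1) * (of_nat n + 2 - 2 * a) * (legendre_coeff n j * beta_moment a j) =
        f (Suc j) - f j" for j
  proof (cases j)
    case 0
    have "f (Suc j) = 2 * (2 * of_nat n + 3) * a"
      using nz[of 0] by (simp add: f_def 0 beta_moment_def)
    moreover have "f j = 0" by (simp add: f_def 0)
    ultimately show ?thesis by (simp add: 0 beta_moment_def algebra_simps)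
  next
    case (Suc i)
    have "f (Suc j) = 2 * (2 * of_nat n + 3) * legendre_coeff (Suc n) j * ((a + of_nat j) * beta_moment a j)"
      unfolding beta_moment_Suc[OF nz, symmetric] by (simp add: f_def algebra_simps)
    moreover have "f j = 2 * (2 * of_nat n + 3) * legendre_coeff (Suc n) i * (2 * a + of_nat i) * beta_moment a j"
      by (simp add: f_def Suc)
    ultimately have "f (Suc j) - f j = (2 * (2 * of_nat n + 3) * ((of_nat (Suc i) + a) * legendre_coeff (Suc n) (Suc i) -
            (2 * a + of_nat i) * legendre_coeff (Suc n) i)) * beta_moment a j"
      unfolding Suc by (simp only: ring_distribs) (simp add: algebra_simps)
    then show ?thesis
      unfolding legendre_coeff_rec Suc by (simp add: algebra_simps)
  qed
  have e: "legendre_moment a n = (\<Sum>j\<le>Suc (Suc n). legendre_coeff n j * beta_moment a j)"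
    by (rule legendre_moment_extend) simp
  have "(of_nat n + 2) * (of_nat n + 1 + 2 * a) * legendre_moment a (Suc (Suc n)) -
        (of_nat n + 1) * (of_nat n + 2 - 2 * a) * legendre_moment a n = (\<Sum>j\<le>Suc (Suc n). f (Suc j) - f j)"
    unfolding e legendre_moment_def[of a "Suc (Suc n)"] sum_distrib_left sum_subtractf[symmetric] step ..
  also have "\<dots> = f (Suc (Suc (Suc n))) - f 0"
    unfolding lessThan_Suc_atMost[symmetric] by (rule sum_lessThan_telescope)
  also have "\<dots> = 0"
    by (simp add: f_def)
  finally show ?thesis by simp
qed

text \<open>The expectation of x (p_{n+1}' + p_n') = (n + 1) (p_{n+1} - p_n), which is
  \<open>legendre_coeff_swap\<close> coefficient by coefficient.\<close>

lemma legendre_deriv_moment_rec: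
  fixes a :: "'a :: field_char_0"
  shows "legendre_deriv_moment a (Suc n) + legendre_deriv_moment a n =
     of_nat (Suc n) * (legendre_moment a (Suc n) - legendre_moment a n)"
proof -
  have e: "legendre_moment a n = (\<Sum>j\<le>Suc n. legendre_coeff n j * beta_moment a j)"
    by (rule legendre_moment_extend) simp
  have e': "legendre_deriv_moment a n = (\<Sum>j\<le>Suc n. of_nat j * legendre_coeff n j * beta_moment a j)"
    unfolding legendre_deriv_moment_def by (rule sum_legendre_extend) simp
  have "legendre_deriv_moment a (Suc n) + legendre_deriv_moment a n - of_nat (Suc n) * (legendre_moment a (Suc n) - legendre_moment a n)
     = (\<Sum>j\<le>Suc n. ((of_nat n + of_nat j + 1) * legendre_coeff n j - (of_nat n - of_nat j + 1) * legendre_coeff (Suc n) j) * beta_moment a j)"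
    unfolding e e' legendre_deriv_moment_def[of a "Suc n"] legendre_moment_def[of a "Suc n"]
      sum_distrib_left sum.distrib[symmetric] sum_subtractf[symmetric]
    by (rule sum.cong[OF HOL.refl]) (simp add: algebra_simps)
  then show ?thesis
    unfolding legendre_coeff_swap by simp
qed

text \<open>Solves the first-order recurrence for the derivative moments; the closed form propagates
  by the two-step recurrence of the moments. The factor \<open>2 * (1 - a)\<close> becomes
  \<open>2 * b\<close> for the partner \<open>b = 1 - a\<close>.\<close>

lemma legendre_deriv_moment_eq:
  fixes a :: "'a :: field_char_0"
  assumes nz: "\<And>j. 2 * a + of_nat j \<noteq> 0"
  shows "2 * (1 - a) * legendre_deriv_moment a (Suc n) =
    of_nat (Suc n) * ((of_nat n + 2) * legendre_moment a (Suc n) - (of_nat n + 2 - 2 * a) * legendre_moment a n)"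
proof (induction n)
  case 0
  have "legendre_deriv_moment a (Suc 0) = - 1"
    using nz[of 0] by (simp add: legendre_deriv_moment_def legendre_coeff_def beta_moment_def)
  moreover have "legendre_moment a 0 = 1" by (simp add: legendre_moment_def beta_moment_def)
  moreover have "legendre_moment a (Suc 0) = 0" using nz[of 0] by (intro legendre_moment_1) auto
  ultimately show ?case by simp
next
  case (Suc n)
  define N :: 'a where "N = of_nat n"
  define M0 M1 M2 where "M0 = legendre_moment a n" "M1 = legendre_moment a (Suc n)" "M2 = legendre_moment a (Suc (Suc n))"
  have 1: "legendre_deriv_moment a (Suc (Suc n)) = (N + 2) * (M2 - M1) - legendre_deriv_moment a (Suc n)"
    using legendre_deriv_moment_rec[of a "Suc n"] by (simp add: N_def M0_M1_M2_def algebra_simps)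
  have 2: "(N + 2) * (N + 1 + 2 * a) * M2 = (N + 1) * (N + 2 - 2 * a) * M0"
    unfolding N_def M0_M1_M2_def by (rule legendre_moment_rec[OF nz])
  have "2 * (1 - a) * legendre_deriv_moment a (Suc (Suc n)) =
     2 * (1 - a) * (N + 2) * (M2 - M1) - 2 * (1 - a) * legendre_deriv_moment a (Suc n)"
    unfolding 1 by (simp add: algebra_simps)
  also have "\<dots> = 2 * (1 - a) * (N + 2) * (M2 - M1) - (N + 1) * ((N + 2) * M1 - (N + 2 - 2 * a) * M0)"
    unfolding Suc.IH by (simp add: N_def M0_M1_M2_def algebra_simps)
  also have "\<dots> = 2 * (1 - a) * (N + 2) * (M2 - M1) - (N + 1) * (N + 2) * M1 + (N + 1) * (N + 2 - 2 * a) * M0"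
    by (simp add: algebra_simps)
  also have "\<dots> = (N + 2) * ((N + 3) * M2 - (N + 3 - 2 * a) * M1)"
    unfolding 2[symmetric] by (simp add: algebra_simps)
  finally show ?case by (simp add: N_def M0_M1_M2_def algebra_simps)
qed

text \<open>The inner sums of \<^const>\<open>q_rev\<close> (with \<open>a = 1/4\<close> and \<open>a = 3/4\<close>), made polynomial
  in \<open>x = n\<close>.\<close>

definition pade_coeff :: "'a :: field_char_0 \<Rightarrow> nat \<Rightarrow> nat \<Rightarrow> 'a" where
  "pade_coeff a k j = of_nat ((k + j) choose k) * pochhammer (2 * a + of_nat j) (k - j) * pochhammer a j"

definition pade_sum :: "'a :: field_char_0 \<Rightarrow> 'a \<Rightarrow> nat \<Rightarrow> 'a" where
  "pade_sum a x k = (\<Sum>j\<le>k. pade_coeff a k j * ((x - of_nat j) gchoose (k - j)))"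

text \<open>The comparison of coefficients behind \<open>pade_sum_rec\<close>: the two terms on the
  left come from the two binomials that \<open>gbinomial_three_term\<close> leaves.\<close>

lemma pade_coeff_rec:
  assumes "j \<le> k"
  shows "(of_nat (Suc k) - of_nat j + 1 - 2 * a) * pade_coeff a (Suc k) j
      + (if j = 0 then 0 else (of_nat j - 1 + a) * pade_coeff a (Suc k) (j - 1)) =
    (of_nat k + 2 * a) * (of_nat k + 2 - 2 * a) * pade_coeff a k j"
proof (cases j)
  case 0
  then show ?thesis by (simp add: pade_coeff_def pochhammer_rec' algebra_simps)
next
  case (Suc i)
  obtain d where d: "k = Suc i + d" using assms Suc by (metis le_iff_add)
  define P where "P = pochhammer (2 * a + of_nat j) (k - j) * pochhammer a i"
  define B0 B1 :: 'a where "B0 = of_nat ((k + j) choose k)" "B1 = of_nat ((k + j) choose Suc k)"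
  have k: "(of_nat k :: 'a) = of_nat i + of_nat d + 1" by (simp add: d)
  have 1: "pade_coeff a (Suc k) j = (B0 + B1) * (2 * a + of_nat k) * (a + of_nat i) * P"
  proof -
    have "pochhammer (2 * a + of_nat j) (Suc k - j) = (2 * a + of_nat k) * pochhammer (2 * a + of_nat j) (k - j)"
      using assms by (simp add: Suc_diff_le pochhammer_rec' of_nat_diff)
    moreover have "pochhammer a j = (a + of_nat i) * pochhammer a i"
      by (simp add: Suc pochhammer_rec')
    moreover have "of_nat ((Suc k + j) choose Suc k) = B0 + B1"
      by (simp add: B0_B1_def)
    ultimately show ?thesis by (simp add: pade_coeff_def P_def)
  qed
  have 2: "pade_coeff a (Suc k) i = B1 * (2 * a + of_nat i) * (2 * a + of_nat k) * P"
  proof -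
    have "Suc k - i = Suc (Suc (k - j))" using d Suc by simp
    then have "pochhammer (2 * a + of_nat i) (Suc k - i) = (2 * a + of_nat i) * (pochhammer (2 * a + of_nat j) (Suc (k - j)))"
      using Suc by (simp add: pochhammer_rec[of _ "Suc _"] add_ac)
    also have "pochhammer (2 * a + of_nat j) (Suc (k - j)) = (2 * a + of_nat k) * pochhammer (2 * a + of_nat j) (k - j)"
      using d Suc by (simp add: pochhammer_rec' add_ac)
    finally show ?thesis using Suc by (simp add: pade_coeff_def P_def B0_B1_def)
  qed
  have 3: "pade_coeff a k j = B0 * (a + of_nat i) * P"
    by (simp add: pade_coeff_def P_def B0_B1_def Suc pochhammer_rec')
  have 4: "(of_nat k + 1) * B1 = (of_nat i + 1) * B0"
  proof -
    have "Suc k * ((k + j) choose Suc k) = j * ((k + j) choose k)"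
      by (metis add_diff_cancel_left' binomial_absorb_comp binomial_absorption)
    then show ?thesis unfolding B0_B1_def Suc by (metis of_nat_Suc of_nat_mult add.commute)
  qed
  have "(of_nat (Suc k) - of_nat j + 1 - 2 * a) * pade_coeff a (Suc k) j
      + (if j = 0 then 0 else (of_nat j - 1 + a) * pade_coeff a (Suc k) (j - 1))
    = (2 * a + of_nat k) * (a + of_nat i) * P * ((of_nat k - of_nat i + 1 - 2 * a) * (B0 + B1) + (2 * a + of_nat i) * B1)"
    unfolding 1 using Suc 2 by (simp add: algebra_simps)
  also have "\<dots> = (2 * a + of_nat k) * (a + of_nat i) * P * ((of_nat k - of_nat i + 1 - 2 * a) * B0 + (of_nat k + 1) * B1)"
    by (simp add: algebra_simps)
  also have "\<dots> = (2 * a + of_nat k) * (a + of_nat i) * P * (of_nat k + 2 - 2 * a) * B0"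
    unfolding 4 by (simp add: algebra_simps)
  finally show ?thesis unfolding 3 by (simp add: algebra_simps)
qed

text \<open>The coefficients \<open>x + 2 - a\<close>, \<open>-(2 * x + 2)\<close>,
  \<open>x + a\<close> of this difference operator add up to 0, so it lowers degrees. On the
  binomial basis it hits only two neighbouring elements of the next lower level.\<close>

lemma gbinomial_three_term:
  fixes x :: "'a :: field_char_0"
  shows "(x + 2 - a) * ((x + 1 - of_nat j) gchoose Suc i) - (2 * x + 2) * ((x - of_nat j) gchoose Suc i)
      + (x + a) * ((x - 1 - of_nat j) gchoose Suc i) =
    (of_nat i + 2 - 2 * a) * ((x - of_nat j) gchoose i) +
      (if i = 0 then 0 else (of_nat j + a) * ((x - 1 - of_nat j) gchoose (i - 1)))"
proof -
  define u where "u = x - of_nat j"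
  have x: "x = u + of_nat j" by (simp add: u_def)
  have 1: "(u + 1) gchoose Suc i = (u gchoose Suc i) + (u gchoose i)"
    by (subst gbinomial_addition_formula) simp
  have 2: "u gchoose Suc i = ((u - 1) gchoose Suc i) + ((u - 1) gchoose i)"
    by (rule gbinomial_addition_formula)
  show ?thesis
  proof (cases i)
    case 0
    then show ?thesis by (simp add: algebra_simps)
  next
    case (Suc l)
    have 3: "u gchoose i = ((u - 1) gchoose i) + ((u - 1) gchoose l)"
      unfolding Suc by (rule gbinomial_addition_formula)
    have 4: "of_nat i * (u gchoose i) = u * ((u - 1) gchoose l)"
      unfolding Suc by (rule gbinomial_absorption)
    define A B C where "A = (u - 1) gchoose Suc i" "B = (u - 1) gchoose i" "C = (u - 1) gchoose l"
    have "(x + 2 - a) * ((x + 1 - of_nat j) gchoose Suc i) - (2 * x + 2) * ((x - of_nat j) gchoose Suc i)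
      + (x + a) * ((x - 1 - of_nat j) gchoose Suc i) =
      (x + 2 - a) * (A + B + (B + C)) - (2 * x + 2) * (A + B) + (x + a) * A"
      unfolding x using 1 2 3 by (simp add: A_B_C_def algebra_simps)
    also have "\<dots> = u * C + (2 - 2 * a) * (B + C) + (of_nat j + a) * C"
      unfolding x by (simp add: algebra_simps)
    also have "\<dots> = (of_nat i + 2 - 2 * a) * (B + C) + (of_nat j + a) * C"
      using 4 unfolding 3 A_B_C_def[symmetric] by (simp add: algebra_simps)
    finally show ?thesis
      using 3 Suc unfolding A_B_C_def x by (simp add: algebra_simps)
  qed
qed

text \<open>The operator lowers \<open>k\<close>. Its factor on the right is invariant under
  replacing a by 1 - a, so the sums for 1/4 and 3/4 share it; that lets a combination of both
  satisfy one recurrence.\<close>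

lemma pade_sum_rec:
  fixes x :: "'a :: field_char_0"
  shows "(x + 2 - a) * pade_sum a (x + 1) (Suc k) - (2 * x + 2) * pade_sum a x (Suc k) + (x + a) * pade_sum a (x - 1) (Suc k) =
    (of_nat k + 2 * a) * (of_nat k + 2 - 2 * a) * pade_sum a x k"
proof -
  define c where "c = pade_coeff a (Suc k)"
  define g where "g j = (x - of_nat j) gchoose (k - j)" for j
  define t where "t j = (x + 2 - a) * ((x + 1 - of_nat j) gchoose (Suc k - j)) - (2 * x + 2) * ((x - of_nat j) gchoose (Suc k - j))
      + (x + a) * ((x - 1 - of_nat j) gchoose (Suc k - j))" for j
  have t: "t j = (of_nat k - of_nat j + 2 - 2 * a) * g j + (if j = k then 0 else (of_nat j + a) * g (Suc j))" if "j \<le> k" for j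
    using gbinomial_three_term[of x a j "k - j"] that
    by (auto simp add: t_def g_def Suc_diff_le of_nat_diff algebra_simps)
  have "(x + 2 - a) * pade_sum a (x + 1) (Suc k) - (2 * x + 2) * pade_sum a x (Suc k) + (x + a) * pade_sum a (x - 1) (Suc k) =
    (\<Sum>j\<le>Suc k. c j * t j)"
    unfolding pade_sum_def c_def[symmetric] sum_distrib_left sum_subtractf[symmetric] sum.distrib[symmetric]
    by (rule sum.cong[OF HOL.refl]) (simp add: t_def algebra_simps)
  also have "\<dots> = (\<Sum>j\<le>k. c j * t j)"
    by (simp add: t_def)
  also have "\<dots> = (\<Sum>j\<le>k. c j * (of_nat k - of_nat j + 2 - 2 * a) * g j) + (\<Sum>j\<le>k. if j = k then 0 else c j * (of_nat j + a) * g (Suc j))"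
    unfolding sum.distrib[symmetric] by (intro sum.cong HOL.refl) (simp add: t algebra_simps)
  also have "(\<Sum>j\<le>k. if j = k then 0 else c j * (of_nat j + a) * g (Suc j)) = (\<Sum>j<k. c j * (of_nat j + a) * g (Suc j))"
    unfolding lessThan_Suc_atMost[symmetric] by simp
  also have "\<dots> = (\<Sum>j\<le>k. if j = 0 then 0 else c (j - 1) * (of_nat j - 1 + a) * g j)"
    by (subst sum.atMost_shift) simp
  also have "(\<Sum>j\<le>k. c j * (of_nat k - of_nat j + 2 - 2 * a) * g j) + \<dots> =
    (\<Sum>j\<le>k. (of_nat k + 2 * a) * (of_nat k + 2 - 2 * a) * pade_coeff a k j * g j)"
    unfolding sum.distrib[symmetric]
  proof (intro sum.cong HOL.refl, goal_cases)
    case (1 j)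
    then show ?case
      using arg_cong[OF pade_coeff_rec[of j k a], of "\<lambda>z. z * g j"] by (auto simp: c_def algebra_simps)
  qed
  finally show ?thesis
    by (simp only: pade_sum_def g_def sum_distrib_left mult.assoc)
qed

lemma pade_sum_0 [simp]: "pade_sum a x 0 = 1"
  by (simp add: pade_sum_def pade_coeff_def)

lemma pochhammer_split_ratio:
  fixes a :: "'a :: field_char_0"
  assumes "\<And>j. a + of_nat j \<noteq> 0" and "j \<le> k"
  shows "pochhammer (a + of_nat j) (k - j) = pochhammer a k / pochhammer a j"
proof -
  have "pochhammer a j \<noteq> 0"
    using assms(1) by (metis pochhammer_eq_0_iff add.commute add_eq_0_iff2 )
  then show ?thesis
    using pochhammer_product[OF assms(2), of a] by simp
qed

text \<open>At \<open>x = -1\<close> the generalized binomials are, up to sign, ordinary ones, and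
  together with the binomials of \<open>pade_coeff\<close> they form Legendre coefficients.\<close>

lemma pade_sum_minus_1:
  fixes a :: "'a :: field_char_0"
  assumes nz: "\<And>j. 2 * a + of_nat j \<noteq> 0"
  shows "pade_sum a (-1) k = (-1) ^ k * pochhammer (2 * a) k * legendre_moment a k"
  unfolding pade_sum_def legendre_moment_def sum_distrib_left
proof (intro sum.cong HOL.refl)
  fix j assume "j \<in> {..k}"
  then have j: "j \<le> k" by simp
  have "(-1 - of_nat j :: 'a) gchoose (k - j) = (-1) ^ (k - j) * of_nat (k choose (k - j))"
  proof -
    have "(-1 - of_nat j :: 'a) gchoose (k - j) = (-1) ^ (k - j) * ((1 + of_nat j + of_nat (k - j) - 1) gchoose (k - j))"
      using gbinomial_minus[of "1 + of_nat j :: 'a" "k - j"] by simp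
    also have "1 + of_nat j + of_nat (k - j) - 1 = (of_nat k :: 'a)"
      using j by (simp add: of_nat_diff)
    finally show ?thesis by (simp add: binomial_gbinomial)
  qed
  moreover have "(-1 :: 'a) ^ (k - j) = (-1) ^ k * (-1) ^ j"
    using j by (simp add: minus_one_power_iff even_diff_nat)
  moreover have "(k + j) choose k = (k + j) choose j" using binomial_symmetric[of j "k + j"] by simp
  moreover have "k choose (k - j) = k choose j" using binomial_symmetric[OF j] by simp
  ultimately show "pade_coeff a k j * ((-1 - of_nat j) gchoose (k - j)) =
         (-1) ^ k * pochhammer (2 * a) k * (legendre_coeff k j * beta_moment a j)"
    using pochhammer_split_ratio[OF nz j] by (simp add: pade_coeff_def legendre_coeff_def beta_moment_def)
qed

text \<open>As at -1, but reducing the binomials to those of \<open>Suc k\<close> by absorption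
  costs the factor \<open>Suc k\<close> and supplies the factor \<open>j\<close> of the derivative
  moment.\<close>

lemma pade_sum_zero:
  fixes a :: "'a :: field_char_0"
  assumes nz: "\<And>j. 2 * a + of_nat j \<noteq> 0"
  shows "of_nat (Suc k) * pade_sum a 0 (Suc k) =
     (-1) ^ Suc k * pochhammer (2 * a) (Suc k) * legendre_deriv_moment a (Suc k)"
  unfolding pade_sum_def legendre_deriv_moment_def sum_distrib_left
proof (intro sum.cong HOL.refl)
  fix j assume "j \<in> {..Suc k}"
  then have j: "j \<le> Suc k" by simp
  have "of_nat (Suc k) * ((0 - of_nat j :: 'a) gchoose (Suc k - j)) = (-1) ^ (Suc k - j) * (of_nat j * of_nat (Suc k choose (Suc k - j)))"
  proof (cases j)
    case 0
    then show ?thesis by (simp add: gbinomial_0_left)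
  next
    case (Suc i)
    have ik: "i \<le> k" using j Suc by simp
    have "(0 - of_nat j :: 'a) gchoose (Suc k - j) = (-1) ^ (Suc k - j) * ((of_nat j + of_nat (Suc k - j) - 1) gchoose (Suc k - j))"
      using gbinomial_minus[of "of_nat j :: 'a" "Suc k - j"] by simp
    also have "of_nat j + of_nat (Suc k - j) - 1 = (of_nat k :: 'a)"
      using j by (simp add: of_nat_diff)
    also have "(of_nat k gchoose (Suc k - j)) = (of_nat (k choose i) :: 'a)"
      using ik using binomial_symmetric[OF ik] by (simp add: Suc binomial_gbinomial[symmetric])
    finally have "of_nat (Suc k) * ((0 - of_nat j :: 'a) gchoose (Suc k - j)) = (-1) ^ (Suc k - j) * (of_nat (Suc k) * of_nat (k choose i))"
      by (simp add: algebra_simps)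
    also have "of_nat (Suc k) * of_nat (k choose i) = (of_nat j * of_nat (Suc k choose j) :: 'a)"
      unfolding Suc using Suc_times_binomial[of i k] by (metis of_nat_mult)
    also have "Suc k choose j = Suc k choose (Suc k - j)" using j by (rule binomial_symmetric)
    finally show ?thesis .
  qed
  moreover have "(-1 :: 'a) ^ (Suc k - j) = (-1) ^ Suc k * (-1) ^ j"
    using j by (simp add: minus_one_power_iff even_diff_nat)
  moreover have "(Suc k + j) choose Suc k = (Suc k + j) choose j" using binomial_symmetric[of j "Suc k + j"] by simp
  moreover have "Suc k choose (Suc k - j) = Suc k choose j" using binomial_symmetric[OF j] by simp
  moreover have "of_nat (Suc k) * (pade_coeff a (Suc k) j * ((0 - of_nat j) gchoose (Suc k - j)))
     = pade_coeff a (Suc k) j * (of_nat (Suc k) * ((0 - of_nat j) gchoose (Suc k - j)))"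
    by (rule mult.left_commute)
  ultimately show "of_nat (Suc k) * (pade_coeff a (Suc k) j * ((0 - of_nat j) gchoose (Suc k - j))) =
         (-1) ^ Suc k * pochhammer (2 * a) (Suc k) * (of_nat j * legendre_coeff (Suc k) j * beta_moment a j)"
    using pochhammer_split_ratio[OF nz j] by (simp add: pade_coeff_def legendre_coeff_def beta_moment_def)
qed

text \<open>The moment recurrence turns into one whose coefficient is symmetric in a and 1 - a, and
  the initial values 1 and 0 do not involve a.\<close>

lemma pade_sum_minus_1_sym:
  fixes a b :: "'a :: field_char_0"
  assumes nza: "\<And>j. 2 * a + of_nat j \<noteq> 0" and nzb: "\<And>j. 2 * b + of_nat j \<noteq> 0" and ab: "a + b = 1"
  shows "pade_sum a (-1) k = pade_sum b (-1) k"
proof -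
  have rec: "(of_nat k + 2) * pade_sum a (-1) (Suc (Suc k)) =
      (of_nat k + 1) * (of_nat k + 2 * a) * (of_nat k + 2 - 2 * a) * pade_sum a (-1) k"
    if nz: "\<And>j. 2 * a + of_nat j \<noteq> 0" for a :: 'a and k
  proof -
    have "(of_nat k + 2) * pade_sum a (-1) (Suc (Suc k)) = (-1) ^ k * (of_nat k + 2 * a) * pochhammer (2 * a) k *
       ((of_nat k + 2) * (of_nat k + 1 + 2 * a) * legendre_moment a (Suc (Suc k)))"
      unfolding pade_sum_minus_1[OF nz] pochhammer_rec' by (simp add: algebra_simps)
    then show ?thesis
      unfolding legendre_moment_rec[OF nz] pade_sum_minus_1[OF nz] by (simp add: algebra_simps)
  qed
  show ?thesis
  proof (induction k rule: induct_nat_012)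
    case 0
    then show ?case by simp
  next
    case 1
    have "2 * a \<noteq> 0" "2 * b \<noteq> 0" using nza[of 0] nzb[of 0] by auto
    then show ?case by (simp add: pade_sum_minus_1 nza nzb legendre_moment_1)
  next
    case (ge2 k)
    have b: "1 - a = b" using ab by (auto simp: algebra_simps)
    have c: "(of_nat k + 2 * a) * (of_nat k + 2 - 2 * a) = (of_nat k + 2 * b) * (of_nat k + 2 - 2 * b)"
      unfolding b[symmetric] by (simp add: algebra_simps)
    have "(of_nat k + 2) * pade_sum a (-1) (Suc (Suc k)) = (of_nat k + 2) * pade_sum b (-1) (Suc (Suc k))"
      using ge2.IH(1) c unfolding rec[OF nza] rec[OF nzb] by (simp add: mult.assoc)
    moreover have "of_nat k + 2 \<noteq> (0 :: 'a)"
      by (metis of_nat_add of_nat_numeral of_nat_eq_0_iff add_is_0 zero_neq_numeral)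
    ultimately show ?case by simp
  qed
qed

text \<open>By \<open>legendre_deriv_moment_eq\<close>, \<open>2 * (1 - a)\<close> times the value
  at 0 is a combination of values at -1 with coefficients symmetric in a and 1 - a.\<close>

lemma pade_sum_zero_sym:
  fixes a b :: "'a :: field_char_0"
  assumes nza: "\<And>j. 2 * a + of_nat j \<noteq> 0" and nzb: "\<And>j. 2 * b + of_nat j \<noteq> 0" and ab: "a + b = 1"
  shows "b * pade_sum a 0 (Suc k) = a * pade_sum b 0 (Suc k)"
proof -
  have eq: "2 * (1 - a) * pade_sum a 0 (Suc k) =
      (of_nat k + 2) * pade_sum a (-1) (Suc k) + (of_nat k + 2 - 2 * a) * (of_nat k + 2 * a) * pade_sum a (-1) k"
    if nz: "\<And>j. 2 * a + of_nat j \<noteq> 0" for a :: 'a and k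
  proof -
    have "of_nat (Suc k) * (2 * (1 - a) * pade_sum a 0 (Suc k)) = 2 * (1 - a) * (of_nat (Suc k) * pade_sum a 0 (Suc k))"
      by (simp add: algebra_simps)
    also have "\<dots> = (-1) ^ Suc k * pochhammer (2 * a) (Suc k) * (2 * (1 - a) * legendre_deriv_moment a (Suc k))"
      unfolding pade_sum_zero[OF nz] by (simp add: algebra_simps)
    also have "\<dots> = of_nat (Suc k) * ((of_nat k + 2) * pade_sum a (-1) (Suc k) + (of_nat k + 2 - 2 * a) * (of_nat k + 2 * a) * pade_sum a (-1) k)"
      unfolding legendre_deriv_moment_eq[OF nz] pade_sum_minus_1[OF nz] pochhammer_rec' power_Suc by (simp add: algebra_simps)
    finally show ?thesis using of_nat_neq_0 by (metis mult_left_cancel)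
  qed
  have b: "1 - a = b" and a: "1 - b = a" using ab by (auto simp: algebra_simps)
  have c: "(of_nat k + 2 - 2 * a) * (of_nat k + 2 * a) = (of_nat k + 2 - 2 * b) * (of_nat k + 2 * b)"
    unfolding b[symmetric] by (simp add: algebra_simps)
  have "2 * b * pade_sum a 0 (Suc k) = 2 * a * pade_sum b 0 (Suc k)"
    using eq[OF nza, of k] eq[OF nzb, of k]
    unfolding a b c pade_sum_minus_1_sym[OF nza nzb ab] by simp
  then show ?thesis by simp
qed

text \<open>The index is shifted: \<open>pade_rev (Suc n) k\<close> belongs to \<^term>\<open>q_rev m n k\<close>, and
  \<open>pade_rev 0\<close> starts the three-term recurrence.\<close>

definition pade_rev :: "nat \<Rightarrow> nat \<Rightarrow> rat" where
  "pade_rev n k = (-1) ^ (n + 1) / pochhammer (1/2 - of_nat k) (2 * k + 1) *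
     (pochhammer (3/4) n * pade_sum (1/4) (of_nat n - 1) k - pochhammer (1/4) n * pade_sum (3/4) (of_nat n - 1) k)"

lemma quarter_nonzero: "2 * (1/4) + of_nat j \<noteq> (0::rat)" "2 * (3/4) + of_nat j \<noteq> (0::rat)"
  by (metis add_pos_nonneg of_nat_0_le_iff less_irrefl mult_pos_pos zero_less_numeral zero_less_divide_1_iff zero_less_divide_iff)+

text \<open>Here and in \<open>pade_rev_1\<close> the sums for 1/4 and 3/4 have to cancel; this is
  what the two symmetry lemmas are for.\<close>

lemma pade_rev_0: "pade_rev 0 k = 0"
  using pade_sum_minus_1_sym[OF quarter_nonzero, of k] by (simp add: pade_rev_def)

lemma pade_rev_1: "pade_rev (Suc 0) k = (if k = 0 then 1 else 0)"
  using pade_sum_zero_sym[OF quarter_nonzero, of "k - 1"] by (cases k) (simp_all add: pade_rev_def)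

text \<open>Widening the product by one factor at each end yields, up to sign, the constant of
  \<open>pade_sum_rec\<close> for a = 1/4 and a = 3/4. This is why the product is the right
  denominator in \<open>pade_rev\<close>.\<close>

lemma pochhammer_half_symmetric_Suc:
  "pochhammer (1/2 - of_nat (Suc k) :: rat) (2 * Suc k + 1) =
     - (of_nat k + 1/2) * (of_nat k + 3/2) * pochhammer (1/2 - of_nat k) (2 * k + 1)"
proof -
  have "pochhammer (1/2 - of_nat (Suc k) :: rat) (2 * Suc k + 1) = pochhammer (1/2 - of_nat (Suc k)) (Suc (Suc (2 * k + 1)))"
    by simp
  also have "\<dots> = (1/2 - of_nat (Suc k)) * ((1/2 - of_nat k + of_nat (2 * k + 1)) * pochhammer (1/2 - of_nat k) (2 * k + 1))"
    unfolding pochhammer_rec[of _ "Suc _"] by (subst pochhammer_rec') (simp add: algebra_simps)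
  finally show ?thesis by (simp add: algebra_simps)
qed

lemma pochhammer_half_symmetric_nonzero: "pochhammer (1/2 - of_nat k :: rat) (2 * k + 1) \<noteq> 0"
proof (induction k)
  case (Suc k)
  have "of_nat k + 1/2 > (0::rat)" "of_nat k + 3/2 > (0::rat)" by (simp_all add: add_nonneg_pos)
  then show ?case unfolding pochhammer_half_symmetric_Suc using Suc by simp
qed simp

text \<open>Apply \<open>pade_sum_rec\<close> to both sums. The Pochhammer prefactors absorb the
  coefficient \<open>x + 2 - a\<close> of the highest term, and on the lowest term prefactor and
  coefficient combine to \<open>(n + 1/4) * (n + 3/4)\<close> in both cases.\<close>

lemma pade_rev_rec:
  "pade_rev (Suc (Suc n)) k = (if k = 0 then 0 else pade_rev (Suc n) (k - 1)) - (2 * of_nat n + 2) * pade_rev (Suc n) k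
     - (of_nat n + 1/4) * (of_nat n + 3/4) * pade_rev n k"
proof (cases k)
  case 0
  show ?thesis
    by (simp add: 0 pade_rev_def pochhammer_rec') (simp add: field_simps)
next
  case (Suc l)
  define N :: rat where "N = of_nat n"
  define A B e where "A = pochhammer (1/4::rat) n" "B = pochhammer (3/4::rat) n" "e = (-1::rat) ^ n"
  define c where "c = pochhammer (1/2 - of_nat l :: rat) (2 * l + 1)"
  define \<kappa> :: rat where "\<kappa> = (of_nat l + 1/2) * (of_nat l + 3/2)"
  have c: "pochhammer (1/2 - of_nat (Suc l) :: rat) (2 * Suc l + 1) = - \<kappa> * c"
    unfolding c_def \<kappa>_def by (subst pochhammer_half_symmetric_Suc) (simp only: mult_minus_left)
  have c0: "c \<noteq> 0" unfolding c_def by (rule pochhammer_half_symmetric_nonzero)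
  have k0: "\<kappa> \<noteq> 0" unfolding \<kappa>_def
    by (smt (verit) mult_eq_0_iff of_nat_0_le_iff zero_less_divide_1_iff zero_less_numeral add_nonneg_pos less_irrefl zero_less_divide_iff)
  define s t where "s i = pade_sum (1/4) (N + i) (Suc l)" "t i = pade_sum (3/4) (N + i) (Suc l)" for i :: rat
  define s' t' where "s' = pade_sum (1/4) N l" "t' = pade_sum (3/4) N l"
  have S: "(N + 7/4) * s 1 = (2 * N + 2) * s 0 - (N + 1/4) * s (-1) + \<kappa> * s'"
    using pade_sum_rec[of N "1/4" l] by (simp add: s_t_def s'_t'_def \<kappa>_def algebra_simps)
  have T: "(N + 5/4) * t 1 = (2 * N + 2) * t 0 - (N + 3/4) * t (-1) + \<kappa> * t'"
    using pade_sum_rec[of N "3/4" l] by (simp add: s_t_def s'_t'_def \<kappa>_def algebra_simps)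
  have 2: "pade_rev (Suc (Suc n)) (Suc l) = e / (\<kappa> * c) * (B * (N + 3/4) * ((N + 7/4) * s 1) - A * (N + 1/4) * ((N + 5/4) * t 1))"
    unfolding pade_rev_def c pochhammer_rec' by (simp add: s_t_def N_def A_B_e_def c0 k0 field_simps)
  have 1: "pade_rev (Suc n) (Suc l) = - e / (\<kappa> * c) * (B * (N + 3/4) * s 0 - A * (N + 1/4) * t 0)"
    unfolding pade_rev_def c pochhammer_rec' by (simp add: s_t_def N_def A_B_e_def c0 k0 field_simps)
  have 0: "pade_rev n (Suc l) = e / (\<kappa> * c) * (B * s (-1) - A * t (-1))"
    unfolding pade_rev_def c pochhammer_rec' by (simp add: s_t_def N_def A_B_e_def c0 k0 field_simps)
  have r1: "pade_rev (Suc n) l = e / c * (B * (N + 3/4) * s' - A * (N + 1/4) * t')"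
    unfolding pade_rev_def c_def[symmetric] pochhammer_rec' by (simp add: s'_t'_def N_def A_B_e_def c0 k0 field_simps)
  show ?thesis
    unfolding Suc 2 1 0 S T N_def[symmetric] using c0 k0 by (simp add: r1) (simp add: field_simps)
qed

lemma q_rev_eq:
  assumes "k \<le> n"
  shows "q_rev m n k = (4 * of_nat m) ^ (n - k) * pade_rev (Suc n) k"
proof -
  have S: "(\<Sum>j=0..k. of_nat ((k + j) choose k) * of_nat ((n - j) choose (k - j)) *
          pochhammer (c + of_nat j) (k - j) * pochhammer a j) = pade_sum a (of_nat n) k" if "c = 2 * a" for a c :: rat
    unfolding pade_sum_def pade_coeff_def atLeast0AtMost
    using assms that by (intro sum.cong HOL.refl) (simp add: binomial_gbinomial of_nat_diff)
  show ?thesis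
    unfolding q_rev_def pade_rev_def using S[of "1/2" "1/4"] S[of "3/2" "3/4"] by simp
qed

section \<open>The denominators as integer polynomials\<close>

text \<open>The recurrence of \<open>pade_rev\<close> after scaling by \<open>x = 4 m\<close>:
  \<open>x * (2 * n + 4) = 8 * m * (n + 2)\<close> and \<open>x^2 * (n + 5/4) * (n + 7/4) = m^2 * (4
  * n + 5) * (4 * n + 7)\<close>. That these are integers yields the integrality of
  \<open>Q4\<close>.\<close>

fun pade_denom :: "nat \<Rightarrow> nat \<Rightarrow> int poly" where
  "pade_denom m 0 = 1"
| "pade_denom m (Suc 0) = [:1, - 8 * int m:]"
| "pade_denom m (Suc (Suc n)) = [:1, - 8 * int m * (int n + 2):] * pade_denom m (Suc n)
     - monom (int m ^ 2 * (4 * int n + 5) * (4 * int n + 7)) 2 * pade_denom m n"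

text \<open>The vanishing of \<open>pade_rev\<close> beyond the degree is carried along because the
  recurrence at the extreme coefficients refers to such entries.\<close>

lemma coeff_pade_denom:
  "of_int (coeff (pade_denom m n) i) = (if i \<le> n then (4 * of_nat m) ^ i * pade_rev (Suc n) (n - i) else 0)
   \<and> (\<forall>k>n. pade_rev (Suc n) k = 0)"
proof (induction n arbitrary: i rule: induct_nat_012)
  case 0
  then show ?case by (simp add: pade_rev_1)
next
  case 1
  have "pade_rev (Suc (Suc 0)) k = (if k = 1 then 1 else if k = 0 then - 2 else 0)" for k
    by (simp add: pade_rev_rec[of 0] pade_rev_0 pade_rev_1)
  then show ?case by (cases i) (auto simp: coeff_pCons split: nat.split)
next
  case (ge2 n)
  define x :: rat where "x = 4 * of_nat m"
  have c2: "of_int (coeff (pade_denom m (Suc n)) i) = (if i \<le> Suc n then x ^ i * pade_rev (Suc (Suc n)) (Suc n - i) else 0)"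
    and c1: "of_int (coeff (pade_denom m n) i) = (if i \<le> n then x ^ i * pade_rev (Suc n) (n - i) else 0)"
    and z2: "k > Suc n \<Longrightarrow> pade_rev (Suc (Suc n)) k = 0" and z1: "k > n \<Longrightarrow> pade_rev (Suc n) k = 0" for i k
    using ge2 by (auto simp: x_def)
  define N :: rat where "N = of_nat n"
  have rec: "pade_rev (Suc (Suc (Suc n))) k = (if k = 0 then 0 else pade_rev (Suc (Suc n)) (k - 1)) - (2 * N + 4) * pade_rev (Suc (Suc n)) k
     - (N + 5/4) * (N + 7/4) * pade_rev (Suc n) k" for k
    by (subst pade_rev_rec) (simp add: N_def algebra_simps)
  have z: "\<forall>k>Suc (Suc n). pade_rev (Suc (Suc (Suc n))) k = 0"
    using z1 z2 by (auto simp: rec)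
  have cc: "of_int (coeff (pade_denom m (Suc (Suc n))) i) =
     of_int (coeff (pade_denom m (Suc n)) i)
      - (if i = 0 then 0 else x * (2 * N + 4) * of_int (coeff (pade_denom m (Suc n)) (i - 1)))
      - (if i < 2 then 0 else x ^ 2 * (N + 5/4) * (N + 7/4) * of_int (coeff (pade_denom m n) (i - 2)))"
  proof -
    define C where "C = int m ^ 2 * (4 * int n + 5) * (4 * int n + 7)"
    have "coeff (pade_denom m (Suc (Suc n))) i = coeff (pade_denom m (Suc n)) i
      + (if i = 0 then 0 else - 8 * int m * (int n + 2) * coeff (pade_denom m (Suc n)) (i - 1))
      - (if i < 2 then 0 else C * coeff (pade_denom m n) (i - 2))"
      unfolding pade_denom.simps C_def[symmetric] by (auto simp: coeff_monom_mult coeff_pCons split: nat.split)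
    note * = this
    show ?thesis unfolding * by (simp add: x_def N_def C_def power2_eq_square algebra_simps del: pade_denom.simps)
  qed
  have "of_int (coeff (pade_denom m (Suc (Suc n))) i) = (if i \<le> Suc (Suc n) then x ^ i * pade_rev (Suc (Suc (Suc n))) (Suc (Suc n) - i) else 0)"
  proof -
    consider "i = 0" | "i = 1" | j where "i = Suc (Suc j)" "j \<le> n" | "i > Suc (Suc n)"
      by (metis One_nat_def Suc_le_mono linorder_not_le not0_implies_Suc)
    then show ?thesis
    proof cases
      case 1
      then show ?thesis using z1 z2 unfolding cc c1 c2 rec by simp
    next
      case 2
      then show ?thesis using z1 unfolding cc c1 c2 rec by (simp add: algebra_simps)
    next
      case 3
      then obtain d where "n = j + d" by (metis le_iff_add)
      then show ?thesis using 3 unfolding cc c1 c2 rec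
        by (simp add: Suc_diff_le power2_eq_square) (simp add: algebra_simps)
    next
      case 4
      then show ?thesis unfolding cc c1 c2 by auto
    qed
  qed
  then show ?case using z by (simp add: x_def)
qed

lemma Q4_eq: "Q4 m n = map_poly of_int (pade_denom m n)"
proof (rule poly_eqI)
  fix i
  have "coeff (Q4 m n) i = (\<Sum>j=0..n. if j = i then q_rev m n (n - j) else 0)"
    unfolding Q4_def by (simp add: coeff_sum)
  also have "\<dots> = (if i \<le> n then q_rev m n (n - i) else 0)"
    by simp
  also have "\<dots> = of_int (coeff (pade_denom m n) i)"
    using coeff_pade_denom[of m n i] by (simp add: q_rev_eq)
  finally show "coeff (Q4 m n) i = coeff (map_poly of_int (pade_denom m n)) i"
    by (simp add: coeff_map_poly)
qed

lemma degree_Q4: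
  assumes "m > 0"
  shows "degree (Q4 m n) = n"
proof (rule antisym)
  have c: "coeff (Q4 m n) i = (if i \<le> n then (4 * of_nat m) ^ i * pade_rev (Suc n) (n - i) else 0)" for i
    using coeff_pade_denom[of m n i] by (simp add: Q4_eq coeff_map_poly)
  show "degree (Q4 m n) \<le> n" using c by (intro degree_le) simp
  \<comment> \<open>The leading coefficient is a nonzero multiple of the difference of the two
    Pochhammer products of length \<open>n + 1\<close>, so these have to be compared
    strictly.\<close>
  have "pochhammer (1/4) k \<le> pochhammer (3/4::rat) k \<and> 0 < pochhammer (1/4::rat) k" for k
    by (induction k) (auto simp: pochhammer_rec' intro!: mult_mono mult_pos_pos add_pos_nonneg)
  note * = this[of n]
  have "(3/4 + of_nat n) * pochhammer (3/4) n > (1/4 + of_nat n) * pochhammer (1/4 :: rat) n"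
  proof -
    have "(1/4 + of_nat n) * pochhammer (1/4 :: rat) n < (3/4 + of_nat n) * pochhammer (1/4) n"
      using * by (intro mult_strict_right_mono) auto
    also have "\<dots> \<le> (3/4 + of_nat n) * pochhammer (3/4) n"
      using * by (intro mult_left_mono) auto
    finally show ?thesis .
  qed
  then have "pade_rev (Suc n) 0 \<noteq> 0"
    by (simp add: pade_rev_def pochhammer_rec')
  then have "coeff (Q4 m n) n \<noteq> 0" unfolding c using assms by simp
  then show "n \<le> degree (Q4 m n)" by (rule le_degree)
qed

lemma pade_denom_coeff_0: "coeff (pade_denom m n) 0 = 1"
  by (induction n rule: induct_nat_012) (auto simp: coeff_pCons coeff_monom_mult)

unbundle fps_syntax

section \<open>Congruences for the hypergeometric series\<close>

text \<open>For prime \<open>p\<close>: \<open>x\<close> lies in \<open>p ^ e\<close> times the ring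
  of fractions with denominator prime to \<open>p\<close>. The case \<open>e = 0\<close> is
  p-integrality.\<close>

definition padic_dvd :: "nat \<Rightarrow> nat \<Rightarrow> rat \<Rightarrow> bool" where
  "padic_dvd p e x \<longleftrightarrow> (\<exists>a b :: int. coprime b (int p) \<and> x * of_int b = of_nat p ^ e * of_int a)"

lemma padic_dvd_0 [simp]: "padic_dvd p e 0"
  unfolding padic_dvd_def by (intro exI[of _ 0] exI[of _ 1]) simp

lemma padic_dvd_add:
  assumes "padic_dvd p e x" "padic_dvd p e y"
  shows "padic_dvd p e (x + y)"
proof -
  obtain a b c d where 1: "coprime b (int p)" "x * of_int b = of_nat p ^ e * of_int a"
    "coprime d (int p)" "y * of_int d = of_nat p ^ e * of_int c"
    using assms unfolding padic_dvd_def by blast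
  have "(x + y) * of_int (b * d) = (x * of_int b) * of_int d + (y * of_int d) * of_int b"
    by (simp add: algebra_simps)
  also have "\<dots> = of_nat p ^ e * of_int (a * d + c * b)"
    unfolding 1 by (simp add: algebra_simps)
  finally show ?thesis
    unfolding padic_dvd_def using 1 coprime_mult_left_iff by blast
qed

lemma padic_dvd_mult:
  assumes "padic_dvd p e x" "padic_dvd p f y"
  shows "padic_dvd p (e + f) (x * y)"
proof -
  obtain a b c d where 1: "coprime b (int p)" "x * of_int b = of_nat p ^ e * of_int a"
    "coprime d (int p)" "y * of_int d = of_nat p ^ f * of_int c"
    using assms unfolding padic_dvd_def by blast
  have "(x * y) * of_int (b * d) = (x * of_int b) * (y * of_int d)"
    by (simp add: algebra_simps)
  also have "\<dots> = of_nat p ^ (e + f) * of_int (a * c)"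
    unfolding 1 by (simp add: algebra_simps power_add)
  finally show ?thesis
    unfolding padic_dvd_def using 1 coprime_mult_left_iff by blast
qed

lemma padic_dvd_of_int:
  assumes "int p ^ e dvd k"
  shows "padic_dvd p e (of_int k)"
proof -
  obtain a where "k = int p ^ e * a" using assms by (elim dvdE)
  then show ?thesis unfolding padic_dvd_def by (intro exI[of _ a] exI[of _ 1]) simp
qed

lemma padic_dvd_of_intD:
  assumes "padic_dvd p e (of_int k)"
  shows "int p ^ e dvd k"
proof -
  obtain a b where 1: "coprime b (int p)" "(of_int k :: rat) * of_int b = of_nat p ^ e * of_int a"
    using assms unfolding padic_dvd_def by blast
  have "(of_int (k * b) :: rat) = of_int (int p ^ e * a)" using 1(2) by simp
  then have "k * b = int p ^ e * a" by (simp only: of_int_eq_iff)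
  then have "int p ^ e dvd k * b" by simp
  moreover have "coprime (int p ^ e) b" using 1(1) by (simp add: coprime_commute)
  ultimately show ?thesis by (simp add: coprime_dvd_mult_left_iff)
qed

lemma padic_dvd_0_of_int [simp]: "padic_dvd p 0 (of_int k)"
  by (rule padic_dvd_of_int) simp

lemma padic_dvd_minus: "padic_dvd p e x \<Longrightarrow> padic_dvd p e (- x)"
  using padic_dvd_mult[OF padic_dvd_0_of_int[of p "- 1"], of e x] by simp

lemma padic_dvd_diff: "padic_dvd p e x \<Longrightarrow> padic_dvd p e y \<Longrightarrow> padic_dvd p e (x - y)"
  using padic_dvd_add[of p e x "- y"] by (simp add: padic_dvd_minus)

lemma padic_dvd_sum: "(\<And>i. i \<in> A \<Longrightarrow> padic_dvd p e (f i)) \<Longrightarrow> padic_dvd p e (sum f A)"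
  by (induction A rule: infinite_finite_induct) (auto intro: padic_dvd_add)

lemma padic_dvd_cancel:
  assumes "padic_dvd p e (x * of_int c)" "coprime c (int p)"
  shows "padic_dvd p e x"
proof -
  obtain a b where 1: "coprime b (int p)" "x * of_int c * of_int b = of_nat p ^ e * of_int a"
    using assms unfolding padic_dvd_def by blast
  then have "x * of_int (c * b) = of_nat p ^ e * of_int a" by simp
  then show ?thesis unfolding padic_dvd_def using 1 assms(2) coprime_mult_left_iff by blast
qed

lemma prime_power_dvd_fact:
  assumes "p > 0"
  shows "p ^ e dvd (fact (e * p) :: nat)"
proof (induction e)
  case (Suc e)
  have "Suc e * p = Suc (Suc e * p - 1)" using assms by simp
  then have "fact (Suc e * p) = (Suc e * p) * (fact (Suc e * p - 1) :: nat)"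
    by (metis fact_Suc of_nat_id)
  moreover have "(fact (e * p) :: nat) dvd fact (Suc e * p - 1)"
    using assms by (intro fact_dvd) simp
  then have "p ^ e dvd fact (Suc e * p - 1)" using Suc dvd_trans by blast
  ultimately show ?case by (simp add: mult_dvd_mono dvd_mult2 mult.assoc)
qed simp

text \<open>Modulo the p-part of \<open>fact N\<close> the difference \<open>u\<close> is
  invertible, so the progression is \<open>u\<close> times a run of consecutive integers, and the
  product of such a run is divisible by \<open>fact N\<close>.\<close>

lemma padic_dvd_progression:
  fixes a u :: int
  assumes p: "prime p" and u: "coprime u (int p)"
  shows "padic_dvd p 0 (of_int (\<Prod>j<N. a + u * int j) / fact N)"
proof -
  have "(fact N :: nat) \<noteq> 0" by simp
  then obtain c where c: "fact N = p ^ multiplicity p (fact N :: nat) * c" "\<not> p dvd c"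
    using multiplicity_decompose'[of "fact N :: nat" p] p by (metis not_prime_unit)
  define e where "e = multiplicity p (fact N :: nat)"
  define M where "M = int p ^ e"
  have "coprime u M" unfolding M_def using u by simp
  then obtain v where v: "[u * v = 1] (mod M)" using cong_solve_coprime_int by blast
  define s where "s = v * a"
  have s: "[a + u * int j = u * (s + int j)] (mod M)" for j
  proof -
    have "[u * v * a + u * int j = 1 * a + u * int j] (mod M)"
      by (intro cong_add cong_mult v cong_refl)
    then show ?thesis by (simp add: s_def cong_sym algebra_simps)
  qed
  have "[(\<Prod>j<N. a + u * int j) = (\<Prod>j<N. u * (s + int j))] (mod M)"
    by (intro cong_prod s)
  also have "(\<Prod>j<N. u * (s + int j)) = u ^ N * pochhammer s N"
    by (simp add: prod.distrib pochhammer_prod atLeast0LessThan)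
  finally have "[(\<Prod>j<N. a + u * int j) = u ^ N * pochhammer s N] (mod M)" .
  moreover have "M dvd pochhammer s N"
  proof -
    have "M dvd int (fact N)" using c(1) unfolding M_def e_def by (metis dvd_triv_left of_nat_dvd_iff of_nat_power)
    then show ?thesis using fact_dvd_pochhammer[of N s] by (metis dvd_trans of_nat_fact)
  qed
  ultimately have "M dvd (\<Prod>j<N. a + u * int j)"
    by (metis cong_dvd_iff dvd_mult)
  then obtain t where t: "(\<Prod>j<N. a + u * int j) = M * t" by (elim dvdE)
  have f: "(fact N :: rat) = of_int M * of_nat c"
  proof -
    have "(fact N :: rat) = of_nat (fact N)" by simp
    also have "\<dots> = of_nat (p ^ e * c)" using c(1) e_def by simp
    finally show ?thesis by (simp add: M_def)
  qed
  have "M \<noteq> 0" "c \<noteq> 0" using p c(2) by (auto simp: M_def prime_gt_0_nat intro!: Nat.gr0I)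
  have "padic_dvd p 0 (of_int (\<Prod>j<N. a + u * int j) / fact N * of_int (int c))"
    unfolding t f using \<open>M \<noteq> 0\<close> \<open>c \<noteq> 0\<close> by simp
  moreover have "coprime (int c) (int p)"
    using c(2) p by (metis coprime_commute coprime_int_iff prime_imp_coprime)
  ultimately show ?thesis by (rule padic_dvd_cancel)
qed

section \<open>Divisibility of the hypergeometric coefficients\<close>

definition hyp_coeff :: "nat \<Rightarrow> nat \<Rightarrow> nat \<Rightarrow> rat" where
  "hyp_coeff m n k = (4 * of_nat m) ^ k * pochhammer (of_nat n + 1/4) k * pochhammer (of_nat n + 3/4) k / fact k"

text \<open>The progressions 4n + 1 + 4i and 4n + 3 + 4i of the two Pochhammer symbols interleave to
  a single one with difference 2.\<close>

lemma hyp_coeff_prod: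
  "hyp_coeff m n k * of_int (4 ^ k) * fact k = of_nat m ^ k * of_int (\<Prod>j<2*k. (4 * int n + 1) + 2 * int j)"
proof -
  have "(4 * of_nat m) ^ k * pochhammer (of_nat n + 1/4) k * pochhammer (of_nat n + 3/4) k * 4 ^ k =
     (of_nat m ^ k * of_int (\<Prod>j<2*k. (4 * int n + 1) + 2 * int j) :: rat)"
  proof (induction k)
    case (Suc k)
    define P :: rat where "P = of_int (\<Prod>j<2*k. (4 * int n + 1) + 2 * int j)"
    have P: "of_int (\<Prod>j<2 * Suc k. (4 * int n + 1) + 2 * int j) =
       P * (4 * of_nat n + 1 + 4 * of_nat k) * (4 * of_nat n + 3 + 4 * of_nat k)"
      by (simp add: P_def algebra_simps)
    have "(4 * of_nat m) ^ Suc k * pochhammer (of_nat n + 1/4) (Suc k) * pochhammer (of_nat n + 3/4) (Suc k) * 4 ^ Suc k =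
      ((4 * of_nat m) ^ k * pochhammer (of_nat n + 1/4) k * pochhammer (of_nat n + 3/4) k * 4 ^ k)
        * (16 * of_nat m * (of_nat n + 1/4 + of_nat k) * (of_nat n + 3/4 + of_nat k) :: rat)"
      unfolding pochhammer_rec' power_Suc by (simp add: mult_ac)
    also have "\<dots> = of_nat m ^ k * P * (16 * of_nat m * (of_nat n + 1/4 + of_nat k) * (of_nat n + 3/4 + of_nat k))"
      unfolding Suc.IH P_def ..
    also have "\<dots> = of_nat m ^ Suc k * (P * (4 * of_nat n + 1 + 4 * of_nat k) * (4 * of_nat n + 3 + 4 * of_nat k))"
      by (simp add: field_simps)
    finally show ?case unfolding P .
  qed simp
  then show ?thesis by (simp add: hyp_coeff_def)
qed

lemma coprime_four_power: "odd p \<Longrightarrow> coprime (4 ^ k) (int p)"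
  using coprime_mult_left_iff[of 2 2 "int p"] by simp

text \<open>The progression has 2k factors, so it contains (2k)! p-integrally, while only k! is
  divided out. The surplus is k! times a binomial coefficient, and \<open>p ^ e\<close> divides k!
  once \<open>e * p \<le> k\<close>.\<close>

lemma padic_dvd_hyp_coeff:
  assumes p: "prime p" "odd p" and k: "e * p \<le> k"
  shows "padic_dvd p e (hyp_coeff m n k)"
proof -
  define Q where "Q = (\<Prod>j<2*k. (4 * int n + 1) + 2 * int j)"
  have two: "coprime (2::int) (int p)" using p by simp
  have 1: "hyp_coeff m n k * of_int (4 ^ k) =
    of_int (int m ^ k) * (of_int Q / fact (2 * k)) * of_int (int (fact k * ((2 * k) choose k)))"
  proof -
    have "(fact k * fact k * of_nat ((2 * k) choose k) :: rat) = fact (2 * k)"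
      using binomial_fact_lemma[of k "2 * k"]
      by (metis (mono_tags, lifting) le_add1 mult_2 add_diff_cancel_left' of_nat_fact of_nat_mult)
    then have "hyp_coeff m n k * of_int (4 ^ k) * fact k * fact (2 * k) =
       of_nat m ^ k * of_int Q * (fact k * fact k * of_nat ((2 * k) choose k))"
      unfolding hyp_coeff_prod Q_def[symmetric] by simp
    then show ?thesis by (simp add: field_simps)
  qed
  have "p ^ e dvd fact k"
    using prime_power_dvd_fact[of p e] fact_dvd[OF k, where 'a = nat] dvd_trans p(1) prime_gt_0_nat by blast
  then have "p ^ e dvd fact k * ((2 * k) choose k)" by simp
  then have "padic_dvd p e (of_int (int (fact k * ((2 * k) choose k))))"
    by (intro padic_dvd_of_int) (metis of_nat_dvd_iff of_nat_power)
  then have "padic_dvd p (0 + 0 + e) (hyp_coeff m n k * of_int (4 ^ k))"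
    unfolding 1 Q_def by (intro padic_dvd_mult padic_dvd_progression padic_dvd_0_of_int p two)
  then have "padic_dvd p e (hyp_coeff m n k * of_int (4 ^ k))" by simp
  moreover have "coprime (4 ^ k) (int p)" using p(2) by (rule coprime_four_power)
  ultimately show ?thesis by (rule padic_dvd_cancel)
qed

text \<open>The prime is the first or second factor of the progression, hence divides the numerator
  as soon as \<open>k > 0\<close>. For \<open>k < p\<close> the denominator is prime to
  \<open>p\<close>; larger \<open>k\<close> fall under the previous lemma.\<close>

lemma padic_dvd_hyp_coeff_critical:
  assumes p: "prime p" "p = 4 * n + 1 \<or> p = 4 * n + 3" and k: "k > 0"
  shows "padic_dvd p 1 (hyp_coeff m n k)"
proof (cases "p \<le> k")
  case True
  then show ?thesis using p by (intro padic_dvd_hyp_coeff) auto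
next
  case False
  define Q where "Q = (\<Prod>j<2*k. (4 * int n + 1) + 2 * int j)"
  have "int p dvd Q"
  proof -
    obtain j where "j < 2 * k" "int p = (4 * int n + 1) + 2 * int j"
      using p(2) k by (elim disjE) (force intro: that[of 0], force intro: that[of 1])
    then show ?thesis unfolding Q_def by (metis dvd_prod_eqI dvd_refl finite_lessThan lessThan_iff)
  qed
  then have "padic_dvd p 1 (of_int (int m ^ k * Q))" by (intro padic_dvd_of_int) simp
  then have "padic_dvd p 1 (hyp_coeff m n k * of_int (4 ^ k * fact k))"
    using hyp_coeff_prod[of m n k] by (simp add: Q_def mult.assoc)
  moreover have "coprime (4 ^ k * fact k) (int p)"
  proof -
    have "\<not> p dvd fact k" using False p(1) by (simp add: prime_dvd_fact_iff)
    then have "coprime (fact k) p" using p(1) by (metis coprime_commute prime_imp_coprime)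
    then have "coprime (fact k) (int p)" by (metis coprime_int_iff of_nat_fact)
    then show ?thesis using coprime_four_power[of p k] p(2) by auto
  qed
  ultimately show ?thesis by (rule padic_dvd_cancel)
qed

lemma hyp_coeff_0 [simp]: "hyp_coeff m n 0 = 1"
  by (simp add: hyp_coeff_def)

section \<open>Contiguous relations and their link to the denominators\<close>

definition hyp_series :: "nat \<Rightarrow> nat \<Rightarrow> rat fps" where
  "hyp_series m n = Abs_fps (hyp_coeff m n)"

lemma hyp_coeff_contiguous_1:
  "hyp_coeff m n 1 = hyp_coeff m (Suc n) 1 - 8 * of_nat m * (of_nat n + 1)"
  by (simp add: hyp_coeff_def field_simps)

lemma hyp_coeff_contiguous:
  "hyp_coeff m n (Suc (Suc k)) = hyp_coeff m (Suc n) (Suc (Suc k)) - 8 * of_nat m * (of_nat n + 1) * hyp_coeff m (Suc n) (Suc k)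
     - of_nat m ^ 2 * (4 * of_nat n + 5) * (4 * of_nat n + 7) * hyp_coeff m (Suc (Suc n)) k"
proof -
  define N K x :: rat where "N = of_nat n" "K = of_nat k" "x = 4 * of_nat m"
  \<comment> \<open>Every coefficient involved is a rational multiple of \<open>A * B\<close>,
    because the Pochhammer products for the three consecutive indices overlap in these.\<close>
  define A where "A = pochhammer (N + 1/4 + 1) (Suc k)"
  define B where "B = pochhammer (N + 3/4 + 1) (Suc k)"
  define f where "f = (fact k :: rat)"
  have f: "f \<noteq> 0" "fact (Suc k) = (K + 1) * f" "fact (Suc (Suc k)) = (K + 2) * (K + 1) * f"
    by (simp_all add: f_def N_K_x_def algebra_simps)
  have K: "K + 1 \<noteq> 0" "K + 2 \<noteq> 0" by (simp_all add: N_K_x_def add_nonneg_eq_0_iff)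
  have m: "of_nat m = x / 4" by (simp add: N_K_x_def)
  have Suc_n: "of_nat (Suc n) + 1/4 = N + 1/4 + 1" "of_nat (Suc n) + 3/4 = N + 3/4 + 1"
     "of_nat (Suc (Suc n)) + 1/4 = N + 1/4 + 1 + 1" "of_nat (Suc (Suc n)) + 3/4 = N + 3/4 + 1 + 1"
    by (simp_all add: N_K_x_def)
  have 1: "hyp_coeff m n (Suc (Suc k)) = x ^ k * x^2 * ((N + 1/4) * A) * ((N + 3/4) * B) / ((K + 2) * (K + 1) * f)"
    unfolding hyp_coeff_def f pochhammer_rec[of "_ + _" "Suc k"] A_def B_def N_K_x_def by (simp add: power2_eq_square)
  have 2: "hyp_coeff m (Suc n) (Suc (Suc k)) = x ^ k * x^2 * ((N + K + 9/4) * A) * ((N + K + 11/4) * B) / ((K + 2) * (K + 1) * f)"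
    unfolding hyp_coeff_def f Suc_n pochhammer_rec'[of _ "Suc k"] A_def[symmetric] B_def[symmetric] by (simp add: N_K_x_def power2_eq_square algebra_simps)
  have 3: "hyp_coeff m (Suc n) (Suc k) = x ^ k * x * A * B / ((K + 1) * f)"
    unfolding hyp_coeff_def f Suc_n A_def[symmetric] B_def[symmetric] by (simp add: N_K_x_def)
  have 4: "(N + 5/4) * (N + 7/4) * hyp_coeff m (Suc (Suc n)) k = x ^ k * A * B / f"
    unfolding hyp_coeff_def Suc_n A_def B_def pochhammer_rec[of _ k] f_def by (simp add: N_K_x_def add_ac)
  have 5: "of_nat m ^ 2 * (4 * of_nat n + 5) * (4 * of_nat n + 7) * hyp_coeff m (Suc (Suc n)) k = x ^ 2 * (x ^ k * A * B / f)"
    unfolding 4[symmetric] m by (simp add: N_K_x_def field_simps power2_eq_square)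
  show ?thesis
    unfolding 1 2 3 5 unfolding m N_K_x_def(1)[symmetric] using f(1) K
    by (simp add: divide_simps) (simp add: algebra_simps power2_eq_square)
qed

lemma hyp_series_contiguous:
  "hyp_series m n = (1 - fps_const (8 * of_nat m * (of_nat n + 1)) * fps_X) * hyp_series m (Suc n)
     - fps_const (of_nat m ^ 2 * (4 * of_nat n + 5) * (4 * of_nat n + 7)) * fps_X ^ 2 * hyp_series m (Suc (Suc n))"
proof (rule fps_ext)
  fix k
  consider "k = 0" | "k = 1" | j where "k = Suc (Suc j)" by (metis One_nat_def not0_implies_Suc)
  then show "hyp_series m n $ k = ((1 - fps_const (8 * of_nat m * (of_nat n + 1)) * fps_X) * hyp_series m (Suc n)
     - fps_const (of_nat m ^ 2 * (4 * of_nat n + 5) * (4 * of_nat n + 7)) * fps_X ^ 2 * hyp_series m (Suc (Suc n))) $ k"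
  proof cases
    case 1 then show ?thesis
      by (simp add: hyp_series_def left_diff_distrib mult.assoc fps_X_power_mult_nth)
  next
    case 2 then show ?thesis
      using hyp_coeff_contiguous_1[of m n] by (simp add: hyp_series_def left_diff_distrib mult.assoc fps_X_power_mult_nth)
  next
    case 3 then show ?thesis
      using hyp_coeff_contiguous[of m n j] by (simp add: hyp_series_def left_diff_distrib mult.assoc fps_X_power_mult_nth)
  qed
qed

definition pade_denom_fps :: "nat \<Rightarrow> nat \<Rightarrow> rat fps" where
  "pade_denom_fps m n = fps_of_poly (Q4 m n)"

lemma pade_denom_fps_nth: "pade_denom_fps m n $ i = of_int (coeff (pade_denom m n) i)"
  by (simp add: pade_denom_fps_def Q4_eq coeff_map_poly)

lemma pade_denom_fps_0: "pade_denom_fps m 0 = 1"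
  by (rule fps_ext) (simp add: pade_denom_fps_nth)

lemma pade_denom_fps_1: "pade_denom_fps m (Suc 0) = 1 - fps_const (8 * of_nat m) * fps_X"
  by (rule fps_ext) (auto simp add: pade_denom_fps_nth coeff_pCons split: nat.split)

lemma pade_denom_fps_Suc_Suc:
  "pade_denom_fps m (Suc (Suc n)) = (1 - fps_const (8 * of_nat m * (of_nat n + 2)) * fps_X) * pade_denom_fps m (Suc n)
     - fps_const (of_nat m ^ 2 * (4 * of_nat n + 5) * (4 * of_nat n + 7)) * fps_X ^ 2 * pade_denom_fps m n"
  by (rule fps_ext) (auto simp: pade_denom_fps_nth coeff_pCons coeff_monom_mult left_diff_distrib mult.assoc fps_X_power_mult_nth
      split: nat.split)

text \<open>Each use of the contiguous relation trades the pair of series for the next one, and the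
  coefficient of the first series then changes by exactly the recurrence of
  \<open>pade_denom\<close>.\<close>

lemma hyp_series_eq_pade:
  "hyp_series m 0 = pade_denom_fps m (Suc n) * hyp_series m (Suc n)
     - fps_const (of_nat m ^ 2 * (4 * of_nat n + 5) * (4 * of_nat n + 7)) * fps_X ^ 2 * pade_denom_fps m n * hyp_series m (Suc (Suc n))"
proof (induction n)
  case 0
  show ?case
    by (subst hyp_series_contiguous) (simp add: pade_denom_fps_0 pade_denom_fps_1)
next
  case (Suc n)
  define c where "c = fps_const (of_nat m ^ 2 * (4 * of_nat n + 5) * (4 * of_nat n + 7) :: rat) * fps_X ^ 2"
  define d where "d = fps_const (of_nat m ^ 2 * (4 * of_nat (Suc n) + 5) * (4 * of_nat (Suc n) + 7) :: rat) * fps_X ^ 2"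
  define g where "g = 1 - fps_const (8 * of_nat m * (of_nat n + 2) :: rat) * fps_X"
  have W: "hyp_series m (Suc n) = g * hyp_series m (Suc (Suc n)) - d * hyp_series m (Suc (Suc (Suc n)))"
    using hyp_series_contiguous[of m "Suc n"] by (simp add: g_def d_def add_ac)
  have Q: "pade_denom_fps m (Suc (Suc n)) = g * pade_denom_fps m (Suc n) - c * pade_denom_fps m n"
    unfolding g_def c_def by (rule pade_denom_fps_Suc_Suc)
  have "hyp_series m 0 = pade_denom_fps m (Suc n) * hyp_series m (Suc n) - c * pade_denom_fps m n * hyp_series m (Suc (Suc n))"
    using Suc.IH by (simp add: c_def)
  also have "\<dots> = pade_denom_fps m (Suc (Suc n)) * hyp_series m (Suc (Suc n)) - d * pade_denom_fps m (Suc n) * hyp_series m (Suc (Suc (Suc n)))"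
    unfolding W Q by (simp add: algebra_simps)
  finally show ?case unfolding d_def .
qed

section \<open>Power series modulo prime powers\<close>

definition fps_padic_dvd :: "nat \<Rightarrow> nat \<Rightarrow> rat fps \<Rightarrow> bool" where
  "fps_padic_dvd p e f \<longleftrightarrow> (\<forall>n. padic_dvd p e (f $ n))"

lemma fps_padic_dvd_add: "fps_padic_dvd p e f \<Longrightarrow> fps_padic_dvd p e g \<Longrightarrow> fps_padic_dvd p e (f + g)"
  by (simp add: fps_padic_dvd_def padic_dvd_add)

lemma fps_padic_dvd_diff: "fps_padic_dvd p e f \<Longrightarrow> fps_padic_dvd p e g \<Longrightarrow> fps_padic_dvd p e (f - g)"
  by (simp add: fps_padic_dvd_def padic_dvd_diff)

lemma fps_padic_dvd_mult: "fps_padic_dvd p e f \<Longrightarrow> fps_padic_dvd p e' g \<Longrightarrow> fps_padic_dvd p (e + e') (f * g)"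
  unfolding fps_padic_dvd_def fps_mult_nth by (blast intro: padic_dvd_sum padic_dvd_mult)

lemma fps_padic_dvd_power: "fps_padic_dvd p e f \<Longrightarrow> fps_padic_dvd p (e * k) (f ^ k)"
proof (induction k)
  case 0
  then show ?case using padic_dvd_0_of_int[of p 1] by (auto simp: fps_padic_dvd_def fps_one_nth)
next
  case (Suc k)
  then show ?case using fps_padic_dvd_mult[of p e f "e * k" "f ^ k"] by simp
qed

lemma fps_padic_dvd_inverse:
  assumes "fps_padic_dvd p 0 f" "f $ 0 = 1"
  shows "fps_padic_dvd p 0 (inverse f)"
  unfolding fps_padic_dvd_def
proof
  fix n show "padic_dvd p 0 (inverse f $ n)"
  proof (induction n rule: less_induct)
    case (less n)
    show ?case
    proof (cases n)
      case 0
      then show ?thesis using assms(2) padic_dvd_0_of_int[of p 1] by simp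
    next
      case (Suc l)
      have "inverse f $ n = - (\<Sum>i=1..n. f $ i * inverse f $ (n - i))"
        using Suc assms(2) by (simp add: fps_inverse_def)
      moreover have "padic_dvd p (0 + 0) (f $ i * inverse f $ (n - i))" if "i \<in> {1..n}" for i
        using assms(1) less that unfolding fps_padic_dvd_def by (intro padic_dvd_mult) auto
      then have "padic_dvd p 0 (\<Sum>i=1..n. f $ i * inverse f $ (n - i))"
        by (intro padic_dvd_sum) simp
      ultimately show ?thesis by (metis padic_dvd_minus)
    qed
  qed
qed

text \<open>The p-integral series that are polynomials modulo \<open>p ^ e\<close>. They form a ring
  closed under z d/dz, so numerator and denominator of F both belong to it.\<close>

definition poly_mod :: "nat \<Rightarrow> nat \<Rightarrow> rat fps \<Rightarrow> bool" where
  "poly_mod p e f \<longleftrightarrow> fps_padic_dvd p 0 f \<and> (\<exists>N. \<forall>n\<ge>N. padic_dvd p e (f $ n))"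

lemma poly_mod_add: "poly_mod p e f \<Longrightarrow> poly_mod p e g \<Longrightarrow> poly_mod p e (f + g)"
  unfolding poly_mod_def
proof (elim conjE exE, intro conjI)
  fix M N assume "\<forall>n\<ge>M. padic_dvd p e (f $ n)" "\<forall>n\<ge>N. padic_dvd p e (g $ n)"
  then show "\<exists>N. \<forall>n\<ge>N. padic_dvd p e ((f + g) $ n)"
    by (intro exI[of _ "max M N"]) (simp add: padic_dvd_add)
qed (rule fps_padic_dvd_add)

lemma poly_mod_mult:
  assumes "poly_mod p e f" "poly_mod p e g"
  shows "poly_mod p e (f * g)"
proof -
  obtain M N where f: "fps_padic_dvd p 0 f" "\<And>n. n \<ge> M \<Longrightarrow> padic_dvd p e (f $ n)"
    and g: "fps_padic_dvd p 0 g" "\<And>n. n \<ge> N \<Longrightarrow> padic_dvd p e (g $ n)"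
    using assms unfolding poly_mod_def by blast
  have "padic_dvd p e ((f * g) $ n)" if nMN: "n \<ge> M + N" for n
    unfolding fps_mult_nth
  proof (rule padic_dvd_sum)
    fix i assume "i \<in> {0..n}"
    then consider "i \<ge> M" | "n - i \<ge> N" using nMN by fastforce
    then show "padic_dvd p e (f $ i * g $ (n - i))"
    proof cases
      case 1
      then show ?thesis using padic_dvd_mult[of p e "f $ i" 0 "g $ (n - i)"] f(2) g(1) by (simp add: fps_padic_dvd_def)
    next
      case 2
      then show ?thesis using padic_dvd_mult[of p 0 "f $ i" e "g $ (n - i)"] f(1) g(2) by (simp add: fps_padic_dvd_def)
    qed
  qed
  moreover have "fps_padic_dvd p 0 (f * g)" using fps_padic_dvd_mult[OF f(1) g(1)] by simp
  ultimately show ?thesis unfolding poly_mod_def by blast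
qed

lemma poly_mod_of_fps_of_poly:
  assumes "fps_padic_dvd p 0 (fps_of_poly q)"
  shows "poly_mod p e (fps_of_poly q)"
  unfolding poly_mod_def using assms
  by (intro conjI exI[of _ "Suc (degree q)"]) (auto simp: coeff_eq_0)

lemma poly_mod_const: "poly_mod p e (fps_const (of_int c))"
  unfolding poly_mod_def fps_padic_dvd_def by (auto intro!: exI[of _ 1])

lemma poly_mod_power: "poly_mod p e f \<Longrightarrow> poly_mod p e (f ^ k)"
  using poly_mod_const[of p e 1] by (induction k) (auto intro: poly_mod_mult)

lemma poly_mod_hyp_series:
  assumes "prime p" "odd p"
  shows "poly_mod p e (hyp_series m n)"
  unfolding poly_mod_def fps_padic_dvd_def hyp_series_def
  using padic_dvd_hyp_coeff[OF assms] by (auto intro!: exI[of _ "e * p"])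

lemma poly_mod_X_deriv:
  assumes "poly_mod p e f"
  shows "poly_mod p e (fps_X * fps_deriv f)"
proof -
  have n: "(fps_X * fps_deriv f) $ n = of_int (int n) * f $ n" for n
    by (cases n) simp_all
  have "padic_dvd p d ((fps_X * fps_deriv f) $ n)" if "padic_dvd p d (f $ n)" for n d
    using padic_dvd_mult[OF padic_dvd_0_of_int that, of "int n"] unfolding n by simp
  then show ?thesis using assms unfolding poly_mod_def fps_padic_dvd_def by blast
qed

text \<open>In \<open>hyp_series_eq_pade\<close>, taken at the critical index, the first series is 1
  modulo p and the constant \<open>m^2 * (4 * n + 1) * (4 * n + 3)\<close> of the second term is a
  multiple of p.\<close>

lemma fps_padic_dvd_hyp_series_diff_pade:
  assumes p: "prime p" "p = 4 * n + 1 \<or> p = 4 * n + 3"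
  shows "fps_padic_dvd p 1 (hyp_series m 0 - pade_denom_fps m n)"
proof -
  have odd: "odd p" using p(2) by auto
  have W: "fps_padic_dvd p 1 (hyp_series m n - 1)"
    using padic_dvd_hyp_coeff_critical[OF p, of _ m] by (auto simp: fps_padic_dvd_def hyp_series_def fps_one_nth)
  have Q: "fps_padic_dvd p 0 (pade_denom_fps m i)" for i
    by (simp add: fps_padic_dvd_def pade_denom_fps_nth)
  show ?thesis
  proof (cases n)
    case 0
    then show ?thesis using W by (simp add: pade_denom_fps_0)
  next
    case (Suc l)
    define c where "c = int m ^ 2 * (4 * int l + 5) * (4 * int l + 7)"
    define d where "d = fps_const (of_int c :: rat) * fps_X ^ 2"
    have "int p ^ 1 dvd c" using p(2) unfolding c_def Suc by (auto simp: add_ac)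
    then have d: "fps_padic_dvd p 1 d" unfolding d_def fps_padic_dvd_def
      by (auto simp: padic_dvd_of_int fps_X_power_iff fps_mult_left_const_nth intro: padic_dvd_of_int)
    have "hyp_series m 0 = pade_denom_fps m n * hyp_series m n - d * pade_denom_fps m l * hyp_series m (Suc (Suc l))"
      using hyp_series_eq_pade[of m l] by (simp add: d_def c_def Suc)
    then have "hyp_series m 0 - pade_denom_fps m n = pade_denom_fps m n * (hyp_series m n - 1) - d * (pade_denom_fps m l * hyp_series m (Suc (Suc l)))"
      by (simp add: algebra_simps)
    moreover have "fps_padic_dvd p (0 + 1) (pade_denom_fps m n * (hyp_series m n - 1))"
      by (intro fps_padic_dvd_mult Q W)
    moreover have "fps_padic_dvd p (1 + (0 + 0)) (d * (pade_denom_fps m l * hyp_series m (Suc (Suc l))))"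
      using poly_mod_hyp_series[OF p(1) odd] by (intro fps_padic_dvd_mult Q d) (auto simp: poly_mod_def)
    ultimately show ?thesis by (simp add: fps_padic_dvd_diff)
  qed
qed

lemma hyp_quotient_congruent_rational:
  fixes F :: "int fps"
  assumes p: "prime p" "p = 4 * n + 1 \<or> p = 4 * n + 3"
    and F: "rat_fps_of_int_fps F * hyp_series m 0 = hyp_series m 0 + fps_const (4 * of_nat m) * fps_X * fps_deriv (hyp_series m 0)"
  shows "\<exists>P. fps_cong_mod (rat_fps_of_int_fps F) (rat_fps_of_int_poly P * inverse (fps_of_poly (Q4 m n) ^ \<alpha>)) (p ^ \<alpha>)"
proof -
  have odd: "odd p" using p(2) by auto
  define H where "H = hyp_series m 0"
  define Q where "Q = pade_denom_fps m n"
  define D where "D = H + fps_const (4 * of_nat m) * fps_X * fps_deriv H"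
  define E where "E = Q - H"
  have H: "poly_mod p e H" for e
    unfolding H_def by (rule poly_mod_hyp_series[OF p(1) odd])
  have H0: "H $ 0 = 1" by (simp add: H_def hyp_series_def)
  have Q: "poly_mod p e Q" for e
    unfolding Q_def pade_denom_fps_def
    by (rule poly_mod_of_fps_of_poly) (simp add: fps_padic_dvd_def Q4_eq coeff_map_poly)
  have D: "poly_mod p e D" for e
  proof -
    have "poly_mod p e (fps_const (of_int (4 * int m)) * (fps_X * fps_deriv H))"
      by (intro poly_mod_mult poly_mod_const poly_mod_X_deriv H)
    then show ?thesis unfolding D_def by (intro poly_mod_add H) (simp add: mult.assoc)
  qed
  have E: "poly_mod p e E" for e
  proof -
    have "E = Q + fps_const (of_int (-1)) * H" by (simp add: E_def fps_const_neg[symmetric] del: fps_const_neg)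
    then show ?thesis using poly_mod_add[OF Q poly_mod_mult[OF poly_mod_const H]] by metis
  qed
  have Ep: "fps_padic_dvd p 1 E"
    using fps_padic_dvd_diff[of p 1 0 "H - Q"] fps_padic_dvd_hyp_series_diff_pade[OF p, of m]
    unfolding E_def H_def Q_def by (simp add: fps_padic_dvd_def)
  \<comment> \<open>As \<open>Q = H + E\<close>, the powers \<open>Q ^ k\<close> and
    \<open>E ^ k\<close> differ by a multiple of \<open>H\<close>; for \<open>k = \<alpha>\<close>
    the power of \<open>E\<close> is 0 modulo \<open>p ^ \<alpha>\<close>.\<close>
  have "\<exists>G. Q ^ k = H * G + E ^ k \<and> poly_mod p \<alpha> G" for k
  proof (induction k)
    case 0
    show ?case using poly_mod_const[of p \<alpha> 0] by (intro exI[of _ 0]) simp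
  next
    case (Suc k)
    then obtain G where G: "Q ^ k = H * G + E ^ k" "poly_mod p \<alpha> G" by blast
    have "Q ^ Suc k = H * (Q * G + E ^ k) + E ^ Suc k"
      using G(1) by (simp add: E_def algebra_simps)
    moreover have "poly_mod p \<alpha> (Q * G + E ^ k)"
      by (intro poly_mod_add poly_mod_mult poly_mod_power Q E G)
    ultimately show ?case by blast
  qed
  then obtain G where G: "Q ^ \<alpha> = H * G + E ^ \<alpha>" "poly_mod p \<alpha> G" by blast
  define R where "R = rat_fps_of_int_fps F"
  have "R * H = D" using F by (simp add: R_def H_def D_def)
  then have R: "R = D * inverse H"
    using H0 by (metis inverse_mult_eq_1' mult.assoc mult.right_neutral one_neq_zero)
  \<comment> \<open>The multiple of \<open>H\<close> clears the denominator of
    \<open>R = D / H\<close> and leaves a polynomial modulo \<open>p ^ \<alpha>\<close>; in the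
    remaining term p-integrality of \<open>R\<close> suffices.\<close>
  have RQ: "R * Q ^ \<alpha> = D * G + D * inverse H * E ^ \<alpha>"
  proof -
    have "R * Q ^ \<alpha> = (R * H) * G + R * E ^ \<alpha>" unfolding G(1) by (simp add: algebra_simps)
    then show ?thesis unfolding \<open>R * H = D\<close> using R by simp
  qed
  have "fps_padic_dvd p (0 + 0 + 1 * \<alpha>) (D * inverse H * E ^ \<alpha>)"
    using D H H0 Ep by (intro fps_padic_dvd_mult fps_padic_dvd_power fps_padic_dvd_inverse) (auto simp: poly_mod_def)
  moreover have "poly_mod p \<alpha> (D * G)" by (intro poly_mod_mult D G)
  ultimately obtain N where N: "\<And>k. k \<ge> N \<Longrightarrow> padic_dvd p \<alpha> ((R * Q ^ \<alpha>) $ k)"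
    unfolding RQ poly_mod_def fps_padic_dvd_def by (metis add_0 fps_add_nth mult_1 padic_dvd_add)
  define q where "q = fps_of_poly (pade_denom m n)"
  have q0: "q $ 0 = 1" by (simp add: q_def pade_denom_coeff_0)
  have of_mult: "rat_fps_of_int_fps (f * g) = rat_fps_of_int_fps f * rat_fps_of_int_fps g" for f g
    by (rule fps_ext) (simp add: rat_fps_of_int_fps_def fps_mult_nth)
  have of_1: "rat_fps_of_int_fps 1 = 1"
    by (rule fps_ext) (simp add: rat_fps_of_int_fps_def fps_one_nth)
  have of_pow: "rat_fps_of_int_fps (f ^ k) = rat_fps_of_int_fps f ^ k" for f k
    by (induction k) (simp_all add: of_mult of_1)
  have Qq: "Q = rat_fps_of_int_fps q"
    by (rule fps_ext) (simp add: rat_fps_of_int_fps_def q_def Q_def pade_denom_fps_nth)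
  define T where "T = F * q ^ \<alpha>"
  have T: "rat_fps_of_int_fps T = R * Q ^ \<alpha>"
    by (simp add: T_def R_def Qq of_mult of_pow)
  have Tp: "int p ^ \<alpha> dvd T $ k" if "k \<ge> N" for k
    using N[OF that] unfolding T[symmetric] by (intro padic_dvd_of_intD) (simp add: rat_fps_of_int_fps_def)
  \<comment> \<open>The coefficients of \<open>T\<close> below \<open>N\<close> go into the
    polynomial \<open>P\<close>; the others are \<open>p ^ \<alpha>\<close> times those of the
    integer series \<open>U\<close>.\<close>
  define U where "U = Abs_fps (\<lambda>k. T $ k div int p ^ \<alpha> * of_bool (k \<ge> N))"
  define P where "P = Poly (map (\<lambda>k. T $ k) [0..<N])"
  have TP: "T = fps_of_poly P + fps_const (int p ^ \<alpha>) * U"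
  proof (rule fps_ext)
    fix k show "T $ k = (fps_of_poly P + fps_const (int p ^ \<alpha>) * U) $ k"
      using Tp[of k] by (cases "k \<ge> N") (auto simp: P_def U_def coeff_Poly_eq nth_default_def)
  qed
  \<comment> \<open>The constant term 1 makes \<open>q\<close> invertible over the integers, so
    division by \<open>q ^ \<alpha>\<close> preserves congruences between integer
    coefficients.\<close>
  obtain q' where q': "q * q' = 1"
  proof -
    have "fps_left_inverse q 1 * q = 1" using q0 by (intro fps_left_inverse) simp
    then show ?thesis using that by (metis mult.commute)
  qed
  have Qi: "inverse (Q ^ \<alpha>) = rat_fps_of_int_fps (q' ^ \<alpha>)"
  proof -
    have "Q ^ \<alpha> * rat_fps_of_int_fps (q' ^ \<alpha>) = 1"
      unfolding Qq of_pow[symmetric] of_mult[symmetric] power_mult_distrib[symmetric] q' by (simp add: of_1)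
    then show ?thesis by (metis fps_inverse_unique mult.commute)
  qed
  have PP: "rat_fps_of_int_poly P = rat_fps_of_int_fps (fps_of_poly P)"
    by (rule fps_ext) (simp add: rat_fps_of_int_poly_def rat_fps_of_int_fps_def coeff_map_poly)
  have "F = T * q' ^ \<alpha>"
    unfolding T_def mult.assoc power_mult_distrib[symmetric] q' by simp
  then have "F - fps_of_poly P * q' ^ \<alpha> = fps_const (int p ^ \<alpha>) * (U * q' ^ \<alpha>)"
    unfolding TP by (simp add: algebra_simps)
  then have "F $ k - (fps_of_poly P * q' ^ \<alpha>) $ k = int p ^ \<alpha> * (U * q' ^ \<alpha>) $ k" for k
    by (metis fps_mult_left_const_nth fps_sub_nth)
  then have "of_int (F $ k) - of_int ((fps_of_poly P * q' ^ \<alpha>) $ k) = (of_nat (p ^ \<alpha>) * of_int ((U * q' ^ \<alpha>) $ k) :: rat)" for k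
    by (metis of_int_diff of_int_mult of_int_of_nat_eq of_nat_power)
  then have "fps_cong_mod (rat_fps_of_int_fps F) (rat_fps_of_int_fps (fps_of_poly P * q' ^ \<alpha>)) (p ^ \<alpha>)"
    unfolding fps_cong_mod_def by (auto simp: rat_fps_of_int_fps_def)
  then show ?thesis
    unfolding of_mult PP[symmetric] Qi[symmetric] Q_def pade_denom_fps_def by blast
qed

section \<open>Presented groups\<close>

lemma gwords_Nil [simp]: "[] \<in> gwords X"
  and gwords_Cons [simp]: "l # w \<in> gwords X \<longleftrightarrow> fst l \<in> X \<and> w \<in> gwords X"
  and gwords_append [simp]: "v @ w \<in> gwords X \<longleftrightarrow> v \<in> gwords X \<and> w \<in> gwords X"
  by (auto simp: gwords_def mem_Times_iff)

lemma gen_pow_0 [simp]: "gen_pow g 0 = []"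
  and gen_pow_Suc: "gen_pow g (Suc k) = (g, True) # gen_pow g k"
  by (simp_all add: gen_pow_def)

lemma gen_pow_add: "gen_pow g (j + k) = gen_pow g j @ gen_pow g k"
  by (simp add: gen_pow_def replicate_add)

lemma gen_pow_in_gwords [simp]: "g \<in> X \<Longrightarrow> gen_pow g k \<in> gwords X"
  by (induction k) (simp_all add: gen_pow_Suc)

lemma pres_equiv_in_gwords: "pres_equiv X R v w \<Longrightarrow> v \<in> gwords X \<and> w \<in> gwords X"
  by (induction rule: pres_equiv.induct) auto

lemma pres_equiv_context:
  assumes "pres_equiv X R v w" "a \<in> gwords X" "b \<in> gwords X"
  shows "pres_equiv X R (a @ v @ b) (a @ w @ b)"
  using assms(1)
proof (induction rule: pres_equiv.induct)
  case (cancel u v x c)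
  then show ?case
    using pres_equiv.cancel[of "a @ u" X "v @ b" x R c] assms(2,3) by simp
next
  case (relation u v r s)
  then show ?case
    using pres_equiv.relation[of "a @ u" X "v @ b" r s R] assms(2,3) by simp
qed (use assms(2,3) in \<open>auto intro: pres_equiv.intros(1-3)\<close>)

lemma pres_equiv_append:
  assumes "pres_equiv X R v v'" "pres_equiv X R w w'"
  shows "pres_equiv X R (v @ w) (v' @ w')"
proof -
  have "pres_equiv X R (v @ w) (v' @ w)"
    using pres_equiv_context[OF assms(1), of "[]" w] pres_equiv_in_gwords[OF assms(2)] by simp
  also have "pres_equiv X R (v' @ w) (v' @ w')"
    using pres_equiv_context[OF assms(2), of v' "[]"] pres_equiv_in_gwords[OF assms(1)] by simp
  finally (pres_equiv.trans) show ?thesis .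
qed

lemma pres_equiv_relation_self:
  "(r, s) \<in> R \<Longrightarrow> r \<in> gwords X \<Longrightarrow> s \<in> gwords X \<Longrightarrow> pres_equiv X R r s"
  using pres_equiv.relation[of "[]" X "[]" r s R] by simp

lemma equiv_pres_rel: "equiv (gwords X) (pres_rel X R)"
proof (rule equivI)
  show "refl_on (gwords X) (pres_rel X R)"
    by (auto simp: refl_on_def pres_rel_def intro: pres_equiv.refl)
  show "pres_rel X R \<subseteq> gwords X \<times> gwords X"
    by (auto simp: pres_rel_def dest: pres_equiv_in_gwords)
  show "Relation.sym (pres_rel X R)"
    by (auto simp: sym_def pres_rel_def intro: pres_equiv.sym)
  show "Relation.trans (pres_rel X R)"
    by (auto simp: trans_def pres_rel_def intro: pres_equiv.trans)
qed

definition wclass :: "'x set \<Rightarrow> ('x gword \<times> 'x gword) set \<Rightarrow> 'x gword \<Rightarrow> 'x gword set" where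
  "wclass X R w = pres_rel X R `` {w}"

lemma wclass_eq_iff:
  "v \<in> gwords X \<Longrightarrow> w \<in> gwords X \<Longrightarrow> wclass X R v = wclass X R w \<longleftrightarrow> pres_equiv X R v w"
  unfolding wclass_def using eq_equiv_class_iff[OF equiv_pres_rel, of v X w R] by (simp add: pres_rel_def)

lemma wclass_eqI: "pres_equiv X R v w \<Longrightarrow> wclass X R v = wclass X R w"
  using pres_equiv_in_gwords wclass_eq_iff by blast

lemma mem_wclass_self: "w \<in> gwords X \<Longrightarrow> w \<in> wclass X R w"
  by (simp add: wclass_def pres_rel_def pres_equiv.refl)

lemma mem_wclassD: "v \<in> wclass X R w \<Longrightarrow> pres_equiv X R w v"
  by (simp add: wclass_def pres_rel_def)

lemma carrier_presented_group: "carrier (presented_group X R) = wclass X R ` gwords X"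
  by (auto simp: presented_group_def quotient_def wclass_def)

lemma wclass_in_carrier [simp]: "w \<in> gwords X \<Longrightarrow> wclass X R w \<in> carrier (presented_group X R)"
  by (simp add: carrier_presented_group)

lemma one_presented_group: "\<one>\<^bsub>presented_group X R\<^esub> = wclass X R []"
  by (simp add: presented_group_def wclass_def)

text \<open>Equivalence is compatible with concatenation, so the union that defines the product runs
  over copies of one and the same class.\<close>

lemma wclass_mult:
  assumes "v \<in> gwords X" "w \<in> gwords X"
  shows "wclass X R v \<otimes>\<^bsub>presented_group X R\<^esub> wclass X R w = wclass X R (v @ w)"
proof -
  have *: "pres_rel X R `` {v' @ w'} = wclass X R (v @ w)" if "v' \<in> wclass X R v" "w' \<in> wclass X R w" for v' w'
    using wclass_eqI[OF pres_equiv_append[OF mem_wclassD[OF that(1)] mem_wclassD[OF that(2)]]]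
    by (simp add: wclass_def)
  have "wclass X R v \<otimes>\<^bsub>presented_group X R\<^esub> wclass X R w =
    (\<Union>v'\<in>wclass X R v. \<Union>w'\<in>wclass X R w. pres_rel X R `` {v' @ w'})"
    by (simp add: presented_group_def)
  also have "\<dots> = wclass X R (v @ w)"
    using * mem_wclass_self[OF assms(1)] mem_wclass_self[OF assms(2)] by (auto; blast)
  finally show ?thesis .
qed

definition letter_inv :: "'x \<times> bool \<Rightarrow> 'x \<times> bool" where
  "letter_inv l = (fst l, \<not> snd l)"

lemma letter_inv_simps [simp]: "letter_inv (letter_inv l) = l" "fst (letter_inv l) = fst l"
  "snd (letter_inv l) = (\<not> snd l)" "letter_inv (x, b) = (x, \<not> b)"
  by (simp_all add: letter_inv_def)

definition word_inv :: "'x gword \<Rightarrow> 'x gword" where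
  "word_inv w = rev (map letter_inv w)"

lemma word_inv_simps [simp]: "word_inv [] = []" "word_inv (l # w) = word_inv w @ [letter_inv l]"
   "word_inv (v @ w) = word_inv w @ word_inv v" "word_inv (word_inv w) = w"
  by (simp_all add: word_inv_def rev_map comp_def)

lemma word_inv_in_gwords [simp]: "word_inv w \<in> gwords X \<longleftrightarrow> w \<in> gwords X"
  by (induction w) auto

lemma pres_equiv_cancel_letter:
  assumes "fst l \<in> X" "u \<in> gwords X" "v \<in> gwords X"
  shows "pres_equiv X R (u @ [l, letter_inv l] @ v) (u @ v)"
  using pres_equiv.cancel[OF assms(2,3,1), of R "snd l"] by (simp add: letter_inv_def)

lemma pres_equiv_word_inv_right:
  "w \<in> gwords X \<Longrightarrow> pres_equiv X R (w @ word_inv w) []"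
proof (induction w)
  case (Cons l w)
  then have "pres_equiv X R ([l] @ (w @ word_inv w) @ [letter_inv l]) ([l] @ [] @ [letter_inv l])"
    by (intro pres_equiv_context) auto
  also have "pres_equiv X R ([l] @ [] @ [letter_inv l]) []"
    using pres_equiv_cancel_letter[of l X "[]" "[]" R] Cons.prems by simp
  finally (pres_equiv.trans) show ?case by simp
qed (simp add: pres_equiv.refl)

lemma pres_equiv_word_inv_left: "w \<in> gwords X \<Longrightarrow> pres_equiv X R (word_inv w @ w) []"
  using pres_equiv_word_inv_right[of "word_inv w" X R] by simp

lemma group_presented_group: "group (presented_group X R)"
proof (rule groupI)
  fix x y assume "x \<in> carrier (presented_group X R)" "y \<in> carrier (presented_group X R)"
  then show "x \<otimes>\<^bsub>presented_group X R\<^esub> y \<in> carrier (presented_group X R)"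
    by (auto simp: carrier_presented_group wclass_mult)
next
  fix x y z assume "x \<in> carrier (presented_group X R)" "y \<in> carrier (presented_group X R)" "z \<in> carrier (presented_group X R)"
  then show "x \<otimes>\<^bsub>presented_group X R\<^esub> y \<otimes>\<^bsub>presented_group X R\<^esub> z = x \<otimes>\<^bsub>presented_group X R\<^esub> (y \<otimes>\<^bsub>presented_group X R\<^esub> z)"
    by (auto simp: carrier_presented_group wclass_mult)
next
  fix x assume "x \<in> carrier (presented_group X R)"
  then obtain w where w: "w \<in> gwords X" "x = wclass X R w" by (auto simp: carrier_presented_group)
  then have "wclass X R (word_inv w) \<otimes>\<^bsub>presented_group X R\<^esub> x = \<one>\<^bsub>presented_group X R\<^esub>"
    by (simp add: wclass_mult one_presented_group wclass_eqI[OF pres_equiv_word_inv_left])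
  then show "\<exists>y\<in>carrier (presented_group X R). y \<otimes>\<^bsub>presented_group X R\<^esub> x = \<one>\<^bsub>presented_group X R\<^esub>"
    using w(1) by (intro bexI[of _ "wclass X R (word_inv w)"]) auto
qed (auto simp: carrier_presented_group wclass_mult one_presented_group)

lemma inv_wclass:
  assumes "w \<in> gwords X"
  shows "inv\<^bsub>presented_group X R\<^esub> (wclass X R w) = wclass X R (word_inv w)"
  using assms
  by (intro group.inv_equality[OF group_presented_group])
     (simp_all add: wclass_mult one_presented_group wclass_eqI[OF pres_equiv_word_inv_left])

lemma wclass_pow:
  assumes "w \<in> gwords X"
  shows "wclass X R w [^]\<^bsub>presented_group X R\<^esub> k = wclass X R (concat (replicate k w))"
proof (induction k)
  case 0
  then show ?case by (simp add: one_presented_group nat_pow_def)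
next
  case (Suc k)
  have "concat (replicate k w) \<in> gwords X" using assms by (induction k) auto
  moreover have "concat (replicate k w) @ w = concat (replicate (Suc k) w)"
    by (metis append_Nil2 concat.simps concat_append replicate_Suc replicate_append_same)
  ultimately show ?case
    using assms Suc by (simp add: wclass_mult nat_pow_def)
qed

section \<open>Free groups are torsion free\<close>

text \<open>Left multiplication by a letter as a map on reduced words, in the manner of van der
  Waerden.\<close>

definition reduced_cons :: "'x \<times> bool \<Rightarrow> 'x gword \<Rightarrow> 'x gword" where
  "reduced_cons l w = (case w of [] \<Rightarrow> [l] | l' # w' \<Rightarrow> if l' = letter_inv l then w' else l # w)"

abbreviation reduced :: "'x gword \<Rightarrow> bool" where
  "reduced \<equiv> successively (\<lambda>l l'. l' \<noteq> letter_inv l)"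

definition reduce :: "'x gword \<Rightarrow> 'x gword" where
  "reduce w = foldr reduced_cons w []"

lemma reduced_reduced_cons: "reduced w \<Longrightarrow> reduced (reduced_cons l w)"
  by (auto simp: reduced_cons_def successively_Cons split: list.split)

lemma reduced_foldr: "reduced u \<Longrightarrow> reduced (foldr reduced_cons w u)"
  by (induction w) (auto intro: reduced_reduced_cons)

lemma reduced_cons_cancel: "reduced w \<Longrightarrow> reduced_cons l (reduced_cons (letter_inv l) w) = w"
  by (auto simp: reduced_cons_def successively_Cons split: list.splits)

lemma reduce_reduced: "reduced w \<Longrightarrow> reduce w = w"
  by (induction w) (auto simp: reduce_def reduced_cons_def successively_Cons split: list.splits)

lemma length_reduce: "length (reduce w) \<le> length w"
proof (induction w)
  case (Cons l w)
  have "length (reduced_cons l u) \<le> Suc (length u)" for u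
    by (auto simp: reduced_cons_def split: list.split)
  from this[of "reduce w"] Cons show ?case by (simp add: reduce_def)
qed (simp add: reduce_def)

text \<open>A letter and its inverse act on reduced words by mutually inverse maps, so equivalent
  words act alike. Uniqueness of the reduced form follows without a confluence argument.\<close>

lemma pres_equiv_free_reduce_eq:
  assumes "pres_equiv S {} v w" "reduced u"
  shows "foldr reduced_cons v u = foldr reduced_cons w u"
  using assms
proof (induction arbitrary: u rule: pres_equiv.induct)
  case (cancel a b x c)
  have "reduced_cons (x, c) (reduced_cons (letter_inv (x, c)) (foldr reduced_cons b u)) = foldr reduced_cons b u"
    by (intro reduced_cons_cancel reduced_foldr cancel)
  then show ?case by simp
qed auto

lemma pres_equiv_reduced_cons:
  assumes "fst l \<in> S" "w \<in> gwords S"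
  shows "pres_equiv S R (l # w) (reduced_cons l w)"
proof (cases "\<exists>w'. w = letter_inv l # w'")
  case True
  then obtain w' where "w = letter_inv l # w'" by blast
  then show ?thesis using pres_equiv_cancel_letter[of l S "[]" w' R] assms by (simp add: reduced_cons_def)
next
  case False
  then have "reduced_cons l w = l # w" by (auto simp: reduced_cons_def split: list.split)
  then show ?thesis using assms by (simp add: pres_equiv.refl)
qed

lemma pres_equiv_reduce:
  "w \<in> gwords S \<Longrightarrow> pres_equiv S R w (reduce w)"
proof (induction w)
  case (Cons l w)
  then have 1: "pres_equiv S R w (reduce w)" by simp
  have "pres_equiv S R ([l] @ w @ []) ([l] @ reduce w @ [])"
    using Cons by (intro pres_equiv_context 1) auto
  also have "pres_equiv S R ([l] @ reduce w @ []) (reduced_cons l (reduce w))"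
    using pres_equiv_reduced_cons[of l S "reduce w" R] pres_equiv_in_gwords[OF 1] Cons.prems by simp
  finally (pres_equiv.trans) show ?case by (simp add: reduce_def)
qed (simp add: reduce_def pres_equiv.refl)

lemma reduced_equiv_Nil: "reduced w \<Longrightarrow> pres_equiv S {} w [] \<Longrightarrow> w = []"
  using pres_equiv_free_reduce_eq[of S w "[]" "[]"] reduce_reduced[of w] by (simp add: reduce_def)

lemma pres_equiv_conj_pow:
  assumes "a \<in> gwords X" "u \<in> gwords X"
  shows "pres_equiv X R (concat (replicate k (a @ u @ word_inv a))) (a @ concat (replicate k u) @ word_inv a)"
proof (induction k)
  case 0
  then show ?case using assms pres_equiv_word_inv_right[THEN pres_equiv.sym] by simp
next
  case (Suc k)
  define U where "U = concat (replicate k u)"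
  have U: "U \<in> gwords X" unfolding U_def using assms by (induction k) auto
  have "pres_equiv X R ((a @ u @ word_inv a) @ concat (replicate k (a @ u @ word_inv a))) ((a @ u @ word_inv a) @ (a @ U @ word_inv a))"
    using assms Suc unfolding U_def by (intro pres_equiv_append pres_equiv.refl) auto
  also have "pres_equiv X R ((a @ u @ word_inv a) @ (a @ U @ word_inv a)) ((a @ u) @ [] @ (U @ word_inv a))"
    using pres_equiv_context[OF pres_equiv_word_inv_left[of a X R], of "a @ u" "U @ word_inv a"] assms U by simp
  finally (pres_equiv.trans) show ?case by (simp add: U_def)
qed

text \<open>Induction on the length by cyclic reduction. If the reduced form does not start with the
  inverse of its last letter, its powers are reduced and nonempty; otherwise it is a conjugate of a
  shorter word whose power is trivial too.\<close>

lemma free_word_torsion_free: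
  assumes "w \<in> gwords S" "pres_equiv S {} (concat (replicate k w)) []" "k > 0"
  shows "pres_equiv S {} w []"
  using assms(1,2)
proof (induction "length w" arbitrary: w rule: less_induct)
  case less
  define v where "v = reduce w"
  have wv: "pres_equiv S {} w v" unfolding v_def by (rule pres_equiv_reduce) fact
  have vS: "v \<in> gwords S" using pres_equiv_in_gwords[OF wv] by simp
  have vr: "reduced v" unfolding v_def reduce_def by (rule reduced_foldr) simp
  have pow: "pres_equiv S {} (concat (replicate j a)) (concat (replicate j b))" if "pres_equiv S {} a b" for a b j
    using that by (induction j) (auto intro: pres_equiv_append pres_equiv.refl)
  have vk: "pres_equiv S {} (concat (replicate k v)) []"
    by (rule pres_equiv.trans[OF pow[OF pres_equiv.sym[OF wv]] less.prems(2)])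
  have "v = []"
  proof (rule ccontr)
    assume ne: "v \<noteq> []"
    show False
    proof (cases "hd v = letter_inv (last v)")
      case False
      have "reduced (concat (replicate j v)) \<and> (j > 0 \<longrightarrow> concat (replicate j v) \<noteq> [] \<and> hd (concat (replicate j v)) = hd v)" for j
        using ne vr False by (induction j) (auto simp: successively_append_iff)
      from this[of k] show False using reduced_equiv_Nil[OF _ vk] assms(3) by blast
    next
      case True
      obtain l v' where v1: "v = l # v'" using ne by (cases v) auto
      \<comment> \<open>A letter is never its own inverse, so first and last letter stand at
        different places.\<close>
      have "v' \<noteq> []" using True v1 by (auto simp: letter_inv_def prod_eq_iff)
      then obtain u l' where "v' = u @ [l']" by (metis append_butlast_last_id)
      then have v: "v = [l] @ u @ word_inv [l]" using True v1 by simp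
      have lu: "[l] \<in> gwords S" "u \<in> gwords S" using vS v by auto
      define U where "U = concat (replicate k u)"
      have U: "U \<in> gwords S" unfolding U_def using lu by (induction k) auto
      have "pres_equiv S {} ([l] @ U @ word_inv [l]) []"
        using vk unfolding v U_def by (rule pres_equiv.trans[OF pres_equiv.sym[OF pres_equiv_conj_pow[OF lu]]])
      from pres_equiv_context[OF this, of "word_inv [l]" "[l]"] lu
      have 1: "pres_equiv S {} (word_inv [l] @ [l] @ U @ word_inv [l] @ [l]) (word_inv [l] @ [l])" by simp
      have 2: "pres_equiv S {} (word_inv [l] @ [l]) []" by (rule pres_equiv_word_inv_left[OF lu(1)])
      have 3: "pres_equiv S {} ((word_inv [l] @ [l]) @ U @ (word_inv [l] @ [l])) ([] @ U @ [])"
        using U by (intro pres_equiv_append 2 pres_equiv.refl)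
      have "pres_equiv S {} U []"
        using pres_equiv.trans[OF pres_equiv.sym[OF 3] pres_equiv.trans[OF _ 2]] 1
        by (simp only: append_assoc append_Nil append_Nil2)
      moreover have "length u < length w"
        using length_reduce[of w] v by (simp add: v_def)
      ultimately have u: "pres_equiv S {} u []"
        using less.hyps lu(2) unfolding U_def by blast
      have "pres_equiv S {} v ([l] @ [] @ word_inv [l])"
        unfolding v using lu by (intro pres_equiv_context u) auto
      also have "pres_equiv S {} ([l] @ [] @ word_inv [l]) []"
        using pres_equiv_word_inv_right[OF lu(1), of "{}"] by simp
      finally (pres_equiv.trans) show False using reduced_equiv_Nil[OF vr] ne by blast
    qed
  qed
  then show ?case using wv by simp
qed

lemma free_group_torsion_free:
  fixes G (structure)
  assumes "group G" "is_free_group G" "g \<in> carrier G" "g [^] (k::nat) = \<one>" "k > 0"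
  shows "g = \<one>"
proof -
  interpret group G by fact
  obtain S :: "'a set" where "free_group_on S \<cong> G"
    using assms(2) unfolding is_free_group_def by blast
  then obtain h where h: "h \<in> iso (free_group_on S) G" unfolding is_iso_def by blast
  define F where "F = presented_group S {}"
  have F: "group F" unfolding F_def by (rule group_presented_group)
  have hF: "group_hom F G h" using h F assms(1)
    by (intro group_hom.intro group_hom_axioms.intro) (auto simp: F_def free_group_on_def iso_def)
  have bij: "bij_betw h (carrier F) (carrier G)" using h by (simp add: iso_def F_def free_group_on_def)
  obtain w where w: "w \<in> gwords S" "g = h (wclass S {} w)"
    using bij assms(3) unfolding bij_betw_def F_def carrier_presented_group by auto
  have wF: "wclass S {} w \<in> carrier F" using w(1) by (simp add: F_def)
  have "h (wclass S {} w [^]\<^bsub>F\<^esub> k) = \<one>"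
    using group_hom.hom_nat_pow[OF hF wF] assms(4) w(2) by simp
  then have "h (wclass S {} w [^]\<^bsub>F\<^esub> k) = h \<one>\<^bsub>F\<^esub>"
    using group_hom.hom_one[OF hF] by simp
  moreover have "wclass S {} w [^]\<^bsub>F\<^esub> k \<in> carrier F" "\<one>\<^bsub>F\<^esub> \<in> carrier F"
    using F wF by (auto simp: group.is_monoid monoid.nat_pow_closed)
  ultimately have "wclass S {} w [^]\<^bsub>F\<^esub> k = \<one>\<^bsub>F\<^esub>"
    using bij unfolding bij_betw_def by (meson inj_onD)
  then have "wclass S {} (concat (replicate k w)) = wclass S {} []"
    using w(1) by (simp add: F_def wclass_pow one_presented_group)
  moreover have "concat (replicate k w) \<in> gwords S" using w(1) by (induction k) auto
  ultimately have "pres_equiv S {} (concat (replicate k w)) []"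
    by (simp add: wclass_eq_iff)
  then have "wclass S {} w = \<one>\<^bsub>F\<^esub>"
    using free_word_torsion_free[OF w(1) _ assms(5)] by (simp add: F_def one_presented_group wclass_eqI)
  then show ?thesis using group_hom.hom_one[OF hF] w(2) by simp
qed

section \<open>Evaluation of words and a criterion for freeness\<close>

definition letter_eval :: "('g, 'm) monoid_scheme \<Rightarrow> ('x \<Rightarrow> 'g) \<Rightarrow> 'x \<times> bool \<Rightarrow> 'g" where
  "letter_eval G f l = (if snd l then f (fst l) else inv\<^bsub>G\<^esub> (f (fst l)))"

primrec word_eval :: "('g, 'm) monoid_scheme \<Rightarrow> ('x \<Rightarrow> 'g) \<Rightarrow> 'x gword \<Rightarrow> 'g" where
  "word_eval G f [] = \<one>\<^bsub>G\<^esub>"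
| "word_eval G f (l # w) = letter_eval G f l \<otimes>\<^bsub>G\<^esub> word_eval G f w"

context group
begin

lemma letter_eval_in_subgroup:
  "subgroup H G \<Longrightarrow> (\<And>x. x \<in> X \<Longrightarrow> f x \<in> H) \<Longrightarrow> fst l \<in> X \<Longrightarrow> letter_eval G f l \<in> H"
  by (simp add: letter_eval_def subgroup.m_inv_closed)

lemma word_eval_in_subgroup:
  "subgroup H G \<Longrightarrow> (\<And>x. x \<in> X \<Longrightarrow> f x \<in> H) \<Longrightarrow> w \<in> gwords X \<Longrightarrow> word_eval G f w \<in> H"
  by (induction w) (auto intro: subgroup.m_closed subgroup.one_closed letter_eval_in_subgroup)

lemmas word_eval_closed = word_eval_in_subgroup[OF subgroup_self]
lemmas letter_eval_closed = letter_eval_in_subgroup[OF subgroup_self]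

lemma word_eval_append:
  assumes "\<And>x. x \<in> X \<Longrightarrow> f x \<in> carrier G" "v \<in> gwords X" "w \<in> gwords X"
  shows "word_eval G f (v @ w) = word_eval G f v \<otimes> word_eval G f w"
  using assms(2)
proof (induction v)
  case Nil
  then show ?case using word_eval_closed[OF assms(1,3)] by simp
next
  case (Cons l v)
  have "letter_eval G f l \<in> carrier G" "word_eval G f v \<in> carrier G" "word_eval G f w \<in> carrier G"
    using Cons.prems assms(1,3) by (auto intro: letter_eval_closed word_eval_closed)
  then show ?case using Cons by (simp add: m_assoc)
qed

lemma word_eval_free_cong:
  assumes "pres_equiv X {} v w" and f: "\<And>x. x \<in> X \<Longrightarrow> f x \<in> carrier G"
  shows "word_eval G f v = word_eval G f w"
  using assms(1)
proof (induction rule: pres_equiv.induct)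
  case (cancel u v x b)
  have "word_eval G f ([(x, b), (x, \<not> b)] @ v) = word_eval G f v"
    using f[OF cancel(3)] word_eval_closed[OF f cancel(2)] by (cases b) (simp_all add: letter_eval_def m_assoc[symmetric])
  then show ?case
    using word_eval_append[of X f, OF f cancel(1)] cancel(2,3) by (simp del: append.simps)
qed auto

text \<open>Under these hypotheses evaluation of words inverts \<open>\<phi>\<close>:
  \<open>retract\<close> makes \<open>\<phi>\<close> injective, and \<open>gen\<close> together with
  the homomorphism property makes it recover every word from its value. For point stabilizers,
  \<open>\<phi>\<close> will be the Reidemeister-Schreier rewriting.\<close>

lemma is_free_group_subgroupI:
  assumes H: "subgroup H G" and S: "S \<subseteq> H"
    and hom: "\<phi> \<in> hom (G\<lparr>carrier := H\<rparr>) (presented_group S {})"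
    and gen: "\<And>s. s \<in> S \<Longrightarrow> \<phi> s = wclass S {} [(s, True)]"
    and retract: "\<And>h. h \<in> H \<Longrightarrow> \<exists>w\<in>gwords S. \<phi> h = wclass S {} w \<and> word_eval G (\<lambda>s. s) w = h"
  shows "is_free_group (G\<lparr>carrier := H\<rparr>)"
proof -
  define F where "F = presented_group S {}"
  interpret F: group F unfolding F_def by (rule group_presented_group)
  interpret K: group "G\<lparr>carrier := H\<rparr>" using H by (rule subgroup_imp_group)
  interpret \<phi>: group_hom "G\<lparr>carrier := H\<rparr>" F \<phi>
    using hom by unfold_locales (simp add: F_def)
  have SG: "s \<in> S \<Longrightarrow> s \<in> carrier G" for s using S subgroup.subset[OF H] by blast
  have SH: "s \<in> S \<Longrightarrow> s \<in> H" for s using S by blast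
  have inj: "inj_on \<phi> H"
  proof (rule inj_onI)
    fix x y assume xy: "x \<in> H" "y \<in> H" "\<phi> x = \<phi> y"
    obtain v w where vw: "v \<in> gwords S" "\<phi> x = wclass S {} v" "word_eval G (\<lambda>s. s) v = x"
      "w \<in> gwords S" "\<phi> y = wclass S {} w" "word_eval G (\<lambda>s. s) w = y"
      using retract xy(1,2) by metis
    then have "pres_equiv S {} v w" using xy(3) by (metis wclass_eq_iff)
    then have "word_eval G (\<lambda>s. s) v = word_eval G (\<lambda>s. s) w" using SG by (rule word_eval_free_cong)
    then show "x = y" using vw by simp
  qed
  have "\<phi> (word_eval G (\<lambda>s. s) w) = wclass S {} w" if "w \<in> gwords S" for w
    using that
  proof (induction w)
    case Nil
    then show ?case using \<phi>.hom_one by (simp add: F_def one_presented_group)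
  next
    case (Cons l w)
    have l: "fst l \<in> S" "letter_eval G (\<lambda>s. s) l \<in> H"
      using Cons.prems letter_eval_in_subgroup[OF H SH, of S] by auto
    have "\<phi> (letter_eval G (\<lambda>s. s) l) = wclass S {} [l]"
    proof (cases "snd l")
      case True
      then have e: "[l] = [(fst l, True)]" by (simp add: prod_eq_iff)
      show ?thesis using True gen[OF l(1)] by (subst e) (simp add: letter_eval_def)
    next
      case False
      have "\<phi> (inv (fst l)) = \<phi> (inv\<^bsub>G\<lparr>carrier := H\<rparr>\<^esub> (fst l))"
        by (simp only: m_inv_consistent[OF H SH[OF l(1)]])
      also have "\<dots> = inv\<^bsub>F\<^esub> (\<phi> (fst l))" using SH[OF l(1)] by (intro \<phi>.hom_inv) simp
      also have "\<dots> = wclass S {} (word_inv [(fst l, True)])"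
        unfolding gen[OF l(1)] F_def by (rule inv_wclass) (simp add: l(1))
      also have "word_inv [(fst l, True)] = [l]" using False by (simp add: prod_eq_iff)
      finally show ?thesis using False by (simp add: letter_eval_def)
    qed
    moreover have "\<phi> (letter_eval G (\<lambda>s. s) l \<otimes> word_eval G (\<lambda>s. s) w) =
       \<phi> (letter_eval G (\<lambda>s. s) l) \<otimes>\<^bsub>F\<^esub> \<phi> (word_eval G (\<lambda>s. s) w)"
      using \<phi>.hom_mult[of "letter_eval G (\<lambda>s. s) l" "word_eval G (\<lambda>s. s) w"] l(2)
        word_eval_in_subgroup[OF H SH, of S "\<lambda>s. s"] Cons.prems by simp
    ultimately show ?case using Cons l(1) by (simp add: F_def wclass_mult)
  qed
  note retract' = this
  have "\<phi> ` H = carrier F"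
  proof
    show "\<phi> ` H \<subseteq> carrier F" using \<phi>.hom_closed by auto
    show "carrier F \<subseteq> \<phi> ` H"
    proof
      fix y assume "y \<in> carrier F"
      then obtain w where w: "w \<in> gwords S" "y = wclass S {} w"
        by (auto simp: F_def carrier_presented_group)
      have "word_eval G (\<lambda>s. s) w \<in> H" by (rule word_eval_in_subgroup[OF H SH w(1)])
      then show "y \<in> \<phi> ` H" using retract'[OF w(1)] w(2) by (metis imageI)
    qed
  qed
  with inj have "\<phi> \<in> iso (G\<lparr>carrier := H\<rparr>) F"
    using hom by (simp add: iso_def bij_betw_def F_def)
  then have "G\<lparr>carrier := H\<rparr> \<cong> F" by (auto simp: is_iso_def)
  then have "F \<cong> G\<lparr>carrier := H\<rparr>" by (rule K.iso_sym)
  then show ?thesis unfolding is_free_group_def free_group_on_def F_def by blast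
qed

end

section \<open>Semiregular actions\<close>

abbreviation finv :: "('a \<Rightarrow> 'b) \<Rightarrow> 'b \<Rightarrow> 'a" where
  "finv \<equiv> inv_into UNIV"

text \<open>For \<open>d > 0\<close>: the cycle of \<open>f\<close> through \<open>x\<close> has
  exactly \<open>d\<close> elements. The condition is kept pointwise so that it can be restricted to
  orbits and transported through gluings.\<close>

definition semiregular_at :: "('a \<Rightarrow> 'a) \<Rightarrow> nat \<Rightarrow> 'a \<Rightarrow> bool" where
  "semiregular_at f d x \<longleftrightarrow> (f ^^ d) x = x \<and> (\<forall>i. 0 < i \<and> i < d \<longrightarrow> (f ^^ i) x \<noteq> x)"

lemma semiregular_at_mod:
  assumes "semiregular_at f d x"
  shows "(f ^^ i) x = (f ^^ (i mod d)) x"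
  using assms by (simp add: semiregular_at_def funpow_mod_eq)

lemma semiregular_at_fixed_iff:
  assumes "semiregular_at f d x" "d > 0"
  shows "(f ^^ i) x = x \<longleftrightarrow> d dvd i"
proof
  assume "(f ^^ i) x = x"
  then have "(f ^^ (i mod d)) x = x" using semiregular_at_mod[OF assms(1)] by simp
  then show "d dvd i" using assms unfolding semiregular_at_def by (metis mod_less_divisor dvd_eq_mod_eq_0 gr0I)
next
  assume "d dvd i"
  then show "(f ^^ i) x = x" using semiregular_at_mod[OF assms(1), of i] by simp
qed

lemma semiregular_at_eq_iff:
  assumes "semiregular_at f d x" "d > 0" "inj f"
  shows "(f ^^ i) x = (f ^^ j) x \<longleftrightarrow> [i = j] (mod d)"
proof
  have le: "[i = j] (mod d)" if "i \<le> j" "(f ^^ i) x = (f ^^ j) x" for i j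
  proof -
    have "(f ^^ i) ((f ^^ (j - i)) x) = (f ^^ i) x"
      using that by (metis funpow_add comp_apply le_add_diff_inverse)
    then have "(f ^^ (j - i)) x = x" using assms(3) inj_fn by (metis injD)
    then have "d dvd j - i" using semiregular_at_fixed_iff[OF assms(1,2)] by simp
    then show ?thesis using that(1) by (metis cong_altdef_nat cong_sym)
  qed
  assume "(f ^^ i) x = (f ^^ j) x"
  then show "[i = j] (mod d)" using le[of i j] le[of j i, THEN cong_sym] by (metis nat_le_linear)
next
  assume "[i = j] (mod d)"
  then show "(f ^^ i) x = (f ^^ j) x"
    using semiregular_at_mod[OF assms(1)] unfolding cong_def by metis
qed

section \<open>The group and its semiregular actions\<close>

definition Gamma_rels :: "nat \<Rightarrow> (Gamma_gen gword \<times> Gamma_gen gword) set" where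
  "Gamma_rels m = {(gen_pow GenX (2 * m), []), (gen_pow GenY (4 * m), []), (gen_pow GenX 2, gen_pow GenY 4)}"

abbreviation Gamma_words :: "Gamma_gen gword set" where
  "Gamma_words \<equiv> gwords {GenX, GenY}"

abbreviation Gamma_equiv :: "nat \<Rightarrow> Gamma_gen gword \<Rightarrow> Gamma_gen gword \<Rightarrow> bool" where
  "Gamma_equiv m \<equiv> pres_equiv {GenX, GenY} (Gamma_rels m)"

abbreviation Gamma_class :: "nat \<Rightarrow> Gamma_gen gword \<Rightarrow> Gamma_gen gword set" where
  "Gamma_class m \<equiv> wclass {GenX, GenY} (Gamma_rels m)"

lemma Gamma_gen_all [simp]: "g \<in> {GenX, GenY}"
  by (cases g) auto

lemma Gamma_words_all [simp]: "w \<in> Gamma_words"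
  using Gamma_gen_all by (induction w) (simp_all del: insert_iff)

lemma Gamma4_eq: "Gamma4 m = presented_group {GenX, GenY} (Gamma_rels m)"
  by (simp add: Gamma4_def Gamma_rels_def)

lemma group_Gamma4: "group (Gamma4 m)"
  unfolding Gamma4_eq by (rule group_presented_group)

lemma carrier_Gamma4: "carrier (Gamma4 m) = range (Gamma_class m)"
  by (auto simp: Gamma4_eq carrier_presented_group)

lemma Gamma_class_in_carrier [simp]: "Gamma_class m w \<in> carrier (Gamma4 m)"
  by (simp add: carrier_Gamma4)

lemma Gamma_class_mult: "Gamma_class m v \<otimes>\<^bsub>Gamma4 m\<^esub> Gamma_class m w = Gamma_class m (v @ w)"
  by (simp add: Gamma4_eq wclass_mult)

lemma Gamma_class_inv: "inv\<^bsub>Gamma4 m\<^esub> (Gamma_class m w) = Gamma_class m (word_inv w)"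
  by (simp add: Gamma4_eq inv_wclass)

lemma Gamma_class_one: "\<one>\<^bsub>Gamma4 m\<^esub> = Gamma_class m []"
  by (simp add: Gamma4_eq one_presented_group)

lemma Gamma_class_eq_iff: "Gamma_class m v = Gamma_class m w \<longleftrightarrow> Gamma_equiv m v w"
  by (simp add: wclass_eq_iff)

lemma Gamma_equiv_refl [simp]: "Gamma_equiv m w w"
  by (rule pres_equiv.refl) simp

lemma Gamma_equiv_rels:
  "Gamma_equiv m (gen_pow GenX (2 * m)) []"
  "Gamma_equiv m (gen_pow GenY (4 * m)) []"
  "Gamma_equiv m (gen_pow GenX 2) (gen_pow GenY 4)"
  by (auto intro!: pres_equiv_relation_self simp del: insert_iff) (simp_all add: Gamma_rels_def)

lemma Gamma_equiv_GenY_mod: "Gamma_equiv m (gen_pow GenY i) (gen_pow GenY (i mod (4 * m)))"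
proof -
  have "Gamma_equiv m (gen_pow GenY (4 * m * q)) []" for q
  proof (induction q)
    case (Suc q)
    have "Gamma_equiv m (gen_pow GenY (4 * m) @ gen_pow GenY (4 * m * q)) ([] @ [])"
      by (intro pres_equiv_append Suc Gamma_equiv_rels)
    then show ?case by (simp add: gen_pow_add[symmetric])
  qed simp
  from pres_equiv_append[OF this pres_equiv.refl[of "gen_pow GenY (i mod (4 * m))"], of "i div (4 * m)"]
  show ?thesis by (simp add: gen_pow_add[symmetric])
qed

lemma Gamma_equiv_GenY_cong:
  assumes "[i = j] (mod (4 * m))"
  shows "Gamma_equiv m (gen_pow GenY i) (gen_pow GenY j)"
  using Gamma_equiv_GenY_mod[of m i] Gamma_equiv_GenY_mod[of m j, THEN pres_equiv.sym] assms
  unfolding cong_def by (metis pres_equiv.trans)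

definition letter_act :: "('a \<Rightarrow> 'a) \<Rightarrow> ('a \<Rightarrow> 'a) \<Rightarrow> Gamma_gen \<times> bool \<Rightarrow> 'a \<Rightarrow> 'a" where
  "letter_act \<sigma> \<tau> l = (let f = (case fst l of GenX \<Rightarrow> \<sigma> | GenY \<Rightarrow> \<tau>) in if snd l then f else finv f)"

text \<open>The first letter acts first. This right action matches the right cosets that define the
  index.\<close>

primrec word_act :: "('a \<Rightarrow> 'a) \<Rightarrow> ('a \<Rightarrow> 'a) \<Rightarrow> Gamma_gen gword \<Rightarrow> 'a \<Rightarrow> 'a" where
  "word_act \<sigma> \<tau> [] x = x"
| "word_act \<sigma> \<tau> (l # w) x = word_act \<sigma> \<tau> w (letter_act \<sigma> \<tau> l x)"

lemma letter_act_simps [simp]: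
  "letter_act \<sigma> \<tau> (GenX, True) = \<sigma>" "letter_act \<sigma> \<tau> (GenY, True) = \<tau>"
  "letter_act \<sigma> \<tau> (GenX, False) = finv \<sigma>" "letter_act \<sigma> \<tau> (GenY, False) = finv \<tau>"
  by (simp_all add: letter_act_def)

lemma word_act_append [simp]: "word_act \<sigma> \<tau> (v @ w) x = word_act \<sigma> \<tau> w (word_act \<sigma> \<tau> v x)"
  by (induction v arbitrary: x) auto

lemma word_act_gen_pow [simp]:
  "word_act \<sigma> \<tau> (gen_pow GenX k) x = (\<sigma> ^^ k) x"
  "word_act \<sigma> \<tau> (gen_pow GenY k) x = (\<tau> ^^ k) x"
  by (induction k arbitrary: x) (simp_all add: gen_pow_Suc funpow_swap1)

text \<open>Semiregularity is imposed on the two generators only; this already makes the stabilizer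
  of every point of \<open>X\<close> free.\<close>

definition free_action :: "nat \<Rightarrow> ('a \<Rightarrow> 'a) \<Rightarrow> ('a \<Rightarrow> 'a) \<Rightarrow> 'a set \<Rightarrow> bool" where
  "free_action m \<sigma> \<tau> X \<longleftrightarrow> \<sigma> permutes X \<and> \<tau> permutes X \<and>
     (\<forall>x\<in>X. (\<sigma> ^^ 2) x = (\<tau> ^^ 4) x \<and> semiregular_at \<sigma> (2 * m) x \<and> semiregular_at \<tau> (4 * m) x)"

definition stabilizer :: "nat \<Rightarrow> ('a \<Rightarrow> 'a) \<Rightarrow> ('a \<Rightarrow> 'a) \<Rightarrow> 'a \<Rightarrow> Gamma_gen gword set set" where
  "stabilizer m \<sigma> \<tau> x = {Gamma_class m w | w. word_act \<sigma> \<tau> w x = x}"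

locale gamma_action =
  fixes m :: nat and \<sigma> \<tau> :: "'a \<Rightarrow> 'a" and X :: "'a set"
  assumes m_pos: "m > 0" and action: "free_action m \<sigma> \<tau> X"
begin

abbreviation "act \<equiv> word_act \<sigma> \<tau>"

lemma perm: "\<sigma> permutes X" "\<tau> permutes X"
  using action by (auto simp: free_action_def)

lemma bij: "bij \<sigma>" "bij \<tau>"
  using perm permutes_bij by auto

lemma semireg: "x \<in> X \<Longrightarrow> semiregular_at \<sigma> (2 * m) x" "x \<in> X \<Longrightarrow> semiregular_at \<tau> (4 * m) x"
  using action by (auto simp: free_action_def)

lemma funpow_outside: "f permutes X \<Longrightarrow> x \<notin> X \<Longrightarrow> (f ^^ k) x = x"
  by (induction k) (auto simp: permutes_not_in)

text \<open>Outside \<open>X\<close> both maps are the identity, so the relations hold on the whole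
  type and words act without side conditions.\<close>

lemma period: "(\<sigma> ^^ (2 * m)) x = x" "(\<tau> ^^ (4 * m)) x = x"
  using semireg[of x] perm[THEN funpow_outside, of x] unfolding semiregular_at_def by (cases "x \<in> X"; simp)+

lemma sq_eq_fourth: "(\<sigma> ^^ 2) x = (\<tau> ^^ 4) x"
  using action funpow_outside[OF perm(1), of x 2] funpow_outside[OF perm(2), of x 4]
  unfolding free_action_def by (cases "x \<in> X") auto

text \<open>Inverse letters act as positive powers of the generators, so reachability and closure of
  orbits can be treated with positive powers alone.\<close>

lemma inv_eq: "finv \<sigma> x = (\<sigma> ^^ (2 * m - 1)) x" "finv \<tau> x = (\<tau> ^^ (4 * m - 1)) x"
proof -
  have "\<sigma> ((\<sigma> ^^ (2 * m - 1)) x) = (\<sigma> ^^ Suc (2 * m - 1)) x" by simp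
  also have "\<dots> = x" using m_pos period(1) by (metis Suc_diff_1 nat_0_less_mult_iff zero_less_numeral)
  finally show "finv \<sigma> x = (\<sigma> ^^ (2 * m - 1)) x" using bij(1) by (metis bij_inv_eq_iff)
next
  have "\<tau> ((\<tau> ^^ (4 * m - 1)) x) = (\<tau> ^^ Suc (4 * m - 1)) x" by simp
  also have "\<dots> = x" using m_pos period(2) by (metis Suc_diff_1 nat_0_less_mult_iff zero_less_numeral)
  finally show "finv \<tau> x = (\<tau> ^^ (4 * m - 1)) x" using bij(2) by (metis bij_inv_eq_iff)
qed

lemma inv_apply [simp]: "finv \<sigma> (\<sigma> x) = x" "\<sigma> (finv \<sigma> x) = x" "finv \<tau> (\<tau> x) = x" "\<tau> (finv \<tau> x) = x"
  using bij by (simp_all add: bij_is_inj bij_is_surj surj_f_inv_f)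

lemma letter_act_cancel: "letter_act \<sigma> \<tau> (g, \<not> b) (letter_act \<sigma> \<tau> (g, b) x) = x"
  by (cases g; cases b) simp_all

lemma act_cong:
  assumes "Gamma_equiv m v w"
  shows "act v x = act w x"
  using assms
proof (induction arbitrary: x rule: pres_equiv.induct)
  case (cancel u v g b)
  then show ?case by (simp add: letter_act_cancel)
next
  case (relation u v r s)
  have "act r y = act s y" for y
    using relation(3) period sq_eq_fourth by (auto simp: Gamma_rels_def)
  then show ?case by simp
qed auto

lemma act_inv [simp]: "act (word_inv w) (act w x) = x"
  using act_cong[OF pres_equiv_word_inv_right[of w], of x] by simp

lemma letter_act_in: "x \<in> X \<Longrightarrow> letter_act \<sigma> \<tau> l x \<in> X"
  using perm perm[THEN permutes_inv] permutes_in_image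
  by (cases "(\<sigma>, \<tau>, l)" rule: prod_cases4; cases "fst l"; cases "snd l") (fastforce simp: letter_act_def)+

lemma act_in: "x \<in> X \<Longrightarrow> act w x \<in> X"
  by (induction w arbitrary: x) (auto simp: letter_act_in)

lemma Gamma_class_in_stabilizer_iff: "Gamma_class m w \<in> stabilizer m \<sigma> \<tau> x \<longleftrightarrow> act w x = x"
  unfolding stabilizer_def Gamma_class_eq_iff mem_Collect_eq using act_cong Gamma_equiv_refl by metis

lemma subgroup_stabilizer: "subgroup (stabilizer m \<sigma> \<tau> x) (Gamma4 m)"
proof (rule group.subgroupI[OF group_Gamma4])
  show "stabilizer m \<sigma> \<tau> x \<subseteq> carrier (Gamma4 m)" by (auto simp: stabilizer_def)
  have "Gamma_class m [] \<in> stabilizer m \<sigma> \<tau> x" by (simp add: Gamma_class_in_stabilizer_iff)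
  then show "stabilizer m \<sigma> \<tau> x \<noteq> {}" by blast
next
  fix a assume "a \<in> stabilizer m \<sigma> \<tau> x"
  then obtain w where w: "a = Gamma_class m w" "act w x = x" by (auto simp: stabilizer_def)
  have "act (word_inv w) x = x" using act_inv[of w x] w(2) by simp
  then show "inv\<^bsub>Gamma4 m\<^esub> a \<in> stabilizer m \<sigma> \<tau> x"
    using w by (simp add: Gamma_class_inv Gamma_class_in_stabilizer_iff)
next
  fix a b assume "a \<in> stabilizer m \<sigma> \<tau> x" "b \<in> stabilizer m \<sigma> \<tau> x"
  then obtain v w where "a = Gamma_class m v" "act v x = x" "b = Gamma_class m w" "act w x = x"
    by (auto simp: stabilizer_def)
  then show "a \<otimes>\<^bsub>Gamma4 m\<^esub> b \<in> stabilizer m \<sigma> \<tau> x"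
    by (simp add: Gamma_class_mult Gamma_class_in_stabilizer_iff)
qed

lemma act_eq_iff_coset:
  "act v x = act w x \<longleftrightarrow>
    stabilizer m \<sigma> \<tau> x #>\<^bsub>Gamma4 m\<^esub> Gamma_class m v = stabilizer m \<sigma> \<tau> x #>\<^bsub>Gamma4 m\<^esub> Gamma_class m w"
proof -
  interpret group "Gamma4 m" by (rule group_Gamma4)
  have "act v x = act w x \<longleftrightarrow> act (v @ word_inv w) x = x"
    using act_inv[of w] act_inv[of "word_inv w"] by (metis word_act_append word_inv_simps(4))
  also have "\<dots> \<longleftrightarrow> Gamma_class m v \<otimes>\<^bsub>Gamma4 m\<^esub> inv\<^bsub>Gamma4 m\<^esub> Gamma_class m w \<in> stabilizer m \<sigma> \<tau> x"
    by (simp add: Gamma_class_inv Gamma_class_mult Gamma_class_in_stabilizer_iff)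
  also have "\<dots> \<longleftrightarrow> stabilizer m \<sigma> \<tau> x #>\<^bsub>Gamma4 m\<^esub> Gamma_class m v = stabilizer m \<sigma> \<tau> x #>\<^bsub>Gamma4 m\<^esub> Gamma_class m w"
    using subgroup_stabilizer[of x]
    by (metis Gamma_class_in_carrier coset_join1 coset_join2 coset_mult_inv1 coset_mult_inv2 subgroup.subset subgroup_imp_group inv_closed m_closed)
  finally show ?thesis .
qed

lemma card_rcosets_stabilizer:
  "card (rcosets\<^bsub>Gamma4 m\<^esub> (stabilizer m \<sigma> \<tau> x)) = card (range (\<lambda>w. act w x))"
proof -
  define c where "c w = stabilizer m \<sigma> \<tau> x #>\<^bsub>Gamma4 m\<^esub> Gamma_class m w" for w
  have "rcosets\<^bsub>Gamma4 m\<^esub> (stabilizer m \<sigma> \<tau> x) = range c"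
    by (auto simp: RCOSETS_def carrier_Gamma4 c_def)
  moreover have "bij_betw (\<lambda>C. act (SOME w. C = c w) x) (range c) (range (\<lambda>w. act w x))"
  proof (rule bij_betwI')
    fix C D assume C: "C \<in> range c" and D: "D \<in> range c"
    have 1: "C = c (SOME w. C = c w)" "D = c (SOME w. D = c w)"
      using C D by (metis (mono_tags, lifting) image_iff someI_ex)+
    then show "act (SOME w. C = c w) x = act (SOME w. D = c w) x \<longleftrightarrow> C = D"
      unfolding act_eq_iff_coset c_def[symmetric] by metis
  next
    fix y assume "y \<in> range (\<lambda>w. act w x)"
    then obtain w where w: "y = act w x" by blast
    have "c w = c (SOME w'. c w = c w')" by (rule someI[of _ w]) simp
    then show "\<exists>C\<in>range c. y = act (SOME w. C = c w) x"
      unfolding w act_eq_iff_coset c_def[symmetric] by blast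
  qed auto
  ultimately show ?thesis using bij_betw_same_card by metis
qed

end

section \<open>Point stabilizers of semiregular actions are free\<close>

locale pointed_gamma_action = gamma_action +
  fixes x0 :: 'a
  assumes x0: "x0 \<in> X"
begin

definition orb :: "'a set" where
  "orb = range (\<lambda>w. act w x0)"

lemma x0_in_orb: "x0 \<in> orb"
  unfolding orb_def by (rule range_eqI[of _ _ "[]"]) simp

lemma orb_subset: "x \<in> orb \<Longrightarrow> x \<in> X"
  unfolding orb_def using act_in[OF x0] by auto

lemma act_in_orb: "x \<in> orb \<Longrightarrow> act w x \<in> orb"
proof -
  assume "x \<in> orb"
  then obtain v where "x = act v x0" by (auto simp: orb_def)
  then have "act w x = act (v @ w) x0" by simp
  then show ?thesis unfolding orb_def by blast
qed

lemma funpow_in_orb: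
  assumes "x \<in> orb" shows "(\<sigma> ^^ k) x \<in> orb" "(\<tau> ^^ k) x \<in> orb"
  using act_in_orb[OF assms, of "gen_pow GenX k"] act_in_orb[OF assms, of "gen_pow GenY k"] by simp_all

lemma step_in_orb:
  assumes "x \<in> orb" shows "\<sigma> x \<in> orb" "\<tau> x \<in> orb" "finv \<sigma> x \<in> orb"
  using funpow_in_orb[OF assms, of 1] funpow_in_orb(1)[OF assms, of "2 * m - 1"] by (simp_all add: inv_eq)

section \<open>Levels of \<tau>-orbits and the spanning tree\<close>

text \<open>The vertices of the graph are the \<tau>-orbits, and an edge joins the orbit of
  \<open>x\<close> to that of \<open>\<sigma> x\<close>. As \<open>\<sigma>^2 = \<tau>^4\<close>, a
  second application of \<sigma> leads back, so the graph is undirected and \<open>n\<close> is the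
  length of a walk from the orbit of \<open>x0\<close>.\<close>

inductive reach :: "nat \<Rightarrow> 'a \<Rightarrow> bool" where
  reach_0: "reach 0 ((\<tau> ^^ i) x0)"
| reach_Suc: "reach n x \<Longrightarrow> reach (Suc n) ((\<tau> ^^ i) (\<sigma> x))"

lemma reach_tau: "reach n x \<Longrightarrow> reach n (\<tau> x)"
proof (induction rule: reach.cases)
  case (reach_0 i)
  then show ?case using reach.reach_0[of "Suc i"] by simp
next
  case (reach_Suc n x i)
  then show ?case using reach.reach_Suc[of n x "Suc i"] by simp
qed

lemma reach_tau_pow: "reach n x \<Longrightarrow> reach n ((\<tau> ^^ k) x)"
  by (induction k) (auto intro: reach_tau)

lemma reach_orb: "x \<in> orb \<Longrightarrow> \<exists>n. reach n x"
proof -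
  have s: "\<exists>n. reach n ((\<sigma> ^^ k) y)" if "reach n y" for k n y
    using that by (induction k) (auto dest: reach_Suc[of _ _ 0, simplified])
  have "\<exists>n. reach n (act w x0)" for w
  proof (induction w rule: rev_induct)
    case Nil
    then show ?case using reach_0[of 0] by auto
  next
    case (snoc l w)
    then obtain n where n: "reach n (act w x0)" by blast
    have "\<exists>k. letter_act \<sigma> \<tau> l x = (\<sigma> ^^ k) x \<or> letter_act \<sigma> \<tau> l x = (\<tau> ^^ k) x" for x
    proof (cases l)
      case (Pair g b)
      then show ?thesis
        by (cases g; cases b) (auto simp: inv_eq intro: exI[of _ "Suc 0"])
    qed
    then show ?case using s[OF n] reach_tau_pow[OF n] by (metis word_act.simps word_act_append)
  qed
  then show "x \<in> orb \<Longrightarrow> \<exists>n. reach n x" by (auto simp: orb_def)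
qed

definition lev :: "'a \<Rightarrow> nat" where
  "lev x = (LEAST n. reach n x)"

lemma lev_reach: "x \<in> orb \<Longrightarrow> reach (lev x) x"
  unfolding lev_def using reach_orb by (metis LeastI)

lemma lev_le: "reach n x \<Longrightarrow> lev x \<le> n"
  unfolding lev_def by (rule Least_le)

definition torb :: "'a \<Rightarrow> 'a set" where
  "torb x = range (\<lambda>i. (\<tau> ^^ i) x)"

definition sorb :: "'a \<Rightarrow> 'a set" where
  "sorb x = range (\<lambda>i. (\<sigma> ^^ i) x)"

lemma self_in_torb: "x \<in> torb x" and self_in_sorb: "x \<in> sorb x"
  unfolding torb_def sorb_def by (auto intro: range_eqI[of _ _ 0])

lemma funpow_inverse:
  "(\<tau> ^^ (4 * m * i - i)) ((\<tau> ^^ i) x) = x" "(\<sigma> ^^ (2 * m * i - i)) ((\<sigma> ^^ i) x) = x"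
proof -
  have 1: "i \<le> 4 * m * i" "i \<le> 2 * m * i" using m_pos by auto
  have "(\<tau> ^^ (4 * m * i - i)) ((\<tau> ^^ i) x) = (\<tau> ^^ (4 * m * i)) x"
    using 1(1) by (metis comp_apply funpow_add le_add_diff_inverse2)
  also have "\<dots> = x" using funpow_mod_eq[OF period(2), of "4 * m * i" x] by simp
  finally show "(\<tau> ^^ (4 * m * i - i)) ((\<tau> ^^ i) x) = x" .
  have "(\<sigma> ^^ (2 * m * i - i)) ((\<sigma> ^^ i) x) = (\<sigma> ^^ (2 * m * i)) x"
    using 1(2) by (metis comp_apply funpow_add le_add_diff_inverse2)
  also have "\<dots> = x" using funpow_mod_eq[OF period(1), of "2 * m * i" x] by simp
  finally show "(\<sigma> ^^ (2 * m * i - i)) ((\<sigma> ^^ i) x) = x" .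
qed

lemma torb_sym: "y \<in> torb x \<Longrightarrow> x \<in> torb y"
  and sorb_sym: "y \<in> sorb x \<Longrightarrow> x \<in> sorb y"
proof -
  show "y \<in> torb x \<Longrightarrow> x \<in> torb y"
    unfolding torb_def using funpow_inverse(1)[symmetric] by blast
  show "y \<in> sorb x \<Longrightarrow> x \<in> sorb y"
    unfolding sorb_def using funpow_inverse(2)[symmetric] by blast
qed

lemma torb_trans: "y \<in> torb x \<Longrightarrow> z \<in> torb y \<Longrightarrow> z \<in> torb x"
  and sorb_trans: "y \<in> sorb x \<Longrightarrow> z \<in> sorb y \<Longrightarrow> z \<in> sorb x"
proof -
  have *: "(f ^^ j) ((f ^^ i) x) = (f ^^ (j + i)) x" for f :: "'a \<Rightarrow> 'a" and i j x
    by (simp add: funpow_add)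
  show "y \<in> torb x \<Longrightarrow> z \<in> torb y \<Longrightarrow> z \<in> torb x" "y \<in> sorb x \<Longrightarrow> z \<in> sorb y \<Longrightarrow> z \<in> sorb x"
    unfolding torb_def sorb_def by (auto simp: *)
qed

lemma torb_eqI: "y \<in> torb x \<Longrightarrow> torb y = torb x"
  and sorb_eqI: "y \<in> sorb x \<Longrightarrow> sorb y = sorb x"
  using torb_sym torb_trans sorb_sym sorb_trans by blast+

lemma sigma_in_sorb: "\<sigma> x \<in> sorb x"
  unfolding sorb_def by (auto intro: range_eqI[of _ _ 1])

lemma torb_in_orb: "x \<in> orb \<Longrightarrow> y \<in> torb x \<Longrightarrow> y \<in> orb"
  by (auto simp: torb_def funpow_in_orb)

lemma lev_torb: "y \<in> torb x \<Longrightarrow> lev y = lev x"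
proof -
  have "reach n x \<Longrightarrow> y \<in> torb x \<Longrightarrow> reach n y" for n x y
    by (auto simp: torb_def reach_tau_pow)
  then have "reach n x \<longleftrightarrow> reach n y" if "y \<in> torb x" for n x y using that torb_sym by blast
  then show "y \<in> torb x \<Longrightarrow> lev y = lev x" unfolding lev_def by presburger
qed

text \<open>Every \<open>\<tau>\<close>-orbit other than that of \<open>x0\<close> is entered, through its point \<open>rep\<close>, from a
  \<open>\<tau>\<close>-orbit of smaller level. These entries form the spanning tree.\<close>

definition rep :: "'a \<Rightarrow> 'a" where
  "rep x = (if x0 \<in> torb x then x0 else SOME z. z \<in> torb x \<and> lev (finv \<sigma> z) < lev x)"

lemma rep_cong: "y \<in> torb x \<Longrightarrow> rep y = rep x"
  unfolding rep_def by (simp add: torb_eqI lev_torb)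

lemma entry_exists:
  assumes "x \<in> orb" "x0 \<notin> torb x"
  shows "\<exists>z. z \<in> torb x \<and> lev (finv \<sigma> z) < lev x"
  using lev_reach[OF assms(1)]
proof (cases rule: reach.cases)
  case (reach_0 i)
  then have "x \<in> torb x0" by (auto simp: torb_def)
  then have "x0 \<in> torb x" by (rule torb_sym)
  then show ?thesis using assms(2) by simp
next
  case (reach_Suc n y i)
  have "x \<in> torb (\<sigma> y)" by (auto simp: torb_def reach_Suc)
  then have "\<sigma> y \<in> torb x" by (rule torb_sym)
  moreover have "lev (finv \<sigma> (\<sigma> y)) \<le> n" using lev_le[OF reach_Suc(3)] by simp
  ultimately show ?thesis using reach_Suc(1) by (intro exI[of _ "\<sigma> y"]) simp
qed

lemma rep_in_torb: "x \<in> orb \<Longrightarrow> rep x \<in> torb x"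
  and rep_lev: "x \<in> orb \<Longrightarrow> x0 \<notin> torb x \<Longrightarrow> lev (finv \<sigma> (rep x)) < lev x"
  unfolding rep_def using someI_ex[OF entry_exists, of x] by auto

lemma rep_in_orb: "x \<in> orb \<Longrightarrow> rep x \<in> orb"
  using rep_in_torb torb_in_orb by blast

definition idx :: "'a \<Rightarrow> nat" where
  "idx x = (SOME i. (\<tau> ^^ i) (rep x) = x)"

lemma idx: "x \<in> orb \<Longrightarrow> (\<tau> ^^ idx x) (rep x) = x"
proof -
  assume "x \<in> orb"
  then have "x \<in> torb (rep x)" by (intro torb_sym[OF rep_in_torb])
  then obtain i where "x = (\<tau> ^^ i) (rep x)" unfolding torb_def by blast
  then show ?thesis unfolding idx_def using someI[of "\<lambda>i. (\<tau> ^^ i) (rep x) = x" i] by metis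
qed

text \<open>The tree path from \<open>x0\<close> to \<open>x\<close>, written as a word. Each step
  to the parent lowers \<open>lev\<close>, so fuel of at least \<open>lev x\<close> leaves the
  result unchanged.\<close>

primrec trans_word_fuel :: "nat \<Rightarrow> 'a \<Rightarrow> Gamma_gen gword" where
  "trans_word_fuel 0 x = gen_pow GenY (idx x)"
| "trans_word_fuel (Suc n) x = (if x0 \<in> torb x then gen_pow GenY (idx x)
     else trans_word_fuel n (finv \<sigma> (rep x)) @ [(GenX, True)] @ gen_pow GenY (idx x))"

lemma lev_0: "x \<in> orb \<Longrightarrow> lev x = 0 \<Longrightarrow> x0 \<in> torb x"
  using entry_exists by fastforce

lemma trans_word_fuel_stable:
  "x \<in> orb \<Longrightarrow> lev x \<le> n \<Longrightarrow> lev x \<le> k \<Longrightarrow> trans_word_fuel n x = trans_word_fuel k x"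
proof (induction n arbitrary: k x)
  case 0
  then show ?case using lev_0 by (cases k) auto
next
  case (Suc n)
  show ?case
  proof (cases "x0 \<in> torb x")
    case True
    then show ?thesis by (cases k) auto
  next
    case False
    then have k: "k = Suc (k - 1)" using lev_0[of x] Suc.prems by (cases k) auto
    have lt: "lev (finv \<sigma> (rep x)) < lev x" using rep_lev Suc.prems(1) False by blast
    have "trans_word_fuel n (finv \<sigma> (rep x)) = trans_word_fuel (k - 1) (finv \<sigma> (rep x))"
      using Suc.prems lt by (intro Suc.IH step_in_orb rep_in_orb) auto
    then show ?thesis using False by (subst k) simp
  qed
qed

definition trans_word :: "'a \<Rightarrow> Gamma_gen gword" where
  "trans_word x = trans_word_fuel (lev x) x"

definition entry_word :: "'a \<Rightarrow> Gamma_gen gword" where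
  "entry_word x = (if x0 \<in> torb x then [] else trans_word (finv \<sigma> (rep x)) @ [(GenX, True)])"

lemma entry_word_cong: "y \<in> torb x \<Longrightarrow> entry_word y = entry_word x"
  by (simp add: entry_word_def torb_eqI rep_cong)

lemma trans_word_eq:
  assumes "x \<in> orb"
  shows "trans_word x = entry_word x @ gen_pow GenY (idx x)"
proof (cases "x0 \<in> torb x")
  case True
  then show ?thesis by (cases "lev x") (simp_all add: trans_word_def entry_word_def)
next
  case False
  then obtain n where n: "lev x = Suc n" using lev_0[OF assms] by (cases "lev x") auto
  have "trans_word_fuel n (finv \<sigma> (rep x)) = trans_word (finv \<sigma> (rep x))"
    unfolding trans_word_def using rep_lev[OF assms False] n assms
    by (intro trans_word_fuel_stable step_in_orb rep_in_orb) auto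
  then show ?thesis unfolding entry_word_def trans_word_def[of x] n using False by simp
qed

lemma act_trans_word: "x \<in> orb \<Longrightarrow> act (trans_word x) x0 = x"
proof (induction "lev x" arbitrary: x rule: less_induct)
  case less
  have "act (entry_word x) x0 = rep x"
  proof (cases "x0 \<in> torb x")
    case True
    then show ?thesis by (simp add: entry_word_def rep_def)
  next
    case False
    then show ?thesis
      using less.hyps[OF rep_lev[OF less.prems False] step_in_orb(3)[OF rep_in_orb[OF less.prems]]]
      by (simp add: entry_word_def)
  qed
  then show ?case using idx[OF less.prems] by (simp add: trans_word_eq[OF less.prems])
qed

text \<open>The exponent \<open>idx\<close> is an arbitrary choice. Semiregularity of \<tau> fixes
  it modulo \<open>4 * m\<close>, and \<open>y^(4m) = 1\<close> makes the choice harmless in the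
  group.\<close>

lemma trans_word_shift:
  assumes "x \<in> orb" "(\<tau> ^^ i) (rep x) = (\<tau> ^^ k) x"
  shows "Gamma_equiv m (trans_word ((\<tau> ^^ k) x)) (entry_word x @ gen_pow GenY i)"
proof -
  define y where "y = (\<tau> ^^ k) x"
  have y: "y \<in> torb x" "y \<in> orb" using assms(1) by (auto simp: y_def torb_def funpow_in_orb)
  have "(\<tau> ^^ idx y) (rep x) = (\<tau> ^^ i) (rep x)"
    using idx[OF y(2)] rep_cong[OF y(1)] assms(2) by (simp add: y_def)
  then have "[idx y = i] (mod (4 * m))"
    using semiregular_at_eq_iff[OF semireg(2)[OF orb_subset[OF rep_in_orb[OF assms(1)]]]] m_pos bij(2) bij_is_inj by auto
  then show ?thesis
    unfolding y_def[symmetric] trans_word_eq[OF y(2)] entry_word_cong[OF y(1)]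
    by (intro pres_equiv_append Gamma_equiv_refl Gamma_equiv_GenY_cong)
qed

lemma trans_word_tau_pow:
  assumes "x \<in> orb"
  shows "Gamma_equiv m (trans_word ((\<tau> ^^ k) x)) (trans_word x @ gen_pow GenY k)"
proof -
  have "(\<tau> ^^ (idx x + k)) (rep x) = (\<tau> ^^ k) x"
    using idx[OF assms] by (metis add.commute comp_apply funpow_add)
  from trans_word_shift[OF assms this] show ?thesis
    by (simp add: trans_word_eq[OF assms] gen_pow_add)
qed

text \<open>A double \<sigma>-step stays inside the \<tau>-orbit, where the transversal is under
  control; the relation \<open>x^2 = y^4\<close> translates back.\<close>

lemma trans_word_sigma_sigma:
  assumes "x \<in> orb"
  shows "Gamma_equiv m (trans_word (\<sigma> (\<sigma> x))) (trans_word x @ gen_pow GenX 2)"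
proof -
  have "\<sigma> (\<sigma> x) = (\<tau> ^^ 4) x" using sq_eq_fourth[of x] by (simp add: numeral_2_eq_2)
  then have "Gamma_equiv m (trans_word (\<sigma> (\<sigma> x))) (trans_word x @ gen_pow GenY 4)"
    using trans_word_tau_pow[OF assms, of 4] by simp
  also have "Gamma_equiv m (trans_word x @ gen_pow GenY 4) (trans_word x @ gen_pow GenX 2)"
    by (intro pres_equiv_append Gamma_equiv_refl pres_equiv.sym[OF Gamma_equiv_rels(3)])
  finally (pres_equiv.trans) show ?thesis .
qed

lemma trans_word_x0: "Gamma_equiv m (trans_word x0) []"
  using trans_word_shift[OF x0_in_orb, of 0 0] self_in_torb[of x0] by (simp add: rep_def entry_word_def)

text \<open>A whole \<sigma>-orbit is one geometric edge, so belonging to the tree is made a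
  property of the \<sigma>-orbit.\<close>

definition tree :: "'a \<Rightarrow> bool" where
  "tree x \<longleftrightarrow> (\<exists>y\<in>orb. x0 \<notin> torb y \<and> x \<in> sorb (rep y))"

lemma tree_cong: "y \<in> sorb x \<Longrightarrow> tree y \<longleftrightarrow> tree x"
  unfolding tree_def using sorb_trans sorb_sym by blast

lemma tree_sigma [simp]: "tree (\<sigma> x) \<longleftrightarrow> tree x"
  by (rule tree_cong[OF sigma_in_sorb])

definition xword :: "Gamma_gen gword" where
  "xword = [(GenX, True)]"

lemma xword_append: "xword @ xword = gen_pow GenX 2"
  by (simp add: xword_def numeral_2_eq_2 gen_pow_Suc)

lemma act_xword [simp]: "act xword x = \<sigma> x"
  by (simp add: xword_def)

text \<open>At the \<sigma>-preimage \<open>u\<close> of the entry point this holds by construction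
  of the transversal. It moves along the \<sigma>-orbit: \<open>trans_word_sigma_sigma\<close> at
  \<open>v\<close>, combined with the claim at \<open>v\<close>, gives the claim at
  \<open>\<sigma> v\<close>.\<close>

lemma trans_word_tree:
  assumes "x \<in> orb" "tree x"
  shows "Gamma_equiv m (trans_word (\<sigma> x)) (trans_word x @ xword)"
proof -
  obtain y i where y: "y \<in> orb" "x0 \<notin> torb y" "x = (\<sigma> ^^ i) (rep y)"
    using assms(2) by (auto simp: tree_def sorb_def)
  define z where "z = rep y"
  have z: "z \<in> orb" "z \<in> torb y" "rep z = z" using y rep_in_orb rep_in_torb rep_cong by (auto simp: z_def)
  define u where "u = finv \<sigma> z"
  have u: "u \<in> orb" "\<sigma> u = z" using z step_in_orb by (auto simp: u_def)
  have e: "entry_word z = trans_word u @ xword"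
    using y(2) torb_eqI[OF z(2)] by (simp add: entry_word_def z(3) u_def xword_def)
  then have base: "Gamma_equiv m (trans_word (\<sigma> u)) (trans_word u @ xword)"
  proof -
    have "(\<tau> ^^ 0) (rep z) = (\<tau> ^^ 0) z" using z(3) by simp
    from trans_word_shift[OF z(1) this] show ?thesis unfolding u(2) by (simp add: e)
  qed
  have "Gamma_equiv m (trans_word (\<sigma> ((\<sigma> ^^ j) u))) (trans_word ((\<sigma> ^^ j) u) @ xword)" for j
  proof (induction j)
    case 0
    show ?case using base by simp
  next
    case (Suc j)
    define v where "v = (\<sigma> ^^ j) u"
    have v: "v \<in> orb" using u(1) funpow_in_orb by (simp add: v_def)
    have "Gamma_equiv m (trans_word (\<sigma> (\<sigma> v))) (trans_word v @ gen_pow GenX 2)"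
      by (rule trans_word_sigma_sigma[OF v])
    also have "trans_word v @ gen_pow GenX 2 = (trans_word v @ xword) @ xword"
      by (simp add: xword_append)
    also have "Gamma_equiv m ((trans_word v @ xword) @ xword) (trans_word (\<sigma> v) @ xword)"
      using Suc by (intro pres_equiv_append Gamma_equiv_refl) (simp add: v_def pres_equiv.sym)
    finally (pres_equiv.trans) show ?case by (simp add: v_def)
  qed
  from this[of "Suc i"] show ?thesis using y(3) u(2) by (simp add: z_def funpow_swap1)
qed

section \<open>Schreier generators and the basis\<close>

text \<open>The Schreier generator at \<open>x\<close> for the letter \<open>GenX\<close>. Those for
  \<open>GenY\<close> are trivial by \<open>trans_word_tau_pow\<close>.\<close>

definition edge :: "'a \<Rightarrow> Gamma_gen gword set" where
  "edge x = Gamma_class m (trans_word x @ xword @ word_inv (trans_word (\<sigma> x)))"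

lemma Gamma_class_congI: "Gamma_equiv m v w \<Longrightarrow> Gamma_class m v = Gamma_class m w"
  by (simp add: Gamma_class_eq_iff)

lemma edge_eq:
  "edge x = Gamma_class m (trans_word x) \<otimes>\<^bsub>Gamma4 m\<^esub> Gamma_class m xword \<otimes>\<^bsub>Gamma4 m\<^esub> inv\<^bsub>Gamma4 m\<^esub> Gamma_class m (trans_word (\<sigma> x))"
  by (simp add: edge_def Gamma_class_mult Gamma_class_inv)

lemma edge_closed [simp]: "edge x \<in> carrier (Gamma4 m)"
  by (simp add: edge_def)

text \<open>Both sides belong to one geometric edge run through in opposite directions: the
  transversal words of \<open>x\<close> and \<open>\<sigma> (\<sigma> x)\<close> differ by
  \<open>x^2\<close>.\<close>

lemma edge_sigma:
  assumes "x \<in> orb"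
  shows "edge (\<sigma> x) = inv\<^bsub>Gamma4 m\<^esub> (edge x)"
proof -
  interpret group "Gamma4 m" by (rule group_Gamma4)
  define a b c where "a = Gamma_class m (trans_word x)" "b = Gamma_class m (trans_word (\<sigma> x))" "c = Gamma_class m xword"
  have cl: "a \<in> carrier (Gamma4 m)" "b \<in> carrier (Gamma4 m)" "c \<in> carrier (Gamma4 m)" by (simp_all add: a_b_c_def)
  have "Gamma_class m (trans_word (\<sigma> (\<sigma> x))) = a \<otimes>\<^bsub>Gamma4 m\<^esub> (c \<otimes>\<^bsub>Gamma4 m\<^esub> c)"
    using Gamma_class_congI[OF trans_word_sigma_sigma[OF assms]] by (simp add: a_b_c_def Gamma_class_mult xword_append)
  then have "edge (\<sigma> x) = b \<otimes>\<^bsub>Gamma4 m\<^esub> c \<otimes>\<^bsub>Gamma4 m\<^esub> inv\<^bsub>Gamma4 m\<^esub> (a \<otimes>\<^bsub>Gamma4 m\<^esub> (c \<otimes>\<^bsub>Gamma4 m\<^esub> c))"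
    by (simp add: edge_eq a_b_c_def)
  also have "\<dots> = b \<otimes>\<^bsub>Gamma4 m\<^esub> (inv\<^bsub>Gamma4 m\<^esub> c \<otimes>\<^bsub>Gamma4 m\<^esub> inv\<^bsub>Gamma4 m\<^esub> a)"
    using cl m_assoc[of c "inv\<^bsub>Gamma4 m\<^esub> c" "inv\<^bsub>Gamma4 m\<^esub> c \<otimes>\<^bsub>Gamma4 m\<^esub> inv\<^bsub>Gamma4 m\<^esub> a"]
    by (simp add: inv_mult_group m_assoc)
  also have "\<dots> = inv\<^bsub>Gamma4 m\<^esub> (a \<otimes>\<^bsub>Gamma4 m\<^esub> c \<otimes>\<^bsub>Gamma4 m\<^esub> inv\<^bsub>Gamma4 m\<^esub> b)"
    using cl by (simp add: inv_mult_group m_assoc)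
  finally show ?thesis by (simp add: edge_eq a_b_c_def)
qed

lemma edge_sigma_sigma: "x \<in> orb \<Longrightarrow> edge (\<sigma> (\<sigma> x)) = edge x"
  using group.inv_inv[OF group_Gamma4 edge_closed] by (simp add: edge_sigma step_in_orb)

lemma edge_tree:
  assumes "x \<in> orb" "tree x"
  shows "edge x = \<one>\<^bsub>Gamma4 m\<^esub>"
proof -
  interpret group "Gamma4 m" by (rule group_Gamma4)
  show ?thesis
    using Gamma_class_congI[OF trans_word_tree[OF assms]] by (simp add: edge_eq Gamma_class_mult[symmetric])
qed

lemma edge_in_stabilizer: "x \<in> orb \<Longrightarrow> edge x \<in> stabilizer m \<sigma> \<tau> x0"
  using act_inv[of "trans_word (\<sigma> x)" x0]
  by (simp add: edge_def Gamma_class_in_stabilizer_iff act_trans_word step_in_orb)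

text \<open>An orientation of the edges: even distance from a chosen point of the \<sigma>-orbit.
  Parity makes sense because the orbit has the even length \<open>2 * m\<close>.\<close>

definition pos :: "'a \<Rightarrow> bool" where
  "pos x \<longleftrightarrow> (\<exists>j. x = (\<sigma> ^^ (2 * j)) (SOME z. z \<in> sorb x))"

lemma pos_sigma:
  assumes "x \<in> orb"
  shows "pos (\<sigma> x) \<longleftrightarrow> \<not> pos x"
proof -
  define z where "z = (SOME z. z \<in> sorb x)"
  have z: "z \<in> sorb x" unfolding z_def using self_in_sorb by (rule someI)
  have z': "(SOME z. z \<in> sorb (\<sigma> x)) = z" by (simp add: z_def sorb_eqI[OF sigma_in_sorb])
  have zX: "z \<in> X" using z assms orb_subset funpow_in_orb by (auto simp: sorb_def)
  obtain i where i: "x = (\<sigma> ^^ i) z" using sorb_sym[OF z] by (auto simp: sorb_def)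
  have par: "(\<exists>j. (\<sigma> ^^ i) z = (\<sigma> ^^ (2 * j)) z) \<longleftrightarrow> even i" for i
  proof
    assume "\<exists>j. (\<sigma> ^^ i) z = (\<sigma> ^^ (2 * j)) z"
    then obtain j where "[i = 2 * j] (mod (2 * m))"
      using semiregular_at_eq_iff[OF semireg(1)[OF zX]] m_pos bij(1) bij_is_inj by auto
    then show "even i" by (metis cong_dvd_iff cong_dvd_modulus_nat dvd_triv_left)
  qed auto
  have "pos x \<longleftrightarrow> even i" using par[of i] unfolding pos_def z_def[symmetric] i[symmetric] .
  moreover have "pos (\<sigma> x) \<longleftrightarrow> even (Suc i)" using par[of "Suc i"] unfolding pos_def z' by (simp add: i)
  ultimately show ?thesis by simp
qed

definition basis :: "Gamma_gen gword set set" where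
  "basis = edge ` {x \<in> orb. \<not> tree x \<and> pos x}"

definition edge_word :: "'a \<Rightarrow> Gamma_gen gword set gword" where
  "edge_word x = (if tree x then [] else if pos x then [(edge x, True)] else [(edge (\<sigma> x), False)])"

abbreviation "free_equiv \<equiv> pres_equiv basis {}"

lemma edge_word_in_gwords [simp]: "x \<in> orb \<Longrightarrow> edge_word x \<in> gwords basis"
  by (auto simp: edge_word_def basis_def pos_sigma step_in_orb)

lemma edge_word_sigma:
  assumes "x \<in> orb"
  shows "edge_word (\<sigma> x) = word_inv (edge_word x)"
  using assms by (simp add: edge_word_def pos_sigma edge_sigma_sigma)

lemma word_eval_edge_word:
  assumes "x \<in> orb"
  shows "word_eval (Gamma4 m) (\<lambda>s. s) (edge_word x) = edge x"
proof -
  interpret group "Gamma4 m" by (rule group_Gamma4)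
  show ?thesis using assms by (simp add: edge_word_def letter_eval_def edge_tree edge_sigma)
qed

text \<open>The cocycle reads a word along its path and records the edges outside the spanning tree.\<close>

definition letter_cocycle :: "'a \<Rightarrow> Gamma_gen \<times> bool \<Rightarrow> Gamma_gen gword set gword" where
  "letter_cocycle x l = (case fst l of GenX \<Rightarrow> if snd l then edge_word x else word_inv (edge_word (finv \<sigma> x)) | GenY \<Rightarrow> [])"

primrec cocycle :: "Gamma_gen gword \<Rightarrow> 'a \<Rightarrow> Gamma_gen gword set gword" where
  "cocycle [] x = []"
| "cocycle (l # w) x = letter_cocycle x l @ cocycle w (letter_act \<sigma> \<tau> l x)"

lemma cocycle_append: "cocycle (v @ w) x = cocycle v x @ cocycle w (act v x)"
  by (induction v arbitrary: x) auto

lemma letter_act_in_orb: "x \<in> orb \<Longrightarrow> letter_act \<sigma> \<tau> l x \<in> orb"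
  using act_in_orb[of x "[l]"] by simp

lemma cocycle_in_gwords [simp]: "x \<in> orb \<Longrightarrow> cocycle w x \<in> gwords basis"
  by (induction w arbitrary: x)
     (auto simp: letter_cocycle_def letter_act_in_orb step_in_orb split: Gamma_gen.split)

lemma cocycle_GenY_pow [simp]: "cocycle (gen_pow GenY k) x = []"
  by (induction k arbitrary: x) (auto simp: gen_pow_Suc letter_cocycle_def)

lemma cocycle_GenX_even_pow:
  "x \<in> orb \<Longrightarrow> free_equiv (cocycle (gen_pow GenX (2 * k)) x) []"
proof (induction k arbitrary: x)
  case (Suc k)
  have "cocycle (gen_pow GenX (2 * Suc k)) x =
      (edge_word x @ word_inv (edge_word x)) @ cocycle (gen_pow GenX (2 * k)) (\<sigma> (\<sigma> x))"
    using Suc.prems by (simp add: gen_pow_Suc letter_cocycle_def edge_word_sigma)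
  moreover have "free_equiv \<dots> ([] @ [])"
    using Suc.prems by (intro pres_equiv_append pres_equiv_word_inv_right Suc.IH step_in_orb) auto
  ultimately show ?case by simp
qed (simp add: pres_equiv.refl)

lemma cocycle_cong:
  assumes "Gamma_equiv m v w" "x \<in> orb"
  shows "free_equiv (cocycle v x) (cocycle w x)"
  using assms
proof (induction arbitrary: x rule: pres_equiv.induct)
  case (refl w)
  then show ?case by (simp add: pres_equiv.refl)
next
  case (sym v w)
  then show ?case by (simp add: pres_equiv.sym)
next
  case (trans u v w)
  then show ?case by (meson pres_equiv.trans)
next
  case (cancel u v g b)
  define y where "y = act u x"
  have y: "y \<in> orb" using cancel by (simp add: y_def act_in_orb)
  have "free_equiv (letter_cocycle y (g, b) @ letter_cocycle (letter_act \<sigma> \<tau> (g, b) y) (g, \<not> b)) []"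
    using y step_in_orb[OF y]
    by (cases g; cases b) (auto simp: letter_cocycle_def pres_equiv.refl intro: pres_equiv_word_inv_right pres_equiv_word_inv_left)
  then have "free_equiv (cocycle u x @ (letter_cocycle y (g, b) @ letter_cocycle (letter_act \<sigma> \<tau> (g, b) y) (g, \<not> b)) @ cocycle v y)
     (cocycle u x @ [] @ cocycle v y)"
    using y cancel.prems by (intro pres_equiv_context) auto
  then show ?case by (simp add: cocycle_append y_def letter_act_cancel)
next
  case (relation u v r s)
  define y where "y = act u x"
  have y: "y \<in> orb" using relation by (simp add: y_def act_in_orb)
  have rs: "act r y = act s y"
    using act_cong[OF pres_equiv_relation_self[OF relation(3)]] by simp
  \<comment> \<open>Only powers of \<open>GenX\<close> contribute, and an even power runs along the
    edge back and forth.\<close>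
  have "cocycle s y = [] \<and> free_equiv (cocycle r y) []"
    using relation(3) cocycle_GenX_even_pow[OF y, of m] cocycle_GenX_even_pow[OF y, of 1]
    by (auto simp: Gamma_rels_def pres_equiv.refl)
  then have "free_equiv (cocycle u x @ cocycle r y @ cocycle v (act r y)) (cocycle u x @ cocycle s y @ cocycle v (act r y))"
    using y relation.prems by (intro pres_equiv_context) (auto simp: act_in_orb)
  then show ?case using rs by (simp add: cocycle_append y_def)
qed

text \<open>Transversal words follow the spanning tree, whose edges are not recorded.\<close>

lemma cocycle_trans_word: "x \<in> orb \<Longrightarrow> cocycle (trans_word x) x0 = []"
proof (induction "lev x" arbitrary: x rule: less_induct)
  case less
  have "cocycle (entry_word x) x0 = []"
  proof (cases "x0 \<in> torb x")
    case False
    define u where "u = finv \<sigma> (rep x)"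
    have u: "u \<in> orb" "\<sigma> u = rep x" "lev u < lev x"
      using step_in_orb(3)[OF rep_in_orb] rep_lev less.prems False by (auto simp: u_def)
    have "rep x \<in> sorb u" using sigma_in_sorb[of u] u(2) by simp
    then have "tree u" using less.prems False sorb_sym unfolding tree_def by blast
    then show ?thesis
      using False u less.hyps[OF u(3,1)] act_trans_word[OF u(1)]
      by (simp add: entry_word_def u_def[symmetric] cocycle_append letter_cocycle_def edge_word_def)
  qed (simp add: entry_word_def)
  then show ?case by (simp add: trans_word_eq[OF less.prems] cocycle_append)
qed

lemma cocycle_edge:
  assumes "x \<in> orb"
  shows "free_equiv (cocycle (trans_word x @ xword @ word_inv (trans_word (\<sigma> x))) x0) (edge_word x)"
proof -
  define t where "t = trans_word (\<sigma> x)"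
  have t: "act t x0 = \<sigma> x" "cocycle t x0 = []"
    using assms by (simp_all add: t_def act_trans_word cocycle_trans_word step_in_orb)
  have "free_equiv (cocycle (t @ word_inv t) x0) (cocycle [] x0)"
    by (intro cocycle_cong pres_equiv_word_inv_right x0_in_orb) simp
  then have "free_equiv (cocycle (word_inv t) (\<sigma> x)) []"
    using t by (simp add: cocycle_append)
  then have "free_equiv (edge_word x @ cocycle (word_inv t) (\<sigma> x)) (edge_word x @ [])"
    using assms by (intro pres_equiv_append pres_equiv.refl) auto
  then show ?thesis
    using assms by (simp add: cocycle_append act_trans_word cocycle_trans_word t_def[symmetric] xword_def letter_cocycle_def)
qed

text \<open>Inner transversal words cancel, so the product of Schreier generators telescopes. For
  \<open>x = x0\<close> and \<open>w\<close> in the stabilizer the right side is the class of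
  \<open>w\<close> itself, which is the retraction needed for freeness.\<close>

lemma word_eval_cocycle:
  assumes "x \<in> orb"
  shows "word_eval (Gamma4 m) (\<lambda>s. s) (cocycle w x) =
    Gamma_class m (trans_word x @ w @ word_inv (trans_word (act w x)))"
  using assms
proof (induction w arbitrary: x)
  case Nil
  then show ?case
    using Gamma_class_congI[OF pres_equiv_word_inv_right[of "trans_word x"]] by (simp add: Gamma_class_one)
next
  case (Cons l w)
  interpret group "Gamma4 m" by (rule group_Gamma4)
  have ba: "s \<in> basis \<Longrightarrow> s \<in> carrier (Gamma4 m)" for s by (auto simp: basis_def)
  define y where "y = letter_act \<sigma> \<tau> l x"
  have y: "y \<in> orb" using Cons.prems by (simp add: y_def letter_act_in_orb)
  have l: "word_eval (Gamma4 m) (\<lambda>s. s) (letter_cocycle x l) = Gamma_class m (trans_word x @ [l] @ word_inv (trans_word y))"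
  proof -
    consider "l = (GenX, True)" | "l = (GenX, False)" | b where "l = (GenY, b)"
      by (cases l; cases "fst l"; cases "snd l") auto
    then show ?thesis
    proof cases
      case 1
      then show ?thesis using word_eval_edge_word[OF Cons.prems] by (simp add: letter_cocycle_def y_def edge_def xword_def)
    next
      case 2
      have yo: "\<sigma> y = x" using 2 by (simp add: y_def)
      have "word_eval (Gamma4 m) (\<lambda>s. s) (letter_cocycle x l) = edge x"
        using word_eval_edge_word[OF Cons.prems] edge_word_sigma[OF y] yo 2
        by (simp add: letter_cocycle_def y_def)
      also have "\<dots> = inv\<^bsub>Gamma4 m\<^esub> edge y" using edge_sigma[OF y] yo by simp
      also have "\<dots> = Gamma_class m (trans_word x @ [l] @ word_inv (trans_word y))"
        by (simp add: edge_def Gamma_class_inv yo 2 xword_def)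
      finally show ?thesis .
    next
      case 3
      have "Gamma_equiv m (trans_word y) (trans_word x @ [l])"
      proof (cases b)
        case True
        then show ?thesis using trans_word_tau_pow[OF Cons.prems, of 1] 3 by (simp add: y_def gen_pow_def)
      next
        case False
        have "x = \<tau> y" using 3 False by (simp add: y_def)
        then have "Gamma_equiv m (trans_word x @ [l]) ((trans_word y @ [(GenY, True)]) @ [l])"
          using trans_word_tau_pow[OF y, of 1] by (intro pres_equiv_append Gamma_equiv_refl) (simp add: gen_pow_def)
        also have "Gamma_equiv m ((trans_word y @ [(GenY, True)]) @ [l]) (trans_word y @ [])"
          using pres_equiv.cancel[of "trans_word y" "{GenX, GenY}" "[]" GenY "Gamma_rels m" True] 3 False by simp
        finally (pres_equiv.trans) show ?thesis by (simp add: pres_equiv.sym)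
      qed
      from pres_equiv.sym[OF this]
      have "Gamma_equiv m ((trans_word x @ [l]) @ word_inv (trans_word y)) (trans_word y @ word_inv (trans_word y))"
        by (intro pres_equiv_append Gamma_equiv_refl)
      also have "Gamma_equiv m (trans_word y @ word_inv (trans_word y)) []"
        by (rule pres_equiv_word_inv_right) simp
      finally (pres_equiv.trans) have "Gamma_class m ((trans_word x @ [l]) @ word_inv (trans_word y)) = Gamma_class m []"
        by (rule Gamma_class_congI)
      then show ?thesis by (simp add: 3 letter_cocycle_def Gamma_class_one)
    qed
  qed
  have c: "letter_cocycle x l \<in> gwords basis" using cocycle_in_gwords[OF Cons.prems, of "[l]"] by simp
  have "word_eval (Gamma4 m) (\<lambda>s. s) (cocycle (l # w) x) =
     Gamma_class m (trans_word x @ [l] @ word_inv (trans_word y)) \<otimes>\<^bsub>Gamma4 m\<^esub>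
     Gamma_class m (trans_word y @ w @ word_inv (trans_word (act w y)))"
    using word_eval_append[OF ba c cocycle_in_gwords[OF y]] Cons.IH[OF y] l by (simp add: y_def)
  also have "\<dots> = Gamma_class m ((trans_word x @ [l]) @ (word_inv (trans_word y) @ trans_word y) @ (w @ word_inv (trans_word (act w y))))"
    by (simp add: Gamma_class_mult)
  also have "\<dots> = Gamma_class m ((trans_word x @ [l]) @ [] @ (w @ word_inv (trans_word (act w y))))"
    by (intro Gamma_class_congI pres_equiv_context pres_equiv_word_inv_left) simp_all
  finally show ?case by (simp add: y_def)
qed

theorem is_free_group_stabilizer:
  "is_free_group ((Gamma4 m)\<lparr>carrier := stabilizer m \<sigma> \<tau> x0\<rparr>)"
proof -
  interpret group "Gamma4 m" by (rule group_Gamma4)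
  define H where "H = stabilizer m \<sigma> \<tau> x0"
  define \<phi> where "\<phi> h = wclass basis {} (cocycle (SOME w. h = Gamma_class m w) x0)" for h
  have \<phi>: "\<phi> (Gamma_class m w) = wclass basis {} (cocycle w x0)" for w
  proof -
    have "Gamma_class m w = Gamma_class m (SOME v. Gamma_class m w = Gamma_class m v)"
      by (rule someI[of _ w]) simp
    then have "free_equiv (cocycle w x0) (cocycle (SOME v. Gamma_class m w = Gamma_class m v) x0)"
      by (intro cocycle_cong x0_in_orb) (simp only: Gamma_class_eq_iff)
    then show ?thesis unfolding \<phi>_def by (intro wclass_eqI[symmetric])
  qed
  have Hw: "\<exists>w. h = Gamma_class m w \<and> act w x0 = x0" if "h \<in> H" for h
    using that by (auto simp: H_def stabilizer_def)
  have "is_free_group ((Gamma4 m)\<lparr>carrier := H\<rparr>)"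
  proof (rule is_free_group_subgroupI)
    show "subgroup H (Gamma4 m)" unfolding H_def by (rule subgroup_stabilizer)
    show "basis \<subseteq> H" using edge_in_stabilizer by (auto simp: basis_def H_def)
    show "\<phi> \<in> hom ((Gamma4 m)\<lparr>carrier := H\<rparr>) (presented_group basis {})"
    proof (rule homI)
      fix h assume "h \<in> carrier ((Gamma4 m)\<lparr>carrier := H\<rparr>)"
      then obtain w where "h = Gamma_class m w" using Hw by auto
      then show "\<phi> h \<in> carrier (presented_group basis {})" using \<phi> x0_in_orb by simp
    next
      fix g h assume "g \<in> carrier ((Gamma4 m)\<lparr>carrier := H\<rparr>)" "h \<in> carrier ((Gamma4 m)\<lparr>carrier := H\<rparr>)"
      then have gh: "g \<in> H" "h \<in> H" by simp_all
      obtain v where "g = Gamma_class m v" "act v x0 = x0" using Hw[OF gh(1)] by blast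
      moreover obtain w where "h = Gamma_class m w" using Hw[OF gh(2)] by blast
      ultimately show "\<phi> (g \<otimes>\<^bsub>(Gamma4 m)\<lparr>carrier := H\<rparr>\<^esub> h) = \<phi> g \<otimes>\<^bsub>presented_group basis {}\<^esub> \<phi> h"
        using x0_in_orb by (simp add: Gamma_class_mult \<phi> wclass_mult cocycle_append)
    qed
    show "\<phi> s = wclass basis {} [(s, True)]" if s: "s \<in> basis" for s
    proof -
      obtain x where x: "x \<in> orb" "\<not> tree x" "pos x" "s = edge x" using s unfolding basis_def by blast
      have "\<phi> s = wclass basis {} (edge_word x)"
        unfolding x(4) edge_def \<phi> by (intro wclass_eqI cocycle_edge x)
      then show ?thesis using x by (simp add: edge_word_def)
    qed
    show "\<exists>w\<in>gwords basis. \<phi> h = wclass basis {} w \<and> word_eval (Gamma4 m) (\<lambda>s. s) w = h" if h: "h \<in> H" for h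
    proof -
      obtain w where w: "h = Gamma_class m w" "act w x0 = x0" using Hw[OF h] by blast
      have "Gamma_equiv m (trans_word x0 @ w @ word_inv (trans_word x0)) ([] @ w @ [])"
      proof (intro pres_equiv_append Gamma_equiv_refl trans_word_x0)
        have "Gamma_equiv m ([] @ word_inv (trans_word x0)) (trans_word x0 @ word_inv (trans_word x0))"
          by (intro pres_equiv_append Gamma_equiv_refl pres_equiv.sym[OF trans_word_x0])
        also have "Gamma_equiv m (trans_word x0 @ word_inv (trans_word x0)) []"
          by (rule pres_equiv_word_inv_right) simp
        finally (pres_equiv.trans) show "Gamma_equiv m (word_inv (trans_word x0)) []" by simp
      qed
      then have "word_eval (Gamma4 m) (\<lambda>s. s) (cocycle w x0) = h"
        using word_eval_cocycle[OF x0_in_orb, of w] w Gamma_class_congI by simp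
      then show ?thesis using \<phi> w(1) x0_in_orb by (intro bexI[of _ "cocycle w x0"]) auto
    qed
  qed
  then show ?thesis by (simp add: H_def)
qed

end

section \<open>Gluing permutations\<close>

lemma funpow_cong_on:
  assumes "\<And>y. y \<in> Y \<Longrightarrow> f y = g y \<and> g y \<in> Y" "x \<in> Y"
  shows "(f ^^ k) x = (g ^^ k) x \<and> (g ^^ k) x \<in> Y"
  using assms by (induction k) auto

lemma semiregular_at_cong:
  assumes "\<And>y. y \<in> Y \<Longrightarrow> f y = g y \<and> g y \<in> Y" "x \<in> Y"
  shows "semiregular_at f d x \<longleftrightarrow> semiregular_at g d x"
  using funpow_cong_on[OF assms] by (simp add: semiregular_at_def)

lemma glue_permutation:
  assumes p: "p permutes Y" and q: "q permutes (X - Y)" and YX: "Y \<subseteq> X"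
  shows "(q \<circ> p) permutes X" "y \<in> Y \<Longrightarrow> (q \<circ> p) y = p y" "y \<notin> Y \<Longrightarrow> (q \<circ> p) y = q y"
proof -
  have "p permutes X" "q permutes X" using permutes_subset[OF p YX] permutes_subset[OF q] by auto
  then show "(q \<circ> p) permutes X" by (rule permutes_compose)
  show "y \<in> Y \<Longrightarrow> (q \<circ> p) y = p y" using permutes_in_image[OF p] permutes_not_in[OF q] by simp
  show "y \<notin> Y \<Longrightarrow> (q \<circ> p) y = q y" using permutes_not_in[OF p] by simp
qed

lemma unglue_permutation:
  assumes p: "p permutes Y" and f: "f permutes X" and YX: "Y \<subseteq> X" and agree: "\<And>y. y \<in> Y \<Longrightarrow> f y = p y"
  shows "\<exists>q. q permutes (X - Y) \<and> f = q \<circ> p"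
proof (intro exI conjI)
  have "p permutes X" using permutes_subset[OF p YX] .
  then have "(f \<circ> finv p) permutes X" using f by (intro permutes_compose permutes_inv)
  moreover have "(f \<circ> finv p) x = x" if "x \<in> X - (X - Y)" for x
  proof -
    have "finv p x \<in> Y" using that permutes_in_image[OF permutes_inv[OF p]] by auto
    then show ?thesis using agree permutes_inverses[OF p] by simp
  qed
  ultimately show "(f \<circ> finv p) permutes (X - Y)" by (rule permutes_superset)
  show "f = (f \<circ> finv p) \<circ> p" by (simp add: fun_eq_iff permutes_inverses[OF p])
qed

lemma glue_cancel:
  assumes "p permutes Y" "q \<circ> p = q' \<circ> p"
  shows "q = q'"
  using assms by (metis comp_assoc comp_id permutes_inv_o(1))

text \<open>\<open>P f x\<close> depends only on \<open>f\<close> on an invariant set containing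
  \<open>x\<close>. Such conditions can be checked separately on the pieces of a glued
  permutation.\<close>

definition local_property :: "(('a \<Rightarrow> 'a) \<Rightarrow> 'a \<Rightarrow> bool) \<Rightarrow> bool" where
  "local_property P \<longleftrightarrow> (\<forall>f g Y x. x \<in> Y \<longrightarrow> (\<forall>y\<in>Y. f y = g y \<and> g y \<in> Y) \<longrightarrow> P f x = P g x)"

lemma local_propertyD:
  assumes "local_property P" "x \<in> Y" "\<forall>y\<in>Y. f y = g y \<and> g y \<in> Y"
  shows "P f x = P g x"
  using assms(1)[unfolded local_property_def, rule_format, of x Y f g] assms(2,3) by simp

definition perms_with :: "(('a \<Rightarrow> 'a) \<Rightarrow> 'a \<Rightarrow> bool) \<Rightarrow> 'a set \<Rightarrow> ('a \<Rightarrow> 'a) set" where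
  "perms_with P X = {f. f permutes X \<and> (\<forall>x\<in>X. P f x)}"

lemma finite_perms_with: "finite X \<Longrightarrow> finite (perms_with P X)"
  by (rule finite_subset[OF _ finite_permutations]) (auto simp: perms_with_def)

text \<open>Composition with \<open>p\<close> is a bijection from the admissible permutations of the
  complement to the extensions of \<open>p\<close>.\<close>

lemma card_perms_with_agreeing:
  assumes P: "local_property P" and YX: "Y \<subseteq> X" and p: "p permutes Y" "\<And>y. y \<in> Y \<Longrightarrow> P p y"
  shows "card {f \<in> perms_with P X. \<forall>y\<in>Y. f y = p y} = card (perms_with P (X - Y))"
proof -
  have "{f \<in> perms_with P X. \<forall>y\<in>Y. f y = p y} = (\<lambda>q. q \<circ> p) ` perms_with P (X - Y)"
  proof (intro equalityI subsetI)
    fix f assume f: "f \<in> {f \<in> perms_with P X. \<forall>y\<in>Y. f y = p y}"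
    obtain q where q: "q permutes (X - Y)" "f = q \<circ> p"
      using f unglue_permutation[OF p(1) _ YX, of f] by (auto simp: perms_with_def)
    have "P q x" if x: "x \<in> X - Y" for x
    proof -
      have "\<forall>y\<in>X - Y. f y = q y \<and> q y \<in> X - Y"
      proof (intro ballI conjI)
        fix y assume y: "y \<in> X - Y"
        then show "f y = q y" unfolding q(2) using glue_permutation(3)[OF p(1) q(1) YX, of y] by blast
        show "q y \<in> X - Y" using permutes_in_image[OF q(1), of y] y by blast
      qed
      then have "P f x = P q x" by (rule local_propertyD[OF P x])
      then show ?thesis using f x by (simp add: perms_with_def)
    qed
    then show "f \<in> (\<lambda>q. q \<circ> p) ` perms_with P (X - Y)" using q by (auto simp: perms_with_def)
  next
    fix f assume "f \<in> (\<lambda>q. q \<circ> p) ` perms_with P (X - Y)"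
    then obtain q where q: "q permutes (X - Y)" "\<And>x. x \<in> X - Y \<Longrightarrow> P q x" "f = q \<circ> p"
      by (auto simp: perms_with_def)
    have fY: "\<forall>y\<in>Y. f y = p y \<and> p y \<in> Y"
      using glue_permutation(2)[OF p(1) q(1) YX] permutes_in_image[OF p(1)] q(3) by auto
    have fXY: "\<forall>y\<in>X - Y. f y = q y \<and> q y \<in> X - Y"
      using glue_permutation(3)[OF p(1) q(1) YX] permutes_in_image[OF q(1)] q(3) by auto
    have "P f x" if x: "x \<in> X" for x
    proof (cases "x \<in> Y")
      case True
      then have "P f x = P p x" by (rule local_propertyD[OF P _ fY])
      then show ?thesis using p(2) True by simp
    next
      case False
      then have "P f x = P q x" using x by (intro local_propertyD[OF P _ fXY]) blast
      then show ?thesis using q(2) False x by simp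
    qed
    then show "f \<in> {f \<in> perms_with P X. \<forall>y\<in>Y. f y = p y}"
      using glue_permutation(1)[OF p(1) q(1) YX] fY q(3) by (auto simp: perms_with_def)
  qed
  moreover have "inj_on (\<lambda>q. q \<circ> p) (perms_with P (X - Y))"
    using glue_cancel[OF p(1)] by (auto intro: inj_onI)
  ultimately show ?thesis by (simp add: card_image)
qed

section \<open>Counting permutations by the cycle through a base point\<close>

lemma cycle_of_list_funpow_nth:
  assumes "distinct xs" "i < length xs"
  shows "(cycle_of_list xs ^^ k) (xs ! i) = xs ! ((k + i) mod length xs)"
  using arg_cong[OF cyclic_rotation[OF assms(1), of k], of "\<lambda>ys. ys ! i"] assms(2)
  by (simp add: nth_rotate)

lemma semiregular_at_cycle_of_list:
  assumes "distinct xs" "x \<in> set xs"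
  shows "semiregular_at (cycle_of_list xs) (length xs) x"
proof -
  obtain i where i: "i < length xs" "x = xs ! i" using assms(2) by (metis in_set_conv_nth)
  have pos: "length xs > 0" using i by auto
  have "(cycle_of_list xs ^^ k) x = x \<longleftrightarrow> (k + i) mod length xs = i" for k
    unfolding i(2) cycle_of_list_funpow_nth[OF assms(1) i(1)]
    using nth_eq_iff_index_eq[OF assms(1), of "(k + i) mod length xs" i] i(1) pos by simp
  moreover have "(k + i) mod length xs = i \<longleftrightarrow> length xs dvd k" for k
  proof -
    have "(k + i) mod length xs = i \<longleftrightarrow> [k + i = 0 + i] (mod length xs)" using i(1) by (simp add: cong_def)
    then show ?thesis by (simp only: cong_add_rcancel_nat cong_0_iff)
  qed
  ultimately show ?thesis unfolding semiregular_at_def by (auto dest: dvd_imp_le)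
qed

definition trajectory :: "('a \<Rightarrow> 'a) \<Rightarrow> 'a \<Rightarrow> nat \<Rightarrow> 'a list" where
  "trajectory f x d = map (\<lambda>k. (f ^^ k) x) [0..<d]"

lemma trajectory_simps [simp]: "length (trajectory f x d) = d" "k < d \<Longrightarrow> trajectory f x d ! k = (f ^^ k) x"
  by (simp_all add: trajectory_def)

lemma distinct_trajectory:
  assumes "inj f" "semiregular_at f d x" "d > 0"
  shows "distinct (trajectory f x d)"
  unfolding distinct_conv_nth
  using semiregular_at_eq_iff[OF assms(2,3,1)] by (auto simp: cong_def)

lemma trajectory_agree:
  assumes "semiregular_at f d x" "distinct (trajectory f x d)" "d > 0" "y \<in> set (trajectory f x d)"
  shows "f y = cycle_of_list (trajectory f x d) y"
proof -
  obtain k where k: "k < d" "y = (f ^^ k) x" using assms(4) by (auto simp: trajectory_def)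
  have "cycle_of_list (trajectory f x d) y = (f ^^ (Suc k mod d)) x"
    using cycle_of_list_funpow_nth[OF assms(2), of k 1] k assms(3) by simp
  also have "\<dots> = (f ^^ Suc k) x" using semiregular_at_mod[OF assms(1)] by metis
  finally show ?thesis using k by simp
qed

lemma agree_trajectory:
  assumes "distinct xs" "xs \<noteq> []" "\<And>y. y \<in> set xs \<Longrightarrow> f y = cycle_of_list xs y"
  shows "trajectory f (hd xs) (length xs) = xs"
proof (rule nth_equalityI)
  fix k assume "k < length (trajectory f (hd xs) (length xs))"
  then have k: "k < length xs" by simp
  have "(f ^^ k) (hd xs) = (cycle_of_list xs ^^ k) (hd xs)"
    using assms(2,3) permutes_in_image[OF cycle_permutes[of xs]]
    by (intro conjunct1[OF funpow_cong_on[of "set xs"]]) auto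
  also have "\<dots> = xs ! k"
    using cycle_of_list_funpow_nth[OF assms(1), of 0 k] k assms(2) by (simp add: hd_conv_nth)
  finally show "trajectory f (hd xs) (length xs) ! k = xs ! k" using k by simp
qed simp

text \<open>Partition by the cycle of \<open>x0\<close>, written as a list starting at
  \<open>x0\<close>. A permutation determines its list, and each list leaves \<open>N\<close>
  possibilities on the complement.\<close>

lemma card_perms_with_by_trajectory:
  assumes fin: "finite X" and x0: "x0 \<in> X" and d: "d > 0" and P: "local_property P"
    and semi: "\<And>f x. P f x \<Longrightarrow> semiregular_at f d x"
    and L: "\<And>xs. xs \<in> L \<longleftrightarrow> distinct xs \<and> length xs = d \<and> set xs \<subseteq> X \<and> hd xs = x0 \<and> (\<forall>y\<in>set xs. P (cycle_of_list xs) y)"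
    and N: "\<And>xs. xs \<in> L \<Longrightarrow> card (perms_with P (X - set xs)) = N"
  shows "card (perms_with P X) = card L * N"
proof -
  have finL: "finite L"
    by (rule finite_subset[OF _ finite_lists_length_eq[OF fin, of d]]) (auto simp: L)
  define F where "F xs = {f \<in> perms_with P X. \<forall>y\<in>set xs. f y = cycle_of_list xs y}" for xs
  have tr: "trajectory f x0 d = xs" if "f \<in> F xs" "xs \<in> L" for f xs
    using that agree_trajectory[of xs f] d L[of xs] by (auto simp: F_def)
  have "perms_with P X = (\<Union>xs\<in>L. F xs)"
  proof (intro equalityI subsetI)
    fix f assume f: "f \<in> perms_with P X"
    define xs where "xs = trajectory f x0 d"
    have perm: "f permutes X" and s: "semiregular_at f d x0" and Pf: "\<And>x. x \<in> X \<Longrightarrow> P f x"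
      using f x0 semi by (auto simp: perms_with_def)
    have dist: "distinct xs" unfolding xs_def
      by (rule distinct_trajectory[OF permutes_inj[OF perm] s d])
    have agree: "f y = cycle_of_list xs y" if "y \<in> set xs" for y
      using that dist d s unfolding xs_def by (intro trajectory_agree)
    have inX: "(f ^^ k) x0 \<in> X" for k using x0 permutes_in_image[OF perm] by (induction k) auto
    have sub: "set xs \<subseteq> X" using inX by (auto simp: xs_def trajectory_def)
    have "P (cycle_of_list xs) y" if y: "y \<in> set xs" for y
    proof -
      have "\<forall>y\<in>set xs. f y = cycle_of_list xs y \<and> cycle_of_list xs y \<in> set xs"
        using agree permutes_in_image[OF cycle_permutes[of xs]] by auto
      then have "P f y = P (cycle_of_list xs) y" by (rule local_propertyD[OF P y])
      then show ?thesis using Pf sub y by auto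
    qed
    moreover have "hd xs = x0" using d by (simp add: xs_def trajectory_def hd_map)
    ultimately have "xs \<in> L" using dist sub by (simp add: L xs_def)
    moreover have "f \<in> F xs" using f agree by (simp add: F_def)
    ultimately show "f \<in> (\<Union>xs\<in>L. F xs)" by blast
  qed (auto simp: F_def)
  then have "card (perms_with P X) = card (\<Union>xs\<in>L. F xs)" by simp
  also have "\<dots> = (\<Sum>xs\<in>L. card (F xs))"
  proof (rule card_UN_disjoint[OF finL])
    show "\<forall>xs\<in>L. finite (F xs)" using finite_perms_with[OF fin] by (simp add: F_def)
    show "\<forall>xs\<in>L. \<forall>ys\<in>L. xs \<noteq> ys \<longrightarrow> F xs \<inter> F ys = {}" using tr by blast
  qed
  also have "\<dots> = (\<Sum>xs\<in>L. N)"
  proof (rule sum.cong[OF HOL.refl])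
    fix xs assume xs: "xs \<in> L"
    have "card (F xs) = card (perms_with P (X - set xs))"
      unfolding F_def using L[of xs] xs by (intro card_perms_with_agreeing P cycle_permutes) auto
    then show "card (F xs) = N" using N[OF xs] by simp
  qed
  finally show ?thesis by simp
qed

lemma card_pointed_lists:
  assumes "finite X" "x0 \<in> X" "0 < d" "d \<le> card X"
  shows "card {xs. distinct xs \<and> length xs = d \<and> set xs \<subseteq> X \<and> hd xs = x0} * fact (card X - d) = fact (card X - 1)"
proof -
  define L where "L = {xs. length xs = d - 1 \<and> distinct xs \<and> set xs \<subseteq> X - {x0}}"
  have "{xs. distinct xs \<and> length xs = d \<and> set xs \<subseteq> X \<and> hd xs = x0} = Cons x0 ` L"
  proof (intro equalityI subsetI)
    fix xs assume "xs \<in> {xs. distinct xs \<and> length xs = d \<and> set xs \<subseteq> X \<and> hd xs = x0}"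
    then show "xs \<in> Cons x0 ` L" using assms(3) by (cases xs) (auto simp: L_def)
  qed (use assms(2,3) in \<open>auto simp: L_def\<close>)
  then have "card {xs. distinct xs \<and> length xs = d \<and> set xs \<subseteq> X \<and> hd xs = x0} = card L"
    by (simp add: card_image)
  also have "card L = \<Prod>{card X - d + 1..card X - 1}"
  proof -
    have "card L = \<Prod>{card (X - {x0}) - (d - 1) + 1..card (X - {x0})}"
      unfolding L_def using assms by (intro card_lists_distinct_length_eq) auto
    moreover have "card (X - {x0}) = card X - 1" using assms by simp
    moreover have "card X - 1 - (d - 1) = card X - d" using assms by simp
    ultimately show ?thesis by simp
  qed
  moreover have "\<Prod>{1..card X - d} * \<Prod>{card X - d + 1..card X - 1} = \<Prod>{1..card X - 1}"
  proof -
    have "card X - 1 = (card X - d) + (d - 1)" using assms by simp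
    then show ?thesis using prod.ub_add_nat[of 1 "card X - d" "\<lambda>i. i" "d - 1"] by simp
  qed
  ultimately show ?thesis by (simp add: fact_prod mult.commute)
qed

lemma local_semiregular: "local_property (\<lambda>f. semiregular_at f d)"
  unfolding local_property_def
proof (intro allI impI)
  fix f g :: "'a \<Rightarrow> 'a" and Y x
  assume "x \<in> Y" "\<forall>y\<in>Y. f y = g y \<and> g y \<in> Y"
  then show "semiregular_at f d x = semiregular_at g d x" by (intro semiregular_at_cong[of Y]) auto
qed

text \<open>Induction on the number of cycles: the cycle of one point is a pointed list, and what
  remains is a semiregular permutation of the complement.\<close>

lemma card_semiregular_perms:
  assumes "finite X" "card X = d * M" "d > 0"
  shows "card (perms_with (\<lambda>f. semiregular_at f d) X) * (d ^ M * fact M) = fact (card X)"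
  using assms(1,2)
proof (induction M arbitrary: X)
  case 0
  then have "X = {}" by simp
  then have "perms_with (\<lambda>f. semiregular_at f d) X = {id}" by (auto simp: perms_with_def)
  then show ?case using 0 by simp
next
  case (Suc M)
  define P where "P = (\<lambda>f :: 'a \<Rightarrow> 'a. semiregular_at f d)"
  define L where "L = {xs. distinct xs \<and> length xs = d \<and> set xs \<subseteq> X \<and> hd xs = (SOME x. x \<in> X)}"
  have "card X > 0" using Suc.prems assms(3) by simp
  then have x0: "(SOME x. x \<in> X) \<in> X" by (metis card_gt_0_iff ex_in_conv someI_ex)
  have dX: "d \<le> card X" "card X - d = d * M" using Suc.prems by simp_all
  \<comment> \<open>The count on the complement, obtained by exact division, because one constant is
    needed for all possible cycles.\<close>
  define c where "c = fact (d * M) div (d ^ M * fact M :: nat)"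
  have c: "card (perms_with P (X - set xs)) = c" if "xs \<in> L" for xs
  proof -
    have cX: "card (X - set xs) = d * M" "finite (X - set xs)"
      using that Suc.prems dX by (auto simp: L_def card_Diff_subset distinct_card)
    have "card (perms_with P (X - set xs)) * (d ^ M * fact M) = fact (d * M)"
      using Suc.IH[OF cX(2,1)] cX(1) by (simp add: P_def)
    moreover have "d ^ M * fact M \<noteq> (0 :: nat)" using assms(3) by simp
    ultimately show ?thesis unfolding c_def by (metis nonzero_mult_div_cancel_right)
  qed
  have "card (perms_with P X) = card L * c"
  proof (rule card_perms_with_by_trajectory[OF Suc.prems(1) x0 assms(3)])
    show "local_property P" unfolding P_def by (rule local_semiregular)
    show "xs \<in> L \<longleftrightarrow> distinct xs \<and> length xs = d \<and> set xs \<subseteq> X \<and> hd xs = (SOME x. x \<in> X) \<and>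
          (\<forall>y\<in>set xs. P (cycle_of_list xs) y)" for xs
      using semiregular_at_cycle_of_list by (auto simp: L_def P_def)
  qed (use c in \<open>auto simp: P_def\<close>)
  moreover have "card L * fact (d * M) = fact (card X - 1)"
    using card_pointed_lists[OF Suc.prems(1) x0 assms(3) dX(1)] dX(2) by (simp add: L_def)
  moreover have "L \<noteq> {}"
    using calculation(2) by (metis card.empty fact_nonzero mult_zero_left)
  then obtain xs where "xs \<in> L" by blast
  have "c * (d ^ M * fact M) = fact (d * M)"
  proof -
    have cX: "card (X - set xs) = d * M" "finite (X - set xs)"
      using \<open>xs \<in> L\<close> Suc.prems dX by (auto simp: L_def card_Diff_subset distinct_card)
    show ?thesis using Suc.IH[OF cX(2,1)] cX(1) c[OF \<open>xs \<in> L\<close>] by (simp add: P_def)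
  qed
  ultimately have "card (perms_with P X) * (d ^ Suc M * fact (Suc M)) = (d * Suc M) * fact (card X - 1)"
  proof -
    assume a: "card (perms_with P X) = card L * c" "card L * fact (d * M) = fact (card X - 1)" "c * (d ^ M * fact M) = fact (d * M)"
    have "card (perms_with P X) * (d ^ Suc M * fact (Suc M)) = (d * Suc M) * (card L * (c * (d ^ M * fact M)))"
      unfolding a(1) by (simp add: algebra_simps)
    then show ?thesis unfolding a(3) a(2) .
  qed
  also have "\<dots> = fact (card X)"
    using \<open>card X > 0\<close> Suc.prems(2) by (metis fact_reduce of_nat_id)
  finally show ?case by (simp add: P_def)
qed

text \<open>Square roots of a semiregular permutation \<open>\<zeta>\<close> of order \<open>m\<close>: the image \<open>y\<close> of the
  point \<open>x0\<close> lies in another \<open>\<zeta>\<close>-cycle and determines a cycle of length \<open>2m\<close>.\<close>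

definition sqrt_at :: "nat \<Rightarrow> ('a \<Rightarrow> 'a) \<Rightarrow> ('a \<Rightarrow> 'a) \<Rightarrow> 'a \<Rightarrow> bool" where
  "sqrt_at m \<zeta> f x \<longleftrightarrow> f (f x) = \<zeta> x \<and> semiregular_at f (2 * m) x"

lemma local_sqrt: "local_property (sqrt_at m \<zeta>)"
  unfolding local_property_def
proof (intro allI impI)
  fix f g :: "'a \<Rightarrow> 'a" and Y x
  assume "x \<in> Y" "\<forall>y\<in>Y. f y = g y \<and> g y \<in> Y"
  then show "sqrt_at m \<zeta> f x = sqrt_at m \<zeta> g x"
    using semiregular_at_cong[of Y f g x "2 * m"] by (simp add: sqrt_at_def)
qed

text \<open>The cycle x, y, \<zeta> x, \<zeta> y, ... that a square root of \<zeta> sending x to y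
  must have.\<close>

definition interleave :: "nat \<Rightarrow> ('a \<Rightarrow> 'a) \<Rightarrow> 'a \<Rightarrow> 'a \<Rightarrow> 'a list" where
  "interleave m \<zeta> x y = map (\<lambda>k. (\<zeta> ^^ (k div 2)) (if even k then x else y)) [0..<2 * m]"

lemma nth_interleave: "k < 2 * m \<Longrightarrow> interleave m \<zeta> x y ! k = (\<zeta> ^^ (k div 2)) (if even k then x else y)"
  by (simp add: interleave_def)

lemma set_interleave: "set (interleave m \<zeta> x y) = set (trajectory \<zeta> x m) \<union> set (trajectory \<zeta> y m)"
proof -
  have "(\<zeta> ^^ k) x \<in> set (interleave m \<zeta> x y)" "(\<zeta> ^^ k) y \<in> set (interleave m \<zeta> x y)" if "k < m" for k
    using that unfolding interleave_def by (auto intro: rev_image_eqI[of "2 * k"] rev_image_eqI[of "Suc (2 * k)"])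
  then show ?thesis by (auto simp: trajectory_def) (auto simp: interleave_def)
qed

lemma distinct_interleave:
  assumes z: "inj \<zeta>" "semiregular_at \<zeta> m x" "semiregular_at \<zeta> m y" and m: "m > 0"
    and y: "y \<notin> set (trajectory \<zeta> x m)"
  shows "distinct (interleave m \<zeta> x y)"
proof -
  have ne: "(\<zeta> ^^ i) x \<noteq> (\<zeta> ^^ j) y" if "i < m" "j < m" for i j
  proof
    assume e: "(\<zeta> ^^ i) x = (\<zeta> ^^ j) y"
    have "y = (\<zeta> ^^ m) y" using z(3) by (simp add: semiregular_at_def)
    also have "\<dots> = (\<zeta> ^^ (m - j)) ((\<zeta> ^^ j) y)" using that by (metis comp_apply funpow_add le_add_diff_inverse2 less_imp_le)
    also have "\<dots> = (\<zeta> ^^ (m - j + i)) x" by (simp add: e[symmetric] funpow_add)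
    also have "\<dots> = (\<zeta> ^^ ((m - j + i) mod m)) x" by (rule semiregular_at_mod[OF z(2)])
    finally show False using y m by (auto simp: trajectory_def)
  qed
  have eqx: "i = j" if "(\<zeta> ^^ i) x = (\<zeta> ^^ j) x" "i < m" "j < m" for i j
    using semiregular_at_eq_iff[OF z(2) m z(1)] that by (simp add: cong_def)
  have eqy: "i = j" if "(\<zeta> ^^ i) y = (\<zeta> ^^ j) y" "i < m" "j < m" for i j
    using semiregular_at_eq_iff[OF z(3) m z(1)] that by (simp add: cong_def)
  show ?thesis
  proof (unfold distinct_conv_nth, intro allI impI notI)
    fix i j assume ij: "i < length (interleave m \<zeta> x y)" "j < length (interleave m \<zeta> x y)" "i \<noteq> j"
      "interleave m \<zeta> x y ! i = interleave m \<zeta> x y ! j"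
    have ij2: "i < 2 * m" "j < 2 * m" "i div 2 < m" "j div 2 < m" using ij by (auto simp: interleave_def)
    show False
      using ij(3,4) ij2 ne[of "i div 2" "j div 2"] ne[of "j div 2" "i div 2"] eqx[of "i div 2" "j div 2"] eqy[of "i div 2" "j div 2"]
      unfolding nth_interleave[OF ij2(1)] nth_interleave[OF ij2(2)]
      by (cases "even i"; cases "even j") (auto elim!: evenE oddE)
  qed
qed

lemma interleave_sqrt:
  assumes d: "distinct (interleave m \<zeta> x y)" and m: "m > 0" and z: "semiregular_at \<zeta> m x" "semiregular_at \<zeta> m y"
    and w: "w \<in> set (interleave m \<zeta> x y)"
  shows "sqrt_at m \<zeta> (cycle_of_list (interleave m \<zeta> x y)) w"
proof -
  define xs where "xs = interleave m \<zeta> x y"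
  have len: "length xs = 2 * m" by (simp add: xs_def interleave_def)
  obtain k where k: "k < 2 * m" "w = xs ! k" using w len unfolding xs_def[symmetric] by (metis in_set_conv_nth)
  have "cycle_of_list xs (cycle_of_list xs w) = xs ! ((2 + k) mod (2 * m))"
    using cycle_of_list_funpow_nth[of xs k 2] d k len by (simp add: xs_def[symmetric] numeral_2_eq_2)
  also have "\<dots> = (\<zeta> ^^ (((2 + k) mod (2 * m)) div 2)) (if even k then x else y)"
    using m unfolding xs_def by (subst nth_interleave) (auto simp: even_mod_2_iff dvd_mod_iff mod_mod_cancel)
  also have "((2 + k) mod (2 * m)) div 2 = (k div 2 + 1) mod m"
    by (simp add: mod_mult2_eq)
  also have "(\<zeta> ^^ ((k div 2 + 1) mod m)) (if even k then x else y) = (\<zeta> ^^ (k div 2 + 1)) (if even k then x else y)"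
    by (cases "even k") (simp_all only: if_True if_False semiregular_at_mod[OF z(1), of "k div 2 + 1"]
      semiregular_at_mod[OF z(2), of "k div 2 + 1"])
  also have "\<dots> = \<zeta> w" unfolding k(2) xs_def nth_interleave[OF k(1)] by simp
  finally show ?thesis
    using semiregular_at_cycle_of_list[of xs w] d w len by (simp add: sqrt_at_def xs_def)
qed

lemma sqrt_perm_funpow:
  assumes "\<And>x. x \<in> X \<Longrightarrow> f (f x) = \<zeta> x \<and> \<zeta> x \<in> X" "x \<in> X"
  shows "(f ^^ (2 * k)) x = (\<zeta> ^^ k) x" "(\<zeta> ^^ k) x \<in> X"
proof -
  have "(f ^^ (2 * k)) x = (\<zeta> ^^ k) x \<and> (\<zeta> ^^ k) x \<in> X"
    using assms by (induction k) auto
  then show "(f ^^ (2 * k)) x = (\<zeta> ^^ k) x" "(\<zeta> ^^ k) x \<in> X" by auto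
qed

lemma mod_set_trajectory:
  assumes "semiregular_at \<zeta> m x" "m > 0"
  shows "(\<zeta> ^^ k) x \<in> set (trajectory \<zeta> x m)"
  using semiregular_at_mod[OF assms(1), of k] assms(2) by (auto simp: trajectory_def)

lemma trajectory_backward:
  assumes "inj f" "semiregular_at f d w" "d > 0" "f x \<in> set (trajectory f w d)"
  shows "x \<in> set (trajectory f w d)"
proof -
  obtain k where k: "f x = (f ^^ k) w" using assms(4) by (auto simp: trajectory_def)
  have "(f ^^ k) w = (f ^^ (k + d)) w" using assms(2) by (simp add: funpow_add semiregular_at_def)
  also have "\<dots> = f ((f ^^ (k + d - 1)) w)" using assms(3) by (metis add_gr_0 Suc_diff_1 comp_apply funpow.simps(2))
  finally have "x = (f ^^ (k + d - 1)) w" using k assms(1) by (metis injD)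
  then show ?thesis using mod_set_trajectory[OF assms(2,3)] by simp
qed

text \<open>The set is a disjoint union of cycles of length \<open>d\<close>, which are removed one
  at a time.\<close>

lemma semiregular_dvd_card:
  assumes "finite A" "inj f" "d > 0" "\<And>x. x \<in> A \<Longrightarrow> f x \<in> A \<and> semiregular_at f d x"
  shows "d dvd card A"
  using assms(1,4)
proof (induction A rule: finite_psubset_induct)
  case (psubset A)
  show ?case
  proof (cases "A = {}")
    case False
    then obtain x where x: "x \<in> A" by blast
    define T where "T = set (trajectory f x d)"
    have "(f ^^ k) x \<in> A" for k using x psubset.prems by (induction k) auto
    then have TA: "T \<subseteq> A" by (auto simp: T_def trajectory_def)
    have "x \<in> T" using mod_set_trajectory[of f d x 0] psubset.prems[OF x] assms(3) by (simp add: T_def)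
    then have "A - T \<subset> A" using x by blast
    then have "d dvd card (A - T)"
    proof (rule psubset.IH)
      fix y assume y: "y \<in> A - T"
      have "f y \<notin> T" using trajectory_backward[OF assms(2) conjunct2[OF psubset.prems[OF x]] assms(3), of y] y
        by (auto simp: T_def)
      then show "f y \<in> A - T \<and> semiregular_at f d y" using y psubset.prems by blast
    qed
    moreover have "card T = d"
      unfolding T_def using distinct_trajectory[OF assms(2) conjunct2[OF psubset.prems[OF x]] assms(3)]
      by (simp add: distinct_card)
    moreover have "card A = card (A - T) + card T"
      using TA psubset.hyps by (metis card_Diff_subset card_mono finite_subset le_add_diff_inverse2)
    ultimately show ?thesis by simp
  qed simp
qed

text \<open>A square root pairs the 2M cycles of \<zeta> and chooses one of m offsets in each pair.
  The induction removes the pair containing \<open>x0\<close>; the image of \<open>x0\<close> may be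
  any point outside the \<zeta>-cycle of \<open>x0\<close>, which leaves
  \<open>m * (2 * M + 1)\<close> choices.\<close>

lemma card_sqrt_perms:
  fixes X :: "'a set"
  assumes "finite X" "card X = 2 * m * M" "m > 0" "inj \<zeta>" "\<And>x. x \<in> X \<Longrightarrow> \<zeta> x \<in> X \<and> semiregular_at \<zeta> m x"
  shows "card (perms_with (sqrt_at m \<zeta>) X) * (2 ^ M * fact M) = m ^ M * fact (2 * M)"
  using assms(1,2,5)
proof (induction M arbitrary: X)
  case 0
  then have "X = {}" by simp
  then have "perms_with (sqrt_at m \<zeta>) X = {id}" by (auto simp: perms_with_def)
  then show ?case by simp
next
  case (Suc M)
  note zX = Suc.prems(3)
  define x0 where "x0 = (SOME x. x \<in> X)"
  have "card X > 0" using Suc.prems assms(3) by simp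
  then have x0: "x0 \<in> X" unfolding x0_def by (metis card_gt_0_iff ex_in_conv someI_ex)
  define L where "L = {xs. distinct xs \<and> length xs = 2 * m \<and> set xs \<subseteq> X \<and> hd xs = x0 \<and>
    (\<forall>y\<in>set xs. sqrt_at m \<zeta> (cycle_of_list xs) y)}"
  have zk: "(\<zeta> ^^ k) x \<in> X" if "x \<in> X" for k x
    using that zX by (induction k) auto
  have sub: "set (interleave m \<zeta> x0 y) \<subseteq> X" if "y \<in> X" for y
    using that x0 zk by (auto simp: set_interleave trajectory_def)
  have L: "L = interleave m \<zeta> x0 ` (X - set (trajectory \<zeta> x0 m))"
  proof (intro equalityI subsetI)
    fix xs assume "xs \<in> interleave m \<zeta> x0 ` (X - set (trajectory \<zeta> x0 m))"
    then obtain y where y: "y \<in> X" "y \<notin> set (trajectory \<zeta> x0 m)" "xs = interleave m \<zeta> x0 y" by auto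
    have d: "distinct xs" unfolding y(3) using y zX x0 assms(3,4) by (intro distinct_interleave) auto
    have "\<forall>w\<in>set xs. sqrt_at m \<zeta> (cycle_of_list xs) w"
      using d y zX x0 assms(3) unfolding y(3) by (intro ballI interleave_sqrt) auto
    moreover have "hd xs = x0" using assms(3) y(3) by (simp add: interleave_def hd_map)
    moreover have "length xs = 2 * m" by (simp add: y(3) interleave_def)
    ultimately show "xs \<in> L" using d sub[OF y(1)] y(3) by (simp add: L_def)
  next
    fix xs assume "xs \<in> L"
    then have xs: "distinct xs" "length xs = 2 * m" "set xs \<subseteq> X" "hd xs = x0"
      and sq: "\<And>y. y \<in> set xs \<Longrightarrow> cycle_of_list xs (cycle_of_list xs y) = \<zeta> y"
      by (auto simp: L_def sqrt_at_def)
    define c where "c = cycle_of_list xs"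
    define y where "y = xs ! 1"
    have x0n: "x0 = xs ! 0" using xs(2,4) assms(3) by (metis hd_conv_nth list.size(3) mult_eq_0_iff less_irrefl zero_neq_numeral)
    have c2: "c (c z) = \<zeta> z \<and> \<zeta> z \<in> set xs" if "z \<in> set xs" for z
      using sq[OF that] permutes_in_image[OF cycle_permutes[of xs]] that unfolding c_def by metis
    have nth: "xs ! k = (\<zeta> ^^ (k div 2)) (if even k then x0 else y)" if "k < 2 * m" for k
    proof -
      have m1: "1 < length xs" using xs(2) assms(3) by simp
      have "xs ! k = (c ^^ (2 * (k div 2))) (xs ! (k mod 2))"
        using cycle_of_list_funpow_nth[OF xs(1), of "k mod 2" "2 * (k div 2)"] that xs(2) m1
        by (simp add: c_def)
      also have "\<dots> = (\<zeta> ^^ (k div 2)) (xs ! (k mod 2))"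
        using m1 by (intro sqrt_perm_funpow[of "set xs"] c2) (auto intro!: nth_mem simp: mod_less_divisor intro: less_trans)
      also have "xs ! (k mod 2) = (if even k then x0 else y)"
        by (simp add: x0n y_def mod_2_eq_odd)
      finally show ?thesis .
    qed
    have "xs = interleave m \<zeta> x0 y"
      by (rule nth_equalityI) (simp_all add: xs(2) nth nth_interleave, simp add: interleave_def)
    moreover have "y \<in> X" using nth_mem[of 1 xs] xs(2,3) assms(3) unfolding y_def by auto
    \<comment> \<open>Otherwise one point would stand both at position 1 and at an even
      position.\<close>
    moreover have "y \<notin> set (trajectory \<zeta> x0 m)"
    proof
      assume "y \<in> set (trajectory \<zeta> x0 m)"
      then obtain k where k: "k < m" "y = (\<zeta> ^^ k) x0" by (auto simp: trajectory_def)
      then have "xs ! 1 = xs ! (2 * k)" using nth[of "2 * k"] by (simp add: y_def)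
      then have "1 = 2 * k" using xs(1,2) k assms(3) by (simp add: nth_eq_iff_index_eq)
      then show False by presburger
    qed
    ultimately show "xs \<in> interleave m \<zeta> x0 ` (X - set (trajectory \<zeta> x0 m))" by blast
  qed
  have cL: "card L = m * (2 * M + 1)"
  proof -
    have "inj_on (interleave m \<zeta> x0) (X - set (trajectory \<zeta> x0 m))"
    proof (rule inj_onI)
      fix y z assume "interleave m \<zeta> x0 y = interleave m \<zeta> x0 z"
      then have "interleave m \<zeta> x0 y ! 1 = interleave m \<zeta> x0 z ! 1" by simp
      then show "y = z" using assms(3) by (simp add: nth_interleave)
    qed
    then have "card L = card (X - set (trajectory \<zeta> x0 m))" unfolding L by (rule card_image)
    also have "\<dots> = card X - m"
    proof -
      have "distinct (trajectory \<zeta> x0 m)" using zX[OF x0] assms(3,4) by (intro distinct_trajectory) auto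
      moreover have "set (trajectory \<zeta> x0 m) \<subseteq> X" using zk[OF x0] by (auto simp: trajectory_def)
      ultimately show ?thesis by (subst card_Diff_subset) (simp_all add: distinct_card)
    qed
    finally show ?thesis using Suc.prems(2) by (simp add: algebra_simps)
  qed
  define c where "c = (m ^ M * fact (2 * M)) div (2 ^ M * fact M :: nat)"
  have rest: "card (perms_with (sqrt_at m \<zeta>) (X - set xs)) * (2 ^ M * fact M) = m ^ M * fact (2 * M)" if xs: "xs \<in> L" for xs
  proof (rule Suc.IH)
    show "finite (X - set xs)" using Suc.prems by simp
    have "distinct xs" "length xs = 2 * m" "set xs \<subseteq> X" using xs by (auto simp: L_def)
    then show "card (X - set xs) = 2 * m * M" using Suc.prems by (simp add: card_Diff_subset distinct_card)
    fix x assume x: "x \<in> X - set xs"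
    obtain y where y: "y \<in> X" "xs = interleave m \<zeta> x0 y" using xs unfolding L by blast
    have "\<zeta> x \<notin> set xs"
    proof
      assume "\<zeta> x \<in> set xs"
      then obtain w where w: "\<zeta> x \<in> set (trajectory \<zeta> w m)" "w = x0 \<or> w = y" by (auto simp: y(2) set_interleave)
      have "semiregular_at \<zeta> m w" using w(2) zX x0 y by auto
      then have "x \<in> set (trajectory \<zeta> w m)" by (rule trajectory_backward[OF assms(4) _ assms(3) w(1)])
      then show False using x w(2) y(2) by (auto simp: set_interleave)
    qed
    then show "\<zeta> x \<in> X - set xs \<and> semiregular_at \<zeta> m x" using x zX by auto
  qed
  have nz: "2 ^ M * fact M \<noteq> (0::nat)" by simp
  have "card (perms_with (sqrt_at m \<zeta>) X) = card L * c"
  proof (rule card_perms_with_by_trajectory[OF Suc.prems(1) x0, of "2 * m"])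
    show "card (perms_with (sqrt_at m \<zeta>) (X - set xs)) = c" if "xs \<in> L" for xs
      using rest[OF that] nz unfolding c_def by (metis nonzero_mult_div_cancel_right)
    show "local_property (sqrt_at m \<zeta>)" by (rule local_sqrt)
  qed (use assms(3) in \<open>auto simp: L_def sqrt_at_def\<close>)
  moreover have "c * (2 ^ M * fact M) = m ^ M * fact (2 * M)"
  proof -
    have "L \<noteq> {}" using cL assms(3) by (metis card.empty add_is_0 mult_eq_0_iff neq0_conv one_neq_zero)
    then obtain xs where "xs \<in> L" by blast
    from rest[OF this] show ?thesis using nz unfolding c_def by (metis nonzero_mult_div_cancel_right)
  qed
  ultimately have "card (perms_with (sqrt_at m \<zeta>) X) * (2 ^ Suc M * fact (Suc M)) = (2 * Suc M) * (m * (2 * M + 1)) * (m ^ M * fact (2 * M))"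
  proof -
    assume a: "card (perms_with (sqrt_at m \<zeta>) X) = card L * c" "c * (2 ^ M * fact M) = m ^ M * fact (2 * M)"
    have "card (perms_with (sqrt_at m \<zeta>) X) * (2 ^ Suc M * fact (Suc M)) = (2 * Suc M) * card L * (c * (2 ^ M * fact M))"
      unfolding a(1) by (simp add: algebra_simps)
    then show ?thesis unfolding a(2) cL .
  qed
  also have "\<dots> = m ^ Suc M * fact (2 * Suc M)" by (simp add: algebra_simps)
  finally show ?case .
qed

section \<open>Counting semiregular actions\<close>

definition actions :: "nat \<Rightarrow> 'a set \<Rightarrow> (('a \<Rightarrow> 'a) \<times> ('a \<Rightarrow> 'a)) set" where
  "actions m X = {(\<sigma>, \<tau>). free_action m \<sigma> \<tau> X}"

lemma finite_actions: "finite X \<Longrightarrow> finite (actions m X)"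
  by (rule finite_subset[of _ "{p. p permutes X} \<times> {p. p permutes X}"])
     (auto simp: actions_def free_action_def finite_permutations)

lemma semiregular_at_power:
  assumes "semiregular_at f (k * d) x" "k > 0" "d > 0"
  shows "semiregular_at (f ^^ k) d x"
proof -
  have "((f ^^ k) ^^ i) x = x \<longleftrightarrow> d dvd i" for i
    using semiregular_at_fixed_iff[OF assms(1), of "k * i"] assms(2,3) by (simp add: funpow_mult mult.commute)
  then show ?thesis unfolding semiregular_at_def using dvd_imp_le by (auto simp: not_le)
qed

text \<open>Choose \<tau> first. Then \<sigma> is a square root of \<open>\<tau>^4\<close>, which is
  semiregular of order \<open>m\<close> and has \<open>4 * k\<close> cycles, hence
  \<open>M = 2 * k\<close> pairs.\<close>

lemma card_actions:
  fixes X :: "'a set"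
  assumes "finite X" "card X = 4 * m * k" "m > 0"
  shows "card (actions m X) * ((4 * m) ^ k * fact k * (2 ^ (2 * k) * fact (2 * k))) =
    fact (4 * m * k) * (m ^ (2 * k) * fact (4 * k))"
proof -
  define A where "A = perms_with (\<lambda>f. semiregular_at f (4 * m)) X"
  define B where "B \<tau> = perms_with (sqrt_at m (\<tau> ^^ 4)) X" for \<tau> :: "'a \<Rightarrow> 'a"
  have "actions m X = prod.swap ` Sigma A B"
    by (auto simp: actions_def A_def B_def perms_with_def free_action_def sqrt_at_def numeral_2_eq_2 image_iff)
  then have "card (actions m X) = card (Sigma A B)"
    by (simp add: card_image)
  also have "\<dots> = (\<Sum>\<tau>\<in>A. card (B \<tau>))"
    using assms(1) by (intro card_SigmaI) (auto simp: A_def B_def finite_perms_with)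
  finally have c: "card (actions m X) = (\<Sum>\<tau>\<in>A. card (B \<tau>))" .
  have B: "card (B \<tau>) * (2 ^ (2 * k) * fact (2 * k)) = m ^ (2 * k) * fact (4 * k)" if "\<tau> \<in> A" for \<tau>
  proof -
    have perm: "\<tau> permutes X" using that by (simp add: A_def perms_with_def)
    have "(\<tau> ^^ 4) x \<in> X \<and> semiregular_at (\<tau> ^^ 4) m x" if "x \<in> X" for x
    proof
      have "(\<tau> ^^ j) x \<in> X" for j using that permutes_in_image[OF perm] by (induction j) auto
      then show "(\<tau> ^^ 4) x \<in> X" .
      show "semiregular_at (\<tau> ^^ 4) m x"
        using \<open>\<tau> \<in> A\<close> that assms(3) by (intro semiregular_at_power) (auto simp: A_def perms_with_def)
    qed
    then show ?thesis
      using card_sqrt_perms[of X m "2 * k" "\<tau> ^^ 4"] assms permutes_inj[OF perm] inj_fn by (auto simp: B_def)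
  qed
  have 1: "card (actions m X) * (2 ^ (2 * k) * fact (2 * k)) = card A * (m ^ (2 * k) * fact (4 * k))"
    unfolding c sum_distrib_right by (simp add: B)
  have 2: "card A * ((4 * m) ^ k * fact k) = fact (4 * m * k)"
    unfolding A_def using card_semiregular_perms[of X "4 * m" k] assms by simp
  have "card (actions m X) * ((4 * m) ^ k * fact k * (2 ^ (2 * k) * fact (2 * k))) =
      (card (actions m X) * (2 ^ (2 * k) * fact (2 * k))) * ((4 * m) ^ k * fact k)"
    by (simp only: mult_ac)
  also have "\<dots> = (card A * ((4 * m) ^ k * fact k)) * (m ^ (2 * k) * fact (4 * k))"
    unfolding 1 by (simp only: mult_ac)
  finally show ?thesis unfolding 2 .
qed

text \<open>The analogue of \<open>card_perms_with_agreeing\<close> for pairs, whose condition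
  couples the two permutations.\<close>

lemma card_actions_agreeing:
  assumes YX: "Y \<subseteq> X" and pr: "free_action m p r Y"
  shows "card {s \<in> actions m X. \<forall>y\<in>Y. fst s y = p y \<and> snd s y = r y} = card (actions m (X - Y))"
proof -
  have p: "p permutes Y" and r: "r permutes Y" using pr by (auto simp: free_action_def)
  define good where "good \<sigma> \<tau> x \<longleftrightarrow> (\<sigma> ^^ 2) x = (\<tau> ^^ 4) x \<and> semiregular_at \<sigma> (2 * m) x \<and> semiregular_at \<tau> (4 * m) x" for \<sigma> \<tau> :: "'a \<Rightarrow> 'a" and x
  have act: "s \<in> actions m Z \<longleftrightarrow> fst s permutes Z \<and> snd s permutes Z \<and> (\<forall>x\<in>Z. good (fst s) (snd s) x)" for s Z
    by (cases s) (simp add: actions_def free_action_def good_def)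
  have good: "good \<sigma> \<tau> x \<longleftrightarrow> good \<sigma>' \<tau>' x"
    if "x \<in> Z" "\<And>y. y \<in> Z \<Longrightarrow> \<sigma> y = \<sigma>' y \<and> \<sigma>' y \<in> Z" "\<And>y. y \<in> Z \<Longrightarrow> \<tau> y = \<tau>' y \<and> \<tau>' y \<in> Z" for \<sigma> \<tau> \<sigma>' \<tau>' x Z
    unfolding good_def using funpow_cong_on[of Z \<sigma> \<sigma>' x 2] funpow_cong_on[of Z \<tau> \<tau>' x 4]
      semiregular_at_cong[of Z \<sigma> \<sigma>' x "2 * m"] semiregular_at_cong[of Z \<tau> \<tau>' x "4 * m"] that by simp
  define glue where "glue s = (fst s \<circ> p, snd s \<circ> r)" for s :: "('a \<Rightarrow> 'a) \<times> ('a \<Rightarrow> 'a)"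
  have inY: "p y \<in> Y" "r y \<in> Y" if "y \<in> Y" for y
    using that permutes_in_image[OF p] permutes_in_image[OF r] by auto
  have "{s \<in> actions m X. \<forall>y\<in>Y. fst s y = p y \<and> snd s y = r y} = glue ` actions m (X - Y)"
  proof (intro equalityI subsetI)
    fix s assume s: "s \<in> {s \<in> actions m X. \<forall>y\<in>Y. fst s y = p y \<and> snd s y = r y}"
    then have sX: "fst s permutes X" "snd s permutes X" and sgood: "\<And>x. x \<in> X \<Longrightarrow> good (fst s) (snd s) x"
      and agree: "\<And>y. y \<in> Y \<Longrightarrow> fst s y = p y" "\<And>y. y \<in> Y \<Longrightarrow> snd s y = r y" by (auto simp: act)
    obtain q where q: "q permutes (X - Y)" "fst s = q \<circ> p" using unglue_permutation[OF p sX(1) YX agree(1)] by blast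
    obtain t where t: "t permutes (X - Y)" "snd s = t \<circ> r" using unglue_permutation[OF r sX(2) YX agree(2)] by blast
    have "good q t x" if x: "x \<in> X - Y" for x
    proof -
      have "good (fst s) (snd s) x \<longleftrightarrow> good q t x"
      proof (rule good[OF x])
        show "fst s y = q y \<and> q y \<in> X - Y" if "y \<in> X - Y" for y
          using that glue_permutation(3)[OF p q(1) YX, of y] q(2) permutes_in_image[OF q(1), of y] by auto
        show "snd s y = t y \<and> t y \<in> X - Y" if "y \<in> X - Y" for y
          using that glue_permutation(3)[OF r t(1) YX, of y] t(2) permutes_in_image[OF t(1), of y] by auto
      qed
      then show ?thesis using sgood x by simp
    qed
    then have "(q, t) \<in> actions m (X - Y)" using q(1) t(1) by (simp add: act)
    moreover have "s = glue (q, t)" using q(2) t(2) by (simp add: glue_def prod_eq_iff)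
    ultimately show "s \<in> glue ` actions m (X - Y)" by blast
  next
    fix s assume "s \<in> glue ` actions m (X - Y)"
    then obtain q t where q: "q permutes (X - Y)" and t: "t permutes (X - Y)"
      and qt: "\<And>x. x \<in> X - Y \<Longrightarrow> good q t x" and s: "s = (q \<circ> p, t \<circ> r)"
      by (auto simp: act glue_def)
    have good_s: "good (q \<circ> p) (t \<circ> r) x" if x: "x \<in> X" for x
    proof (cases "x \<in> Y")
      case True
      have "good (q \<circ> p) (t \<circ> r) x \<longleftrightarrow> good p r x"
        using glue_permutation(2)[OF p q YX] glue_permutation(2)[OF r t YX] inY
        by (intro good[OF True]) auto
      then show ?thesis using pr True by (simp add: free_action_def good_def)
    next
      case False
      then have xXY: "x \<in> X - Y" using x by simp
      have "good (q \<circ> p) (t \<circ> r) x \<longleftrightarrow> good q t x"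
      proof (rule good[OF xXY])
        show "(q \<circ> p) y = q y \<and> q y \<in> X - Y" if "y \<in> X - Y" for y
          using that glue_permutation(3)[OF p q YX, of y] permutes_in_image[OF q, of y] by auto
        show "(t \<circ> r) y = t y \<and> t y \<in> X - Y" if "y \<in> X - Y" for y
          using that glue_permutation(3)[OF r t YX, of y] permutes_in_image[OF t, of y] by auto
      qed
      then show ?thesis using qt xXY by simp
    qed
    have "\<forall>y\<in>Y. fst s y = p y \<and> snd s y = r y"
      using glue_permutation(2)[OF p q YX] glue_permutation(2)[OF r t YX] by (simp add: s)
    moreover have "s \<in> actions m X"
      using glue_permutation(1)[OF p q YX] glue_permutation(1)[OF r t YX] good_s by (simp add: act s)
    ultimately show "s \<in> {s \<in> actions m X. \<forall>y\<in>Y. fst s y = p y \<and> snd s y = r y}" by blast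
  qed
  moreover have "inj_on glue (actions m (X - Y))"
    by (rule inj_onI) (auto simp: glue_def prod_eq_iff dest: glue_cancel[OF p] glue_cancel[OF r])
  ultimately show ?thesis by (simp add: card_image)
qed

section \<open>Free subgroups and stabilizers\<close>

text \<open>Induces the homomorphism to the integers modulo \<open>4 * m\<close> with x going to 2
  and y to 1. It certifies that x and y have the full orders 2m and 4m in the group.\<close>

primrec word_weight :: "Gamma_gen gword \<Rightarrow> int" where
  "word_weight [] = 0"
| "word_weight (l # w) = (if snd l then 1 else - 1) * (case fst l of GenX \<Rightarrow> 2 | GenY \<Rightarrow> 1) + word_weight w"

lemma word_weight_append [simp]: "word_weight (v @ w) = word_weight v + word_weight w"
  by (induction v) auto

lemma word_weight_inv [simp]: "word_weight (word_inv w) = - word_weight w"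
  by (induction w) (auto split: Gamma_gen.split)

lemma word_weight_gen_pow [simp]: "word_weight (gen_pow g k) = (case g of GenX \<Rightarrow> 2 * int k | GenY \<Rightarrow> int k)"
  by (induction k) (auto simp: gen_pow_Suc split: Gamma_gen.split)

lemma word_weight_cong:
  "Gamma_equiv m v w \<Longrightarrow> [word_weight v = word_weight w] (mod int (4 * m))"
proof (induction rule: pres_equiv.induct)
  case (sym v w)
  show ?case by (rule cong_sym[OF sym.IH])
next
  case (trans u v w)
  then show ?case by (metis cong_trans)
next
  case (cancel u v x b)
  then show ?case by (cases x; cases b) auto
next
  case (relation u v r s)
  have "[word_weight r = word_weight s] (mod int (4 * m))"
    using relation(3) by (auto simp: Gamma_rels_def cong_def)
  then show ?case by (simp add: cong_add_lcancel cong_add_rcancel)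
qed auto

lemma (in group) rcoset_eq_iff:
  assumes "subgroup H G" "a \<in> carrier G" "b \<in> carrier G"
  shows "H #> a = H #> b \<longleftrightarrow> a \<otimes> inv b \<in> H"
  using assms
  by (metis coset_join1 coset_join2 coset_mult_inv1 coset_mult_inv2 subgroup.subset subgroup_imp_group inv_closed m_closed)

section \<open>The action on the cosets of a free subgroup\<close>

locale free_Gamma_subgroup =
  fixes m :: nat and H :: "Gamma_gen gword set set"
  assumes m_pos: "m > 0" and sub: "subgroup H (Gamma4 m)"
    and free: "is_free_group ((Gamma4 m)\<lparr>carrier := H\<rparr>)"
    and fin: "finite (rcosets\<^bsub>Gamma4 m\<^esub> H)"
begin

definition coset :: "Gamma_gen gword \<Rightarrow> Gamma_gen gword set set" where
  "coset w = H #>\<^bsub>Gamma4 m\<^esub> Gamma_class m w"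

abbreviation cosets :: "Gamma_gen gword set set set" where
  "cosets \<equiv> rcosets\<^bsub>Gamma4 m\<^esub> H"

lemma cosets_eq: "cosets = range coset"
  by (auto simp: RCOSETS_def carrier_Gamma4 coset_def)

lemma coset_in [simp]: "coset w \<in> cosets"
  by (simp add: cosets_eq)

lemma coset_eq_iff: "coset v = coset w \<longleftrightarrow> Gamma_class m (v @ word_inv w) \<in> H"
  unfolding coset_def by (simp add: group.rcoset_eq_iff[OF group_Gamma4 sub] Gamma_class_inv Gamma_class_mult)

lemma coset_Nil: "coset [] = H"
  unfolding coset_def Gamma_class_one[symmetric]
  by (rule group.coset_mult_one[OF group_Gamma4 subgroup.subset[OF sub]])

definition step :: "Gamma_gen \<Rightarrow> Gamma_gen gword set set \<Rightarrow> Gamma_gen gword set set" where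
  "step g c = c #>\<^bsub>Gamma4 m\<^esub> Gamma_class m [(g, True)]"

lemma step_coset: "step g (coset w) = coset (w @ [(g, True)])"
  unfolding step_def coset_def
  by (simp add: group.coset_mult_assoc[OF group_Gamma4 subgroup.subset[OF sub]] Gamma_class_mult)

lemma step_in: "c \<in> cosets \<Longrightarrow> step g c \<in> cosets"
  by (auto simp: cosets_eq step_coset)

lemma coset_cong: "Gamma_equiv m v w \<Longrightarrow> coset v = coset w"
  by (simp add: coset_def Gamma_class_eq_iff[symmetric])

lemma step_funpow: "(step g ^^ i) (coset w) = coset (w @ gen_pow g i)"
proof (induction i)
  case (Suc i)
  have "gen_pow g (Suc i) = gen_pow g i @ [(g, True)]" using gen_pow_add[of g i 1] by (simp add: gen_pow_def)
  then show ?case using Suc by (simp add: step_coset)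
qed simp

lemma bij_step: "bij_betw (step g) cosets cosets"
proof (rule bij_betw_imageI)
  show "inj_on (step g) cosets"
  proof (rule inj_onI)
    fix c d assume cd: "c \<in> cosets" "d \<in> cosets" "step g c = step g d"
    then obtain v w where vw: "c = coset v" "d = coset w" by (auto simp: cosets_eq)
    have "Gamma_equiv m (v @ [(g, True), (g, \<not> True)] @ word_inv w) (v @ word_inv w)"
      by (rule pres_equiv.cancel) (simp_all del: insert_iff)
    then have "Gamma_class m ((v @ [(g, True)]) @ word_inv (w @ [(g, True)])) = Gamma_class m (v @ word_inv w)"
      by (simp add: Gamma_class_eq_iff)
    then show "c = d" using cd(3) unfolding vw step_coset coset_eq_iff by simp
  qed
  have "coset w = step g (coset (w @ [(g, False)]))" for w
    using coset_cong[OF pres_equiv.sym[OF pres_equiv.cancel[of w "{GenX, GenY}" "[]" g "Gamma_rels m" False]]]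
    by (simp add: step_coset del: insert_iff)
  then have "cosets \<subseteq> step g ` cosets" unfolding cosets_eq by blast
  moreover have "step g ` cosets \<subseteq> cosets" using step_in by blast
  ultimately show "step g ` cosets = cosets" by blast
qed

text \<open>The conjugate is a torsion element of a free group, hence trivial, and weights are
  invariant under conjugation.\<close>

lemma torsion_conj:
  assumes "Gamma_class m (v @ u @ word_inv v) \<in> H" "Gamma_equiv m (concat (replicate k u)) []" "k > 0"
  shows "[word_weight u = 0] (mod int (4 * m))"
proof -
  interpret group "Gamma4 m" by (rule group_Gamma4)
  define h where "h = Gamma_class m (v @ u @ word_inv v)"
  have "Gamma_equiv m (concat (replicate k (v @ u @ word_inv v))) (v @ concat (replicate k u) @ word_inv v)"
    by (rule pres_equiv_conj_pow) simp_all
  also have "Gamma_equiv m (v @ concat (replicate k u) @ word_inv v) (v @ [] @ word_inv v)"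
    by (intro pres_equiv_context assms) simp_all
  also (pres_equiv.trans) have "Gamma_equiv m (v @ [] @ word_inv v) []"
    using pres_equiv_word_inv_right[of v "{GenX, GenY}" "Gamma_rels m"] by simp
  finally (pres_equiv.trans) have "h [^]\<^bsub>Gamma4 m\<^esub> k = \<one>\<^bsub>Gamma4 m\<^esub>"
    unfolding h_def Gamma4_eq by (simp add: wclass_pow one_presented_group wclass_eqI)
  then have "h [^]\<^bsub>(Gamma4 m)\<lparr>carrier := H\<rparr>\<^esub> k = \<one>\<^bsub>(Gamma4 m)\<lparr>carrier := H\<rparr>\<^esub>"
    by (simp add: nat_pow_consistent[symmetric])
  then have "h = \<one>\<^bsub>Gamma4 m\<^esub>"
    using free_group_torsion_free[OF subgroup.subgroup_is_group[OF sub group_Gamma4] free, of h k] assms(1,3)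
    by (simp add: h_def)
  then have "Gamma_equiv m (v @ u @ word_inv v) []" by (simp add: h_def Gamma_class_one Gamma_class_eq_iff)
  from word_weight_cong[OF this] show ?thesis by simp
qed

lemma concat_gen_pow: "concat (replicate k (gen_pow g i)) = gen_pow g (k * i)"
  by (induction k) (simp_all add: gen_pow_add)

lemma Gamma_equiv_pow_multiple: "Gamma_equiv m (gen_pow g j) [] \<Longrightarrow> Gamma_equiv m (gen_pow g (k * j)) []"
proof (induction k)
  case (Suc k)
  then have "Gamma_equiv m (gen_pow g j @ gen_pow g (k * j)) ([] @ [])" by (intro pres_equiv_append) auto
  then show ?case by (simp add: gen_pow_add)
qed simp

lemma step_fixed_weight:
  assumes "(step g ^^ i) c = c" "c \<in> cosets"
  shows "[word_weight (gen_pow g i) = 0] (mod int (4 * m))"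
proof -
  obtain v where v: "c = coset v" using assms(2) by (auto simp: cosets_eq)
  have "Gamma_class m (v @ gen_pow g i @ word_inv v) \<in> H"
    using assms(1) by (simp add: v step_funpow coset_eq_iff)
  moreover have "Gamma_equiv m (gen_pow g (4 * m)) []"
    using Gamma_equiv_rels(2) Gamma_equiv_pow_multiple[OF Gamma_equiv_rels(1), of 2] by (cases g) simp_all
  then have "Gamma_equiv m (concat (replicate (4 * m) (gen_pow g i))) []"
    unfolding concat_gen_pow mult.commute[of "4 * m"] by (rule Gamma_equiv_pow_multiple)
  ultimately show ?thesis using torsion_conj[of v "gen_pow g i" "4 * m"] m_pos by simp
qed

text \<open>If a power of a generator fixes a coset, a conjugate of it lies in \<open>H\<close>, so
  its weight is 0 modulo \<open>4 * m\<close>. The weights 2 and 1 then force the exponent to be a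
  multiple of 2m or 4m.\<close>

lemma semiregular_step:
  assumes "c \<in> cosets"
  shows "(step GenX ^^ 2) c = (step GenY ^^ 4) c" "semiregular_at (step GenX) (2 * m) c" "semiregular_at (step GenY) (4 * m) c"
proof -
  obtain v where v: "c = coset v" using assms by (auto simp: cosets_eq)
  have rel: "coset (v @ r) = coset (v @ s)" if "Gamma_equiv m r s" for r s
    by (intro coset_cong pres_equiv_append Gamma_equiv_refl that)
  show "(step GenX ^^ 2) c = (step GenY ^^ 4) c"
    unfolding v step_funpow by (intro rel Gamma_equiv_rels)
  have "\<not> (step GenX ^^ i) c = c" if "0 < i" "i < 2 * m" for i
  proof
    assume "(step GenX ^^ i) c = c"
    then have "int (4 * m) dvd 2 * int i" using step_fixed_weight[where g = GenX and i = i and c = c] assms by (simp add: cong_0_iff)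
    then have "int (4 * m) \<le> 2 * int i" using that(1) by (intro zdvd_imp_le) auto
    then show False using that by simp
  qed
  then show "semiregular_at (step GenX) (2 * m) c"
    using rel[OF Gamma_equiv_rels(1)] by (simp add: semiregular_at_def v step_funpow)
  have "\<not> (step GenY ^^ i) c = c" if "0 < i" "i < 4 * m" for i
  proof
    assume "(step GenY ^^ i) c = c"
    then have "int (4 * m) dvd int i" using step_fixed_weight[where g = GenY and i = i and c = c] assms by (simp add: cong_0_iff)
    then have "int (4 * m) \<le> int i" using that(1) by (intro zdvd_imp_le) auto
    then show False using that by simp
  qed
  then show "semiregular_at (step GenY) (4 * m) c"
    using rel[OF Gamma_equiv_rels(2)] by (simp add: semiregular_at_def v step_funpow)
qed

text \<open>An equivariant embedding of the cosets into \<open>X\<close> with \<open>H \<mapsto> x0\<close> is the same as an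
  orbit of \<open>x0\<close> with stabilizer \<open>H\<close>.\<close>

definition embeddings :: "'a set \<Rightarrow> 'a \<Rightarrow> (Gamma_gen gword set set \<Rightarrow> 'a) set" where
  "embeddings X x0 = {\<psi> \<in> cosets \<rightarrow>\<^sub>E X. inj_on \<psi> cosets \<and> \<psi> H = x0}"

definition equivariant :: "(Gamma_gen gword set set \<Rightarrow> 'a) \<Rightarrow> (('a \<Rightarrow> 'a) \<times> ('a \<Rightarrow> 'a)) \<Rightarrow> bool" where
  "equivariant \<psi> s \<longleftrightarrow> (\<forall>c\<in>cosets. fst s (\<psi> c) = \<psi> (step GenX c) \<and> snd s (\<psi> c) = \<psi> (step GenY c))"

lemma H_in_cosets: "H \<in> cosets"
  using coset_in[of "[]"] by (simp add: coset_Nil)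

text \<open>Enumerating the cosets with \<open>H\<close> first turns embeddings into pointed
  lists.\<close>

lemma card_embeddings:
  assumes "finite X" "x0 \<in> X" "card cosets \<le> card X"
  shows "card (embeddings X x0) * fact (card X - card cosets) = fact (card X - 1)"
proof -
  have pos: "card cosets > 0" using fin H_in_cosets by (auto simp: card_gt_0_iff)
  obtain cs' where cs': "set cs' = cosets - {H}" "distinct cs'"
    using finite_distinct_list[of "cosets - {H}"] fin by auto
  define cs where "cs = H # cs'"
  have cs: "set cs = cosets" "distinct cs" using cs' H_in_cosets by (auto simp: cs_def)
  have len: "length cs = card cosets" using cs distinct_card by metis
  define L where "L = {xs. distinct xs \<and> length xs = card cosets \<and> set xs \<subseteq> X \<and> hd xs = x0}"
  have "bij_betw (\<lambda>\<psi>. map \<psi> cs) (embeddings X x0) L"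
  proof (rule bij_betw_imageI)
    show "inj_on (\<lambda>\<psi>. map \<psi> cs) (embeddings X x0)"
    proof (rule inj_onI)
      fix \<psi> \<psi>' assume "\<psi> \<in> embeddings X x0" "\<psi>' \<in> embeddings X x0" "map \<psi> cs = map \<psi>' cs"
      then show "\<psi> = \<psi>'" unfolding embeddings_def using cs(1) by (intro PiE_ext[of \<psi> cosets "\<lambda>_. X" \<psi>']) auto
    qed
    show "(\<lambda>\<psi>. map \<psi> cs) ` embeddings X x0 = L"
    proof (intro equalityI subsetI)
      fix xs assume "xs \<in> (\<lambda>\<psi>. map \<psi> cs) ` embeddings X x0"
      then show "xs \<in> L" using cs len by (auto simp: L_def embeddings_def distinct_map cs_def[symmetric])
         (auto simp: cs_def)
    next
      fix xs assume xs: "xs \<in> L"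
      define \<psi> where "\<psi> = (\<lambda>c. if c \<in> cosets then the (map_of (zip cs xs) c) else undefined)"
      have lx: "length cs = length xs" using xs len by (simp add: L_def)
      have nth: "\<psi> (cs ! i) = xs ! i" if "i < length cs" for i
        using map_of_zip_nth[OF lx cs(2), of i] that lx cs(1) nth_mem[OF that] by (simp add: \<psi>_def)
      have map: "map \<psi> cs = xs" by (rule nth_equalityI) (use lx nth in auto)
      have "inj_on \<psi> cosets" using xs map cs by (metis (mono_tags, lifting) L_def distinct_map mem_Collect_eq)
      moreover have "\<psi> ` cosets \<subseteq> X" using xs map cs(1) unfolding L_def by (metis (mono_tags, lifting) list.set_map mem_Collect_eq)
      moreover have "\<psi> H = x0" using xs map by (auto simp: L_def cs_def)
      ultimately have "\<psi> \<in> embeddings X x0" by (auto simp: embeddings_def \<psi>_def)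
      then show "xs \<in> (\<lambda>\<psi>. map \<psi> cs) ` embeddings X x0" using map by blast
    qed
  qed
  then have "card (embeddings X x0) = card L" by (rule bij_betw_same_card)
  then show ?thesis using card_pointed_lists[OF assms(1,2) pos assms(3)] by (simp add: L_def)
qed

text \<open>An embedding prescribes the action on its image by transport of structure; only an
  action on the complement remains to be chosen.\<close>

lemma card_equivariant:
  assumes "\<psi> \<in> embeddings X x0"
  shows "card {s \<in> actions m X. equivariant \<psi> s} = card (actions m (X - \<psi> ` cosets))"
proof -
  define Y where "Y = \<psi> ` cosets"
  have inj: "inj_on \<psi> cosets" and YX: "Y \<subseteq> X" using assms by (auto simp: embeddings_def Y_def)
  have bij: "bij_betw \<psi> cosets Y" using inj by (simp add: Y_def bij_betw_def)
  define p where "p g y = (if y \<in> Y then \<psi> (step g (inv_into cosets \<psi> y)) else y)" for g y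
  have p: "p g (\<psi> c) = \<psi> (step g c)" if "c \<in> cosets" for g c
    using that inj by (simp add: p_def Y_def)
  have perm: "p g permutes Y" for g
  proof (rule bij_imp_permutes)
    have "bij_betw (\<psi> \<circ> (step g \<circ> inv_into cosets \<psi>)) Y Y"
      using bij_betw_trans[OF bij_betw_trans[OF bij_betw_inv_into[OF bij] bij_step] bij] by (simp add: comp_assoc)
    then show "bij_betw (p g) Y Y" by (rule bij_betw_cong[THEN iffD1, rotated]) (simp add: p_def)
  qed (simp add: p_def)
  have pow: "(p g ^^ i) (\<psi> c) = \<psi> ((step g ^^ i) c) \<and> (step g ^^ i) c \<in> cosets" if "c \<in> cosets" for g c i
    using that by (induction i) (auto simp: p step_in)
  have semi: "semiregular_at (p g) d (\<psi> c) \<longleftrightarrow> semiregular_at (step g) d c" if "c \<in> cosets" for g d c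
    unfolding semiregular_at_def using pow[OF that] inj_on_eq_iff[OF inj _ that] by simp
  have "free_action m (p GenX) (p GenY) Y"
    unfolding free_action_def using perm pow semi semiregular_step by (auto simp: Y_def)
  from card_actions_agreeing[OF YX this]
  have "card {s \<in> actions m X. \<forall>y\<in>Y. fst s y = p GenX y \<and> snd s y = p GenY y} = card (actions m (X - Y))" .
  moreover have "(\<forall>y\<in>Y. fst s y = p GenX y \<and> snd s y = p GenY y) \<longleftrightarrow> equivariant \<psi> s" for s
    by (auto simp: Y_def equivariant_def p)
  ultimately show ?thesis by (simp add: Y_def)
qed

lemma equivariant_word_act:
  assumes "s \<in> actions m X" "equivariant \<psi> s"
  shows "word_act (fst s) (snd s) w (\<psi> (coset v)) = \<psi> (coset (v @ w))"
proof (induction w arbitrary: v)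
  case (Cons l w)
  obtain g b where l: "l = (g, b)" by (cases l)
  have inj: "inj (fst s)" "inj (snd s)"
    using assms(1) permutes_inj by (auto simp: actions_def free_action_def)
  have e: "fst s (\<psi> (coset v)) = \<psi> (coset (v @ [(GenX, True)]))" "snd s (\<psi> (coset v)) = \<psi> (coset (v @ [(GenY, True)]))" for v
    using assms(2) by (simp_all add: equivariant_def step_coset)
  have undo: "coset ((v @ [(g, False)]) @ [(g, True)]) = coset v" for g
    using coset_cong[OF pres_equiv.cancel[of v "{GenX, GenY}" "[]" g "Gamma_rels m" False]] by (simp del: insert_iff)
  have "letter_act (fst s) (snd s) l (\<psi> (coset v)) = \<psi> (coset (v @ [l]))"
  proof (cases b)
    case True
    then show ?thesis using e by (cases g) (simp_all add: l)
  next
    case False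
    have "fst s (\<psi> (coset (v @ [(GenX, False)]))) = \<psi> (coset v)" "snd s (\<psi> (coset (v @ [(GenY, False)]))) = \<psi> (coset v)"
      unfolding e undo by simp_all
    then show ?thesis using False inj by (cases g) (simp_all add: l inv_f_eq)
  qed
  then show ?case using Cons[of "v @ [l]"] by simp
qed simp

text \<open>An action with stabilizer \<open>H\<close> determines its embedding, which sends the
  coset of \<open>w\<close> to the image of \<open>x0\<close> under \<open>w\<close>. So the actions
  split disjointly over the embeddings.\<close>

lemma card_stabilizer_fiber:
  assumes "finite X" "x0 \<in> X"
    and N: "\<And>Y. Y \<subseteq> X \<Longrightarrow> card Y = card cosets \<Longrightarrow> card (actions m (X - Y)) = N"
  shows "card {s \<in> actions m X. stabilizer m (fst s) (snd s) x0 = H} = card (embeddings X x0) * N"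
proof -
  define F where "F \<psi> = {s \<in> actions m X. equivariant \<psi> s}" for \<psi>
  have act: "gamma_action m (fst s) (snd s) X" if "s \<in> actions m X" for s
    using that m_pos by (auto simp: gamma_action_def actions_def)
  have "{s \<in> actions m X. stabilizer m (fst s) (snd s) x0 = H} = (\<Union>\<psi>\<in>embeddings X x0. F \<psi>)"
  proof (intro equalityI subsetI)
    fix s assume "s \<in> (\<Union>\<psi>\<in>embeddings X x0. F \<psi>)"
    then obtain \<psi> where \<psi>: "\<psi> \<in> embeddings X x0" and s: "s \<in> actions m X" "equivariant \<psi> s" by (auto simp: F_def)
    have x0: "x0 = \<psi> (coset [])" using \<psi> by (simp add: embeddings_def coset_Nil)
    have inj: "inj_on \<psi> cosets" using \<psi> by (simp add: embeddings_def)
    have "word_act (fst s) (snd s) w x0 = x0 \<longleftrightarrow> Gamma_class m w \<in> H" for w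
    proof -
      have "word_act (fst s) (snd s) w x0 = x0 \<longleftrightarrow> \<psi> (coset w) = \<psi> (coset [])"
        using equivariant_word_act[OF s, of w "[]"] x0 by simp
      also have "\<dots> \<longleftrightarrow> coset w = coset []" by (rule inj_on_eq_iff[OF inj]) simp_all
      finally show ?thesis by (simp add: coset_eq_iff)
    qed
    then have "stabilizer m (fst s) (snd s) x0 = {Gamma_class m w | w. Gamma_class m w \<in> H}"
      by (simp add: stabilizer_def)
    also have "\<dots> = H" using subgroup.subset[OF sub] by (auto simp: carrier_Gamma4)
    finally show "s \<in> {s \<in> actions m X. stabilizer m (fst s) (snd s) x0 = H}" using s by simp
  next
    fix s assume "s \<in> {s \<in> actions m X. stabilizer m (fst s) (snd s) x0 = H}"
    then have s: "s \<in> actions m X" and st: "stabilizer m (fst s) (snd s) x0 = H" by auto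
    interpret gamma_action m "fst s" "snd s" X by (rule act[OF s])
    have act_eq: "act v x0 = act w x0 \<longleftrightarrow> coset v = coset w" for v w
      using act_eq_iff_coset[of v x0 w] by (simp add: st coset_def)
    define \<psi> where "\<psi> = (\<lambda>c. if c \<in> cosets then act (SOME w. c = coset w) x0 else undefined)"
    have \<psi>: "\<psi> (coset w) = act w x0" for w
    proof -
      have "coset w = coset (SOME v. coset w = coset v)" by (rule someI[of _ w]) simp
      then show ?thesis by (simp add: \<psi>_def act_eq)
    qed
    have "inj_on \<psi> cosets" by (rule inj_onI) (auto simp: cosets_eq \<psi> act_eq)
    moreover have "\<psi> \<in> cosets \<rightarrow>\<^sub>E X"
    proof (rule PiE_I)
      fix c assume "c \<in> cosets"
      then obtain w where "c = coset w" by (auto simp: cosets_eq)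
      then show "\<psi> c \<in> X" using act_in[OF assms(2)] by (simp add: \<psi>)
    qed (simp add: \<psi>_def)
    moreover have "\<psi> H = x0" using \<psi>[of "[]"] by (simp add: coset_Nil)
    ultimately have "\<psi> \<in> embeddings X x0" by (simp add: embeddings_def)
    moreover have "equivariant \<psi> s"
      unfolding equivariant_def by (auto simp: cosets_eq step_coset \<psi>)
    ultimately show "s \<in> (\<Union>\<psi>\<in>embeddings X x0. F \<psi>)" using s by (auto simp: F_def)
  qed
  then have "card {s \<in> actions m X. stabilizer m (fst s) (snd s) x0 = H} = card (\<Union>\<psi>\<in>embeddings X x0. F \<psi>)"
    by simp
  also have "\<dots> = (\<Sum>\<psi>\<in>embeddings X x0. card (F \<psi>))"
  proof (rule card_UN_disjoint)
    show "finite (embeddings X x0)"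
      by (rule finite_subset[of _ "cosets \<rightarrow>\<^sub>E X"]) (use fin assms(1) in \<open>auto simp: embeddings_def intro: finite_PiE\<close>)
    show "\<forall>\<psi>\<in>embeddings X x0. finite (F \<psi>)" using finite_actions[OF assms(1)] by (simp add: F_def)
    show "\<forall>\<psi>\<in>embeddings X x0. \<forall>\<psi>'\<in>embeddings X x0. \<psi> \<noteq> \<psi>' \<longrightarrow> F \<psi> \<inter> F \<psi>' = {}"
    proof (intro ballI impI, rule ccontr)
      fix \<psi> \<psi>' assume \<psi>: "\<psi> \<in> embeddings X x0" "\<psi>' \<in> embeddings X x0" "\<psi> \<noteq> \<psi>'" "F \<psi> \<inter> F \<psi>' \<noteq> {}"
      then obtain s where s: "s \<in> actions m X" "equivariant \<psi> s" "equivariant \<psi>' s" by (auto simp: F_def)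
      have "\<psi> (coset w) = \<psi>' (coset w)" for w
        using equivariant_word_act[OF s(1,2), of w "[]"] equivariant_word_act[OF s(1,3), of w "[]"] \<psi>(1,2)
        by (simp add: coset_Nil embeddings_def)
      then have "\<psi> = \<psi>'"
        using \<psi>(1,2) unfolding embeddings_def by (intro PiE_ext[of \<psi> cosets "\<lambda>_. X" \<psi>']) (auto simp: cosets_eq)
      then show False using \<psi>(3) by simp
    qed
  qed
  also have "\<dots> = (\<Sum>\<psi>\<in>embeddings X x0. N)"
  proof (rule sum.cong[OF HOL.refl])
    fix \<psi> assume \<psi>: "\<psi> \<in> embeddings X x0"
    then have "\<psi> ` cosets \<subseteq> X" "card (\<psi> ` cosets) = card cosets" by (auto simp: embeddings_def card_image)
    then show "card (F \<psi>) = N" unfolding F_def card_equivariant[OF \<psi>] by (rule N)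
  qed
  finally show ?thesis by simp
qed

end

section \<open>The recurrence for the free subgroup numbers\<close>

lemma fact_double_odd:
  "(\<Prod>j<N. 1 + 2 * int j) * (2 ^ N * fact N) = fact (2 * N)"
proof (induction N)
  case (Suc N)
  have "(\<Prod>j<Suc N. 1 + 2 * int j) * (2 ^ Suc N * fact (Suc N)) =
    ((\<Prod>j<N. 1 + 2 * int j) * (2 ^ N * fact N)) * ((1 + 2 * int N) * (2 * (1 + int N)))"
    by (simp add: mult_ac)
  then show ?case unfolding Suc.IH by (simp add: algebra_simps)
qed simp

lemma card_actions_hyp_coeff:
  assumes "finite X" "card X = 4 * m * k" "m > 0"
  shows "of_nat (card (actions m X)) = fact (4 * m * k) * hyp_coeff m 0 k"
proof -
  define P :: rat where "P = of_int (\<Prod>j<2 * k. 1 + 2 * int j)"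
  have h: "hyp_coeff m 0 k * 4 ^ k * fact k = of_nat m ^ k * P"
    using hyp_coeff_prod[of m 0 k] by (simp add: P_def)
  have P: "P * (2 ^ (2 * k) * fact (2 * k)) = fact (4 * k)"
    using arg_cong[OF fact_double_odd[of "2 * k"], of "of_int :: int \<Rightarrow> rat"] by (simp add: P_def)
  define D :: rat where "D = (4 * of_nat m) ^ k * fact k * (2 ^ (2 * k) * fact (2 * k))"
  have D0: "D \<noteq> 0" using assms(3) by (simp add: D_def)
  have "of_nat (card (actions m X)) * D = fact (4 * m * k) * (of_nat m ^ (2 * k) * fact (4 * k))"
    using arg_cong[OF card_actions[OF assms], of "of_nat :: nat \<Rightarrow> rat"] by (simp add: D_def)
  also have "\<dots> = fact (4 * m * k) * (of_nat m ^ k * (of_nat m ^ k * P) * (2 ^ (2 * k) * fact (2 * k)))"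
    unfolding P[symmetric] mult_2[of k] power_add by (simp only: mult_ac)
  also have "\<dots> = fact (4 * m * k) * hyp_coeff m 0 k * D"
    unfolding h[symmetric] D_def by (simp add: power_mult_distrib mult_ac)
  finally show ?thesis using D0 by simp
qed

text \<open>The index is the size of the orbit of \<open>x0\<close>, a multiple of
  \<open>4 * m\<close> because \<tau> is semiregular on it.\<close>

lemma stabilizer_in_free_subgroups4:
  assumes "finite X" "x0 \<in> X" "m > 0" "s \<in> actions m X"
  shows "\<exists>l>0. 4 * m * l \<le> card X \<and> stabilizer m (fst s) (snd s) x0 \<in> free_subgroups4 m l"
proof -
  interpret pointed_gamma_action m "fst s" "snd s" X x0
    using assms by unfold_locales (auto simp: actions_def)
  have sub: "orb \<subseteq> X" using orb_subset by blast
  then have fin: "finite orb" using assms(1) finite_subset by blast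
  have "4 * m dvd card orb"
    using m_pos bij_is_inj[OF bij(2)] step_in_orb(2) semireg(2) orb_subset fin
    by (intro semiregular_dvd_card[of orb "snd s" "4 * m"]) auto
  then obtain l where l: "card orb = 4 * m * l" by (elim dvdE)
  have "card orb > 0" using fin x0_in_orb by (auto simp: card_gt_0_iff)
  then have "l > 0" using l by simp
  moreover have "4 * m * l \<le> card X" using card_mono[OF assms(1) sub] l by simp
  moreover have "stabilizer m (fst s) (snd s) x0 \<in> free_subgroups4 m l"
    unfolding free_subgroups4_def
    using subgroup_stabilizer is_free_group_stabilizer card_rcosets_stabilizer[of x0] l by (simp add: orb_def)
  ultimately show ?thesis by blast
qed

lemma free_subgroups4_locale:
  assumes "m > 0" "l > 0" "H \<in> free_subgroups4 m l"
  shows "free_Gamma_subgroup m H"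
  using assms unfolding free_Gamma_subgroup_def free_subgroups4_def by (auto intro: card_ge_0_finite)

text \<open>The factorial of the size of the complement cancels between embeddings and actions, so
  the count depends on \<open>H\<close> only through its index.\<close>

lemma card_stabilizer_fiber_hyp_coeff:
  assumes "finite X" "x0 \<in> X" "card X = 4 * m * k" "m > 0" "0 < l" "l \<le> k" "H \<in> free_subgroups4 m l"
  shows "of_nat (card {s \<in> actions m X. stabilizer m (fst s) (snd s) x0 = H}) =
    fact (4 * m * k - 1) * hyp_coeff m 0 (k - l)"
proof -
  interpret free_Gamma_subgroup m H by (rule free_subgroups4_locale[OF assms(4,5,7)])
  have c: "card cosets = 4 * m * l" using assms(7) by (simp add: free_subgroups4_def)
  define N where "N = card (actions m {..<4 * m * (k - l)})"
  have N: "of_nat N = fact (4 * m * (k - l)) * hyp_coeff m 0 (k - l)"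
    unfolding N_def by (rule card_actions_hyp_coeff) (simp_all add: assms(4))
  have NY: "card (actions m (X - Y)) = N" if "Y \<subseteq> X" "card Y = card cosets" for Y
  proof -
    have "card (X - Y) = 4 * m * (k - l)"
      using that assms(1,3) c by (simp add: card_Diff_subset finite_subset diff_mult_distrib2)
    then have "of_nat (card (actions m (X - Y))) = (of_nat N :: rat)"
      unfolding N using assms(1,4) by (intro card_actions_hyp_coeff) auto
    then show ?thesis by simp
  qed
  have le: "card cosets \<le> card X" using c assms(3,6) by simp
  have kl: "4 * m * k - 4 * m * l = 4 * m * (k - l)" by (simp add: diff_mult_distrib2)
  have "card (embeddings X x0) * fact (4 * m * (k - l)) = fact (4 * m * k - 1)"
    using card_embeddings[OF assms(1,2) le] c assms(3) kl by simp
  then have e: "of_nat (card (embeddings X x0)) * fact (4 * m * (k - l)) = (fact (4 * m * k - 1) :: rat)"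
    by (metis of_nat_fact of_nat_mult)
  have "card {s \<in> actions m X. stabilizer m (fst s) (snd s) x0 = H} = card (embeddings X x0) * N"
    by (rule card_stabilizer_fiber[OF assms(1,2) NY])
  then show ?thesis by (simp only: of_nat_mult N mult.assoc[symmetric] e)
qed

text \<open>Classify the actions on \<open>4 * m * k\<close> points by the stabilizer of the point 0
  and divide by \<open>fact (4 * m * k - 1)\<close>.\<close>

lemma f4_recurrence:
  assumes "m > 0" "k > 0"
  shows "of_nat (4 * m * k) * hyp_coeff m 0 k = (\<Sum>l=1..k. of_nat (f4 m l) * hyp_coeff m 0 (k - l))"
proof -
  define X where "X = {..<4 * m * k}"
  have X: "finite X" "0 \<in> X" "card X = 4 * m * k" using assms by (simp_all add: X_def)
  define st where "st s = stabilizer m (fst s) (snd s) 0" for s :: "(nat \<Rightarrow> nat) \<times> (nat \<Rightarrow> nat)"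
  define fib where "fib H = {s \<in> actions m X. st s = H}" for H
  define FS where "FS = (\<Union>l\<in>{1..k}. free_subgroups4 m l)"
  have fib: "of_nat (card (fib H)) = fact (4 * m * k - 1) * hyp_coeff m 0 (k - l)"
    if "l \<in> {1..k}" "H \<in> free_subgroups4 m l" for H l
    unfolding fib_def st_def using that X assms by (intro card_stabilizer_fiber_hyp_coeff) auto
  have h0: "hyp_coeff m 0 j > 0" for j
    using assms(1) by (auto simp: hyp_coeff_def intro!: divide_pos_pos mult_pos_pos pochhammer_pos)
  have finA: "finite (actions m X)" by (rule finite_actions[OF X(1)])
  \<comment> \<open>\<open>f4\<close> is a cardinality, which would be 0 for an infinite set. Each
    of these subgroups has a nonempty fiber, hence is a stabilizer of one of finitely many
    actions.\<close>
  have finFS: "finite FS"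
  proof (rule finite_subset[of _ "st ` actions m X"])
    show "FS \<subseteq> st ` actions m X"
    proof
      fix H assume "H \<in> FS"
      then obtain l where l: "l \<in> {1..k}" "H \<in> free_subgroups4 m l" by (auto simp: FS_def)
      have "of_nat (card (fib H)) \<noteq> (0::rat)" unfolding fib[OF l] using h0[of "k - l"] by simp
      then have "fib H \<noteq> {}" by auto
      then show "H \<in> st ` actions m X" by (auto simp: fib_def)
    qed
  qed (use finA in simp)
  have "actions m X = (\<Union>H\<in>FS. fib H)"
  proof (intro equalityI subsetI)
    fix s assume s: "s \<in> actions m X"
    obtain l where l: "l > 0" "4 * m * l \<le> card X" "st s \<in> free_subgroups4 m l"
      using stabilizer_in_free_subgroups4[OF X(1,2) assms(1) s] unfolding st_def by blast
    have "l \<le> k" using l(2) X(3) assms(1) by simp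
    then have "st s \<in> FS" using l unfolding FS_def by force
    then show "s \<in> (\<Union>H\<in>FS. fib H)" using s by (auto simp: fib_def)
  qed (auto simp: fib_def)
  then have "card (actions m X) = card (\<Union>H\<in>FS. fib H)" by simp
  also have "\<dots> = (\<Sum>H\<in>FS. card (fib H))"
    using finFS finA by (intro card_UN_disjoint) (auto simp: fib_def)
  also have "\<dots> = (\<Sum>l=1..k. \<Sum>H\<in>free_subgroups4 m l. card (fib H))"
    unfolding FS_def
  proof (rule sum.UNION_disjoint)
    show "\<forall>l\<in>{1..k}. finite (free_subgroups4 m l)"
      using finFS by (auto simp: FS_def intro: finite_subset)
    show "\<forall>i\<in>{1..k}. \<forall>j\<in>{1..k}. i \<noteq> j \<longrightarrow> free_subgroups4 m i \<inter> free_subgroups4 m j = {}"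
      using assms(1) by (auto simp: free_subgroups4_def)
  qed simp
  finally have "of_nat (card (actions m X)) = (\<Sum>l=1..k. \<Sum>H\<in>free_subgroups4 m l. of_nat (card (fib H)) :: rat)"
    by simp
  also have "\<dots> = (\<Sum>l=1..k. of_nat (f4 m l) * (fact (4 * m * k - 1) * hyp_coeff m 0 (k - l)))"
    by (rule sum.cong[OF HOL.refl]) (simp add: fib f4_def)
  also have "\<dots> = fact (4 * m * k - 1) * (\<Sum>l=1..k. of_nat (f4 m l) * hyp_coeff m 0 (k - l))"
    by (simp add: sum_distrib_left mult_ac)
  also have "of_nat (card (actions m X)) = fact (4 * m * k) * hyp_coeff m 0 k"
    by (rule card_actions_hyp_coeff[OF X(1,3) assms(1)])
  also have "(fact (4 * m * k) :: rat) = of_nat (4 * m * k) * fact (4 * m * k - 1)"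
    using assms by (intro fact_reduce) simp
  finally show ?thesis by (simp add: mult_ac)
qed

text \<open>The generating function form of \<open>f4_recurrence\<close>; the constant term 1 of
  \<open>F4\<close> accounts for the summand \<open>hyp_series m 0\<close>.\<close>

lemma F4_hyp_series:
  assumes "m > 0"
  shows "rat_fps_of_int_fps (F4 m) * hyp_series m 0 =
    hyp_series m 0 + fps_const (4 * of_nat m) * fps_X * fps_deriv (hyp_series m 0)"
proof (rule fps_ext)
  fix n
  have F: "rat_fps_of_int_fps (F4 m) $ l = (if l = 0 then 1 else of_nat (f4 m l))" for l
    by (simp add: rat_fps_of_int_fps_def F4_def)
  show "(rat_fps_of_int_fps (F4 m) * hyp_series m 0) $ n =
    (hyp_series m 0 + fps_const (4 * of_nat m) * fps_X * fps_deriv (hyp_series m 0)) $ n"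
  proof (cases n)
    case 0
    then show ?thesis by (simp add: F hyp_series_def mult.assoc)
  next
    case (Suc k)
    have "(rat_fps_of_int_fps (F4 m) * hyp_series m 0) $ n =
       hyp_coeff m 0 n + (\<Sum>l=1..n. of_nat (f4 m l) * hyp_coeff m 0 (n - l))"
      unfolding fps_mult_nth by (subst sum.atLeast_Suc_atMost) (simp_all add: F hyp_series_def)
    also have "\<dots> = hyp_coeff m 0 n + of_nat (4 * m * n) * hyp_coeff m 0 n"
      using f4_recurrence[OF assms, of n] Suc by simp
    finally show ?thesis using Suc by (simp add: hyp_series_def mult.assoc distrib_left)
  qed
qed

theorem theorem21:
  fixes m \<alpha> p :: nat
  assumes "m > 0" and "\<alpha> > 0" and "prime p"
  shows "([p = 1] (mod 4) \<longrightarrow>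
      degree (Q4 m ((p - 1) div 4)) = (p - 1) div 4 \<and>
      (\<exists>P :: int poly.
        fps_cong_mod (rat_fps_of_int_fps (F4 m))
          (rat_fps_of_int_poly P * inverse (fps_of_poly (Q4 m ((p - 1) div 4)) ^ \<alpha>)) (p ^ \<alpha>)))
    \<and> ([p = 3] (mod 4) \<longrightarrow>
      degree (Q4 m ((p - 3) div 4)) = (p - 3) div 4 \<and>
      (\<exists>P :: int poly.
        fps_cong_mod (rat_fps_of_int_fps (F4 m))
          (rat_fps_of_int_poly P * inverse (fps_of_poly (Q4 m ((p - 3) div 4)) ^ \<alpha>)) (p ^ \<alpha>)))"
proof (intro conjI impI degree_Q4 assms(1))
  assume "[p = 1] (mod 4)"
  then have "p = 4 * ((p - 1) div 4) + 1" unfolding cong_def by presburger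
  then show "\<exists>P. fps_cong_mod (rat_fps_of_int_fps (F4 m))
      (rat_fps_of_int_poly P * inverse (fps_of_poly (Q4 m ((p - 1) div 4)) ^ \<alpha>)) (p ^ \<alpha>)"
    by (intro hyp_quotient_congruent_rational F4_hyp_series assms disjI1)
next
  assume "[p = 3] (mod 4)"
  then have "p = 4 * ((p - 3) div 4) + 3" unfolding cong_def by presburger
  then show "\<exists>P. fps_cong_mod (rat_fps_of_int_fps (F4 m))
      (rat_fps_of_int_poly P * inverse (fps_of_poly (Q4 m ((p - 3) div 4)) ^ \<alpha>)) (p ^ \<alpha>)"
    by (intro hyp_quotient_congruent_rational F4_hyp_series assms disjI2)
qed

end
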